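(* Let $d\ge 1$ and let $b_d$ be the Weyl symbol of the inverse $H^{-1}$ of the harmonic oscillator $H=-\Delta+|x|^2$ on $\mathbf R^d$. Then there is a constant $C>0$ such that $$|\partial^{\alpha}b_d(x,\xi)|\le C^{|\alpha|+1}(\alpha!)^{(s+1)/2}\langle (x,\xi)\rangle^{-2-s|\alpha|}$$ holds for every $(x,\xi)\in\mathbf R^{2d}$, every $\alpha\in\mathbf N^{2d}$ and every $s\in[0,1]$ (so $C$ is independent of $\alpha$, $s$ and $(x,\xi)$).
   Context: $\mathbf N=\{0,1,2,\dots\}$ and $\langle X\rangle=(1+|X|^2)^{1/2}$ for $X=(x,\xi)\in\mathbf R^{2d}$. The harmonic oscillator $H=-\Delta+|x|^2$ on $\mathbf R^d$ is strictly positive on $L^2(\mathbf R^d)$ with discrete spectrum and is invertible. The Weyl symbol of $H^{-1}$ is the (unique, smooth) function $b_d$ on $\mathbf R^{2d}$ such that, in the sense of Weyl quantization (oscillatory integrals), $$H^{-1}f(x)=(2\pi)^{-d}\iint e^{i\langle x-y,\xi\rangle}\,b_d\big((x+y)/2,\xi\big)f(y)\,dy\,d\xi,\qquad f\in\mathscr S(\mathbf R^d).$$ *)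

theory Defs
  imports "HOL-Analysis.Analysis"
begin

definition partial_deriv :: "'a::euclidean_space \<Rightarrow> ('a \<Rightarrow> complex) \<Rightarrow> 'a \<Rightarrow> complex" where
  "partial_deriv i f x = frechet_derivative f (at x) i"

text \<open>All iterated partial derivatives exist and are differentiable, i.e. \<open>f\<close> is \<open>C\<^sup>\<infinity>\<close>.\<close>

definition smooth :: "('a::euclidean_space \<Rightarrow> complex) \<Rightarrow> bool" where
  "smooth f \<longleftrightarrow> (\<forall>is. set is \<subseteq> Basis \<longrightarrow> (\<forall>x. foldr partial_deriv is f differentiable (at x)))"

text \<open>
  A multi-index is a function \<open>\<alpha> :: 'a \<Rightarrow> nat\<close> of which only the values on \<open>Basis\<close> matter.
  The derivative \<open>\<partial>\<^sup>\<alpha>\<close> is composed along an arbitrary enumeration of \<open>Basis\<close>; for smooth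
  functions it does not depend on the enumeration, as partial derivatives commute.
\<close>

definition basis_list :: "'a::euclidean_space list" where
  "basis_list = (SOME is. distinct is \<and> set is = Basis)"

lemma basis_list: "distinct (basis_list :: 'a::euclidean_space list)"
  "set (basis_list :: 'a list) = Basis"
proof -
  have "\<exists>is::'a list. distinct is \<and> set is = Basis"
    using finite_distinct_list[OF finite_Basis] by blast
  from someI_ex[OF this] show "distinct (basis_list :: 'a list)" "set (basis_list :: 'a list) = Basis"
    unfolding basis_list_def by auto
qed

definition multi_deriv :: "('a::euclidean_space \<Rightarrow> nat) \<Rightarrow> ('a \<Rightarrow> complex) \<Rightarrow> 'a \<Rightarrow> complex" where
  "multi_deriv \<alpha> f = foldr (\<lambda>i. partial_deriv i ^^ \<alpha> i) basis_list f"

definition multi_size :: "('a::euclidean_space \<Rightarrow> nat) \<Rightarrow> nat" where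
  "multi_size \<alpha> = (\<Sum>i\<in>Basis. \<alpha> i)"

definition multi_fact :: "('a::euclidean_space \<Rightarrow> nat) \<Rightarrow> nat" where
  "multi_fact \<alpha> = (\<Prod>i\<in>Basis. fact (\<alpha> i))"

definition bracket :: "'a::euclidean_space \<Rightarrow> real" where
  "bracket x = sqrt (1 + (norm x)\<^sup>2)"

definition schwartz :: "('a::euclidean_space \<Rightarrow> complex) \<Rightarrow> bool" where
  "schwartz f \<longleftrightarrow> smooth f \<and>
     (\<forall>\<alpha> k. \<exists>C. \<forall>x. bracket x ^ k * norm (multi_deriv \<alpha> f x) \<le> C)"

definition square_integrable :: "('a::euclidean_space \<Rightarrow> complex) \<Rightarrow> bool" where
  "square_integrable u \<longleftrightarrow>
     u \<in> borel_measurable lborel \<and> integrable lborel (\<lambda>x. (norm (u x))\<^sup>2)"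

definition harmonic_expr :: "('a::euclidean_space \<Rightarrow> complex) \<Rightarrow> 'a \<Rightarrow> complex" where
  "harmonic_expr \<phi> x =
     - (\<Sum>i\<in>Basis. partial_deriv i (partial_deriv i \<phi>) x) + of_real ((norm x)\<^sup>2) * \<phi> x"

text \<open>
  The graph of the self-adjoint operator \<open>-\<Delta> + |x|\<^sup>2\<close> in \<open>L\<^sup>2\<close>, on its maximal domain: the
  equation \<open>H u = v\<close> is understood in the sense of tempered distributions.
  Elements of \<open>L\<^sup>2\<close> are represented by functions, so \<open>u\<close> and \<open>v\<close> are only
  determined up to null sets.
\<close>

definition harmonic_oscillator ::
  "(('a::euclidean_space \<Rightarrow> complex) \<times> ('a \<Rightarrow> complex)) set" where
  "harmonic_oscillator = {(u, v). square_integrable u \<and> square_integrable v \<and>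
     (\<forall>\<phi>. schwartz \<phi> \<longrightarrow>
        (\<integral>x. u x * harmonic_expr \<phi> x \<partial>lborel) = (\<integral>x. v x * \<phi> x \<partial>lborel))}"

text \<open>
  The oscillatory integral of \<open>F\<close>, defined by regularization. Integrability is required
  explicitly because the Bochner integral of a non-integrable function is \<open>0\<close>.
\<close>

definition has_oscillatory_integral ::
  "('a::euclidean_space \<Rightarrow> complex) \<Rightarrow> complex \<Rightarrow> bool" where
  "has_oscillatory_integral F I \<longleftrightarrow>
     (\<forall>\<kappa>. schwartz \<kappa> \<and> \<kappa> 0 = 1 \<longrightarrow>
        (\<forall>\<epsilon>>0. integrable lborel (\<lambda>z. \<kappa> (\<epsilon> *\<^sub>R z) * F z)) \<and>
        ((\<lambda>\<epsilon>. \<integral>z. \<kappa> (\<epsilon> *\<^sub>R z) * F z \<partial>lborel) \<longlongrightarrow> I) (at_right 0))"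

text \<open>
  Smooth functions all of whose derivatives grow at most like one fixed power of \<open>\<langle>X\<rangle>\<close>: the
  class in which the oscillatory integrals of the Weyl quantization make sense. The order
  \<open>m\<close> is arbitrary and differentiation is not assumed to improve the decay.
\<close>

definition amplitude :: "('a::euclidean_space \<Rightarrow> complex) \<Rightarrow> bool" where
  "amplitude b \<longleftrightarrow> smooth b \<and>
     (\<exists>m. \<forall>\<alpha>. \<exists>C. \<forall>X. norm (multi_deriv \<alpha> b X) \<le> C * bracket X powr m)"

text \<open>
  \<open>b\<close> is the Weyl symbol of the operator in \<open>L\<^sup>2\<close> with graph \<open>T\<close>. The identity is one between
  elements of \<open>L\<^sup>2\<close>, hence holds almost everywhere.
\<close>

definition weyl_symbol ::
  "((real^'n \<Rightarrow> complex) \<times> (real^'n \<Rightarrow> complex)) set \<Rightarrow> ((real^'n) \<times> (real^'n) \<Rightarrow> complex) \<Rightarrow> bool" where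
  "weyl_symbol T b \<longleftrightarrow> amplitude b \<and>
     (\<forall>f. schwartz f \<longrightarrow> (\<exists>u. (f, u) \<in> T \<and>
        (AE x in lborel. has_oscillatory_integral
           (\<lambda>(y, \<xi>). cis ((x - y) \<bullet> \<xi>) * b ((1/2) *\<^sub>R (x + y), \<xi>) * f y / of_real ((2 * pi) ^ CARD('n)))
           (u x))))"

end

theory Submission
  imports Defs "HOL-Probability.Probability" "HOL-Complex_Analysis.Complex_Analysis"
begin

text \<open>
  Testing \<open>H u = f\<close> against the coherent states \<open>exp (- x\<^sup>2/2 + q \<bullet> x)\<close>, on which \<open>H\<close> acts as a first order
  operator in \<open>q\<close>, determines all pairings of \<open>u = H\<^sup>-\<^sup>1 f\<close> with coherent states when \<open>f\<close> is one as well.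
  Expressed through the Weyl symbol \<open>b\<close> (integration by parts makes the oscillatory integral absolutely convergent),
  this gives the Fourier transform of \<open>b X * exp (- (norm X)\<^sup>2)\<close>. It agrees with that of
  Mehler's symbol, the integral over \<open>0 < r < 1\<close> of the Gaussians \<open>exp (- s (norm X)\<^sup>2)\<close>,
  \<open>s = (1 - r\<^sup>2) / (1 + r\<^sup>2)\<close>, with a bounded weight, so \<open>b\<close> is that integral.
  Cauchy's inequality bounds the derivatives of order \<open>\<alpha>\<close> of such a Gaussian by \<open>C\<close> to the power of the order times
  \<open>sqrt (\<alpha>!) * sqrt s ^ \<bar>\<alpha>\<bar> * exp (- s (norm X)\<^sup>2 / 2)\<close>; the factor \<open>sqrt s ^ \<bar>\<alpha>\<bar> * exp (- s (norm X)\<^sup>2 / 4)\<close> is at most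
  \<open>1\<close> and at most a constant times \<open>C ^ \<bar>\<alpha>\<bar> * sqrt (\<alpha>!) / bracket X ^ \<bar>\<alpha>\<bar>\<close>, and these two bounds are interpolated.
\<close>

subsection \<open>Gaussians\<close>

text \<open>With \<open>q = a + \<i> v\<close>, the data \<open>f\<close> is the coherent state with
  parameter \<open>- cnj q\<close> and the test function the one with parameter \<open>q\<close>. In
  midpoint coordinates the Gaussians then combine to \<open>exp (- (norm X)\<^sup>2)\<close> times a
  pure oscillation of frequency \<open>2 (v, a)\<close>. Real \<open>a\<close> and \<open>v\<close>
  therefore give the Fourier transform at every frequency, without analytic continuation, and only
  the weak equation for \<open>u\<close> is used, no spectral theory. The factor
  \<open>exp (- (norm X)\<^sup>2)\<close> also makes the symbol, of unknown polynomial growth,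
  integrable. The symbol decays only polynomially because the slope \<open>s\<close> vanishes at
  \<open>r = 1\<close>. The Gaussian is therefore spent in two portions: one is interpolated against
  powers of \<open>s\<close>, the other one, by \<open>1 - r \<le> s\<close>, leaves after
  integration over \<open>r\<close> a multiple of \<open>bracket X powr (- 2)\<close>. The exponent
  of \<open>\<alpha>!\<close> is the sum of \<open>1/2\<close>, from Cauchy's inequality on discs of
  radius \<open>sqrt k\<close>, and of half the interpolation exponent.\<close>

lemma bracket_ge_1: "1 \<le> bracket x"
  by (simp add: bracket_def)

lemma bracket_pos [simp]: "0 < bracket x"
  using bracket_ge_1[of x] by linarith

lemma bracket_nonneg [simp]: "0 \<le> bracket x" and bracket_nonzero [simp]: "bracket x \<noteq> 0"
  using bracket_pos[of x] by linarith+

lemma bracket_squared: "(bracket x)\<^sup>2 = 1 + (norm x)\<^sup>2"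
  by (simp add: bracket_def add_nonneg_nonneg)

lemma norm_le_bracket: "norm x \<le> bracket x"
  unfolding bracket_def by (rule real_le_rsqrt) simp

lemma bracket_le_norm: "bracket x \<le> 1 + norm x"
  unfolding bracket_def by (rule real_le_lsqrt) (auto simp: power2_eq_square algebra_simps)

lemma partial_deriv_eqI: "(f has_derivative D) (at x) \<Longrightarrow> partial_deriv i f x = D i"
  unfolding partial_deriv_def by (simp add: frechet_derivative_at[symmetric])

text \<open>This is \<open>exp (- c * (norm x)\<^sup>2 + q \<bullet> x)\<close>, the complex vector
  \<open>q\<close> being stored as its real part \<open>a\<close> and its imaginary part
  \<open>b\<close>. One family supplies the coherent states (\<open>c = 1/2\<close>), plane waves
  (\<open>c = 0\<close>), the cut-offs and the slices of Mehler's symbol.\<close>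

definition gau :: "real \<Rightarrow> 'a::euclidean_space \<Rightarrow> 'a \<Rightarrow> 'a \<Rightarrow> complex" where
  "gau c a b x = exp (of_real (a \<bullet> x - c * (norm x)\<^sup>2) + \<i> * of_real (b \<bullet> x))"

lemma norm_gau: "norm (gau c a b x) = exp (a \<bullet> x - c * (norm x)\<^sup>2)"
  by (simp add: gau_def)

lemma gau_zero [simp]: "gau c a b 0 = 1"
  by (simp add: gau_def)

lemma continuous_on_gau [continuous_intros]:
  assumes "continuous_on S c" "continuous_on S a" "continuous_on S b" "continuous_on S f"
  shows "continuous_on S (\<lambda>x. gau (c x) (a x) (b x) (f x))"
  unfolding gau_def by (intro continuous_intros assms)

lemma gau_has_derivative:
  "(gau c a b has_derivative
     (\<lambda>h. (of_real (a \<bullet> h - 2 * c * (x \<bullet> h)) + \<i> * of_real (b \<bullet> h)) * gau c a b x)) (at x)"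
proof -
  let ?z = "\<lambda>x. complex_of_real (a \<bullet> x - c * (x \<bullet> x)) + \<i> * of_real (b \<bullet> x)"
  have *: "gau c a b = (\<lambda>x. exp (?z x))"
    by (simp add: gau_def fun_eq_iff power2_norm_eq_inner)
  have "(?z has_derivative (\<lambda>h. of_real (a \<bullet> h - 2 * c * (x \<bullet> h)) + \<i> * of_real (b \<bullet> h))) (at x)"
    by (auto intro!: derivative_eq_intros simp: fun_eq_iff inner_commute algebra_simps)
  from has_derivative_compose[OF this DERIV_exp[THEN has_field_derivative_imp_has_derivative]]
  show ?thesis unfolding * by (simp add: mult.commute)
qed

lemma partial_deriv_gau:
  "partial_deriv i (gau c a b) x
     = (of_real (a \<bullet> i - 2 * c * (x \<bullet> i)) + \<i> * of_real (b \<bullet> i)) * gau c a b x"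
  by (rule partial_deriv_eqI[OF gau_has_derivative])

lemma bracket_power_gauss_bound:
  fixes a :: "'a::euclidean_space"
  shows "\<exists>C>0. \<forall>c\<ge>1/2. \<forall>x. bracket x ^ k * exp (a \<bullet> x - c * (norm x)\<^sup>2) \<le> C * exp (- (norm x)\<^sup>2 / 4)"
proof (intro exI conjI allI impI)
  \<comment> \<open>The total linear rate: \<open>norm a\<close> from the Gaussian and
    \<open>1\<close> from \<open>(1 + norm x) ^ k \<le> fact k * exp (1 + norm x)\<close>.
    Completing the square costs \<open>?A\<^sup>2\<close> and a quarter of
    \<open>(norm x)\<^sup>2\<close>, so \<open>1/2 - 1/4\<close> is left in the exponent.\<close>
  let ?A = "1 + norm a"
  let ?C = "fact k * exp (1 + ?A\<^sup>2) :: real"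
  show "0 < ?C" by simp
  fix c :: real and x :: 'a assume c: "1/2 \<le> c"
  have "(1 + norm x) ^ k / fact k \<le> exp (1 + norm x)"
  proof -
    have s: "summable (\<lambda>n. inverse (fact n) * (1 + norm x) ^ n)" by (rule summable_exp)
    have "(\<Sum>n\<in>{k}. inverse (fact n) * (1 + norm x) ^ n) \<le> (\<Sum>n. inverse (fact n) * (1 + norm x) ^ n)"
      by (rule sum_le_suminf[OF s]) auto
    then show ?thesis by (simp add: exp_def divide_inverse ac_simps)
  qed
  then have 1: "bracket x ^ k \<le> fact k * exp (1 + norm x)"
    using power_mono[OF bracket_le_norm[of x] order_less_imp_le[OF bracket_pos], of k]
    by (simp add: field_simps)
  have "c * (norm x)\<^sup>2 \<ge> 1/2 * (norm x)\<^sup>2" using c by (intro mult_right_mono) auto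
  moreover have "a \<bullet> x \<le> norm a * norm x" by (rule norm_cauchy_schwarz)
  moreover have "0 \<le> (norm x / 2 - ?A)\<^sup>2" by simp
  then have "norm x + norm a * norm x \<le> ?A\<^sup>2 + (norm x)\<^sup>2 / 4"
    by (simp add: power2_eq_square field_simps)
  ultimately have 2: "1 + norm x + (a \<bullet> x - c * (norm x)\<^sup>2) \<le> 1 + ?A\<^sup>2 - (norm x)\<^sup>2 / 4"
    by linarith
  have "bracket x ^ k * exp (a \<bullet> x - c * (norm x)\<^sup>2)
      \<le> fact k * exp (1 + norm x) * exp (a \<bullet> x - c * (norm x)\<^sup>2)"
    using 1 by (intro mult_right_mono) auto
  also have "\<dots> = fact k * exp (1 + norm x + (a \<bullet> x - c * (norm x)\<^sup>2))"
    by (simp only: exp_add mult.assoc)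
  also have "\<dots> \<le> fact k * exp (1 + ?A\<^sup>2 - (norm x)\<^sup>2 / 4)"
    using 2 by (intro mult_left_mono) auto
  also have "\<dots> = ?C * exp (- (norm x)\<^sup>2 / 4)"
    by (simp add: exp_add[symmetric])
  finally show "bracket x ^ k * exp (a \<bullet> x - c * (norm x)\<^sup>2) \<le> ?C * exp (- (norm x)\<^sup>2 / 4)" .
qed

text \<open>Polynomial multiples of one Gaussian, generated inductively so that closure under
  partial derivatives and rapid decay both follow by rule induction. Every iterated derivative stays
  in the class, which gives the Schwartz property.\<close>

inductive gpoly :: "real \<Rightarrow> 'a::euclidean_space \<Rightarrow> 'a \<Rightarrow> ('a \<Rightarrow> complex) \<Rightarrow> bool" for c a b where
  gau: "gpoly c a b (gau c a b)"
| coord: "gpoly c a b f \<Longrightarrow> gpoly c a b (\<lambda>x. of_real (x \<bullet> i) * f x)"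
| scale: "gpoly c a b f \<Longrightarrow> gpoly c a b (\<lambda>x. z * f x)"
| add: "gpoly c a b f \<Longrightarrow> gpoly c a b g \<Longrightarrow> gpoly c a b (\<lambda>x. f x + g x)"

lemma gpoly_deriv:
  "gpoly c a b f \<Longrightarrow> (\<forall>x. f differentiable (at x)) \<and> (\<forall>i. gpoly c a b (partial_deriv i f))"
proof (induction rule: gpoly.induct)
  case gau
  have "partial_deriv i (gau c a b) = (\<lambda>x. (of_real (a \<bullet> i) + \<i> * of_real (b \<bullet> i)) * gau c a b x
      + of_real (- 2 * c) * (of_real (x \<bullet> i) * gau c a b x))" for i
    by (auto simp: fun_eq_iff partial_deriv_gau algebra_simps)
  moreover have "gpoly c a b (\<lambda>x. (of_real (a \<bullet> i) + \<i> * of_real (b \<bullet> i)) * gau c a b x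
      + of_real (- 2 * c) * (of_real (x \<bullet> i) * gau c a b x))" for i
    by (intro gpoly.add gpoly.scale gpoly.coord gpoly.gau)
  ultimately show ?case
    using gau_has_derivative[of c a b] by (auto simp only: differentiable_def)
next
  case (coord f j)
  have D: "((\<lambda>x. of_real (x \<bullet> j) * f x) has_derivative
      (\<lambda>h. of_real (x \<bullet> j) * frechet_derivative f (at x) h + of_real (h \<bullet> j) * f x)) (at x)" for x
    using coord.IH by (auto intro!: derivative_eq_intros simp: frechet_derivative_works[symmetric])
  have "partial_deriv i (\<lambda>x. of_real (x \<bullet> j) * f x)
      = (\<lambda>x. of_real (x \<bullet> j) * partial_deriv i f x + of_real (i \<bullet> j) * f x)" for i
    by (auto simp: fun_eq_iff partial_deriv_eqI[OF D] partial_deriv_def[of i f])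
  then show ?case
    using D coord by (auto simp: differentiable_def intro!: gpoly.intros)
next
  case (scale f z)
  have D: "((\<lambda>x. z * f x) has_derivative (\<lambda>h. z * frechet_derivative f (at x) h)) (at x)" for x
    using scale.IH by (auto intro!: derivative_eq_intros simp: frechet_derivative_works[symmetric])
  have "partial_deriv i (\<lambda>x. z * f x) = (\<lambda>x. z * partial_deriv i f x)" for i
    by (auto simp: fun_eq_iff partial_deriv_eqI[OF D] partial_deriv_def[of i f])
  then show ?case
    using D scale by (auto simp: differentiable_def intro!: gpoly.intros)
next
  case (add f g)
  have D: "((\<lambda>x. f x + g x) has_derivative
      (\<lambda>h. frechet_derivative f (at x) h + frechet_derivative g (at x) h)) (at x)" for x
    using add.IH by (auto intro!: derivative_eq_intros simp: frechet_derivative_works[symmetric])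
  have "partial_deriv i (\<lambda>x. f x + g x) = (\<lambda>x. partial_deriv i f x + partial_deriv i g x)" for i
    by (auto simp: fun_eq_iff partial_deriv_eqI[OF D] partial_deriv_def[of i f] partial_deriv_def[of i g])
  then show ?case
    using D add by (auto simp: differentiable_def intro!: gpoly.intros)
qed

lemma gpoly_decay:
  assumes "1/2 \<le> c" "gpoly c a b f"
  shows "\<exists>C. \<forall>x. bracket x ^ k * norm (f x) \<le> C"
  using assms(2)
proof (induction arbitrary: k rule: gpoly.induct)
  case gau
  obtain C where C: "0 < C" "\<And>x. bracket x ^ k * exp (a \<bullet> x - c * (norm x)\<^sup>2) \<le> C * exp (- (norm x)\<^sup>2 / 4)"
    using bracket_power_gauss_bound[of k a] assms(1) by blast
  have "bracket x ^ k * norm (gau c a b x) \<le> C" for x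
  proof -
    have "C * exp (- (norm x)\<^sup>2 / 4) \<le> C * 1" using C(1) by (intro mult_left_mono) auto
    then show ?thesis using C(2)[of x] by (simp add: norm_gau)
  qed
  then show ?case by blast
next
  case (coord f i)
  obtain C where C: "\<And>x. bracket x ^ Suc k * norm (f x) \<le> C" using coord.IH by meson
  have "bracket x ^ k * norm (of_real (x \<bullet> i) * f x) \<le> norm i * C" for x
  proof -
    have "\<bar>x \<bullet> i\<bar> \<le> norm i * bracket x"
      using Cauchy_Schwarz_ineq2[of x i] mult_left_mono[OF norm_le_bracket[of x], of "norm i"]
      by (simp add: mult.commute)
    then have "bracket x ^ k * norm (of_real (x \<bullet> i) * f x) \<le> bracket x ^ k * (norm i * bracket x * norm (f x))"
      unfolding norm_mult norm_of_real by (intro mult_left_mono mult_right_mono) (auto simp: less_imp_le)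
    also have "\<dots> = norm i * (bracket x ^ Suc k * norm (f x))" by simp
    also have "\<dots> \<le> norm i * C" by (intro mult_left_mono C) auto
    finally show ?thesis .
  qed
  then show ?case by blast
next
  case (scale f z)
  obtain C where C: "\<And>x. bracket x ^ k * norm (f x) \<le> C" using scale.IH by meson
  have "bracket x ^ k * norm (z * f x) \<le> norm z * C" for x
    using mult_left_mono[OF C[of x], of "norm z"] by (simp add: norm_mult ac_simps)
  then show ?case by blast
next
  case (add f g)
  obtain C where C: "\<And>x. bracket x ^ k * norm (f x) \<le> C" using add.IH by meson
  obtain D where D: "\<And>x. bracket x ^ k * norm (g x) \<le> D" using add.IH by meson
  have "bracket x ^ k * norm (f x + g x) \<le> C + D" for x
  proof -
    have "bracket x ^ k * norm (f x + g x) \<le> bracket x ^ k * (norm (f x) + norm (g x))"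
      by (intro mult_left_mono norm_triangle_ineq) (simp add: less_imp_le)
    then show ?thesis using C[of x] D[of x] by (simp add: distrib_left)
  qed
  then show ?case by blast
qed

lemma schwartz_gpoly:
  assumes "1/2 \<le> c" "gpoly c a b f"
  shows "schwartz f"
proof -
  have 1: "gpoly c a b (foldr partial_deriv is f)" for "is"
    using assms(2) by (induction "is") (auto simp: gpoly_deriv)
  have 2: "gpoly c a b ((partial_deriv i ^^ n) g)" if "gpoly c a b g" for i n g
    using that by (induction n) (auto simp: gpoly_deriv)
  have 3: "gpoly c a b (multi_deriv \<alpha> f)" for \<alpha>
  proof -
    have "gpoly c a b (foldr (\<lambda>i. partial_deriv i ^^ \<alpha> i) is f)" for "is"
      using assms(2) 2 by (induction "is") auto
    then show ?thesis by (simp add: multi_deriv_def)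
  qed
  show ?thesis
    unfolding schwartz_def smooth_def
    using gpoly_deriv[OF 1] gpoly_decay[OF assms(1) 3] by blast
qed

lemma schwartz_gau: "1/2 \<le> c \<Longrightarrow> schwartz (gau c a b)"
  by (rule schwartz_gpoly[OF _ gpoly.gau])

section \<open>Gaussian integrals in one and several variables\<close>

lemma
  fixes f :: "'a::euclidean_space \<Rightarrow> real \<Rightarrow> 'b::{real_normed_field,banach,second_countable_topology}"
  assumes f: "\<And>i. i \<in> Basis \<Longrightarrow> integrable lborel (f i)"
  shows integrable_lborel_prod: "integrable lborel (\<lambda>x. \<Prod>i\<in>Basis. f i (x \<bullet> i))"
    and integral_lborel_prod: "(\<integral>x. (\<Prod>i\<in>Basis. f i (x \<bullet> i)) \<partial>lborel) = (\<Prod>i\<in>Basis. integral\<^sup>L lborel (f i))"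
proof -
  interpret product_sigma_finite "\<lambda>_::'a. lborel :: real measure" ..
  \<comment> \<open>\<open>lborel\<close> is the image under \<open>?T\<close> of the product of the
    one-dimensional Lebesgue measures, so both claims are transported from the product
    measure.\<close>
  let ?T = "\<lambda>g. \<Sum>b\<in>Basis. g b *\<^sub>R b :: 'a"
  have [measurable]: "f i \<in> borel_measurable borel" if "i \<in> Basis" for i
    using f[OF that] by (simp add: borel_measurable_integrable)
  have *: "(\<Prod>i\<in>Basis. f i (?T g \<bullet> i)) = (\<Prod>i\<in>Basis. f i (g i))" for g
    by (rule prod.cong) auto
  have [measurable]: "?T \<in> (\<Pi>\<^sub>M b\<in>Basis. lborel) \<rightarrow>\<^sub>M borel" by measurable
  show "integrable lborel (\<lambda>x. \<Prod>i\<in>Basis. f i (x \<bullet> i))"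
    using integrable_distr_eq[of ?T "\<Pi>\<^sub>M b\<in>Basis. lborel" borel "\<lambda>x. \<Prod>i\<in>Basis. f i (x \<bullet> i)"]
    by (simp only: lborel_eq[symmetric] * product_integrable_prod[OF finite_Basis f]) measurable
  show "(\<integral>x. (\<Prod>i\<in>Basis. f i (x \<bullet> i)) \<partial>lborel) = (\<Prod>i\<in>Basis. integral\<^sup>L lborel (f i))"
    using integral_distr[of ?T "\<Pi>\<^sub>M b\<in>Basis. lborel" borel "\<lambda>x. \<Prod>i\<in>Basis. f i (x \<bullet> i)"]
    by (simp only: lborel_eq[symmetric] * product_integral_prod[OF finite_Basis f]) measurable
qed

text \<open>Up to a constant, the characteristic function of the standard normal distribution is the
  case \<open>c = 1/2\<close>, \<open>a = 0\<close>. Completing the square, the real substitution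
  \<open>x \<mapsto> - a / k + k * x\<close> with \<open>k = sqrt (2 * c)\<close> reduces the
  general case to it; the constant \<open>z\<close> collects what the shift leaves behind.\<close>

lemma has_bochner_integral_gau_real:
  fixes a b c :: real
  assumes c: "0 < c"
  shows "has_bochner_integral lborel (gau c a b)
    (of_real (sqrt (pi / c)) * exp ((of_real (a\<^sup>2 - b\<^sup>2) + 2 * \<i> * of_real (a * b)) / of_real (4 * c)))"
proof -
  define k where "k = sqrt (2 * c)"
  have k: "0 < k" "k\<^sup>2 = 2 * c" using c by (auto simp: k_def)
  define t where "t = b / k"
  define g :: "real \<Rightarrow> complex" where "g x = of_real (exp (- x\<^sup>2 / 2)) * iexp (t * x)" for x
  have gn: "g x = of_real (sqrt (2 * pi)) * (std_normal_density x *\<^sub>R iexp (t * x))" for x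
    by (simp add: g_def std_normal_density_def scaleR_conv_of_real)
  have int: "integrable lborel (\<lambda>x. std_normal_density x *\<^sub>R iexp (t * x))"
    using integrable_normal_density[of 1 0]
    by (rule Bochner_Integration.integrable_bound) (auto simp: norm_mult)
  have "(\<integral>x. std_normal_density x *\<^sub>R iexp (t * x) \<partial>lborel) = of_real (exp (- t\<^sup>2 / 2))"
    using fun_cong[OF char_std_normal_distribution, of t]
    unfolding char_def by (subst (asm) integral_density) (auto simp: normal_density_nonneg)
  then have "has_bochner_integral lborel g (of_real (sqrt (2 * pi)) * of_real (exp (- t\<^sup>2 / 2)))"
    unfolding gn[abs_def]
    using int by (intro has_bochner_integral_mult_right) (auto simp: has_bochner_integral_iff)
  then have *: "has_bochner_integral lborel (\<lambda>x. g (- a / k + k * x))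
      ((of_real (sqrt (2 * pi)) * of_real (exp (- t\<^sup>2 / 2))) /\<^sub>R \<bar>k\<bar>)"
    using k by (subst (asm) lborel_has_bochner_integral_real_affine_iff[of k _ _ "- a / k"]) auto
  define z where "z = exp (of_real (a\<^sup>2 / (4 * c)) + \<i> * of_real (a * b / (2 * c)))"
  have "gau c a b x = z * g (- a / k + k * x)" for x
  proof -
    have "- (- a / k + k * x)\<^sup>2 / 2 = - (a\<^sup>2 / k\<^sup>2) / 2 + a * x - (k\<^sup>2 * x\<^sup>2) / 2"
      using k(1) by (simp add: power2_eq_square field_simps)
    then have 1: "- (- a / k + k * x)\<^sup>2 / 2 = - a\<^sup>2 / (4 * c) + (a * x - c * x\<^sup>2)"
      unfolding k by simp
    have "t * (- a / k + k * x) = - a * b / k\<^sup>2 + b * x"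
      using k(1) by (simp add: t_def power2_eq_square field_simps)
    then have 2: "t * (- a / k + k * x) = - a * b / (2 * c) + b * x" unfolding k .
    show ?thesis
      unfolding gau_def g_def z_def 1 2 exp_of_real[symmetric] exp_add[symmetric]
      by (simp add: algebra_simps)
  qed
  then have "gau c a b = (\<lambda>x. z * g (- a / k + k * x))" by (rule ext)
  moreover have "z * ((of_real (sqrt (2 * pi)) * of_real (exp (- t\<^sup>2 / 2))) /\<^sub>R \<bar>k\<bar>)
     = of_real (sqrt (pi / c)) * exp ((of_real (a\<^sup>2 - b\<^sup>2) + 2 * \<i> * of_real (a * b)) / of_real (4 * c))"
  proof -
    have 1: "sqrt (2 * pi) / k = sqrt (pi / c)" using c unfolding k_def real_sqrt_divide[symmetric] by simp
    have 2: "t\<^sup>2 = b\<^sup>2 / (2 * c)" by (simp add: t_def power_divide k)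
    have "z * ((of_real (sqrt (2 * pi)) * of_real (exp (- t\<^sup>2 / 2))) /\<^sub>R \<bar>k\<bar>)
        = of_real (sqrt (2 * pi) / k) * (z * of_real (exp (- t\<^sup>2 / 2)))"
      using k(1) by (simp add: scaleR_conv_of_real field_simps)
    also have "z * of_real (exp (- t\<^sup>2 / 2)) = exp ((of_real (a\<^sup>2 - b\<^sup>2) + 2 * \<i> * of_real (a * b)) / of_real (4 * c))"
      unfolding z_def 2 exp_of_real[symmetric] exp_add[symmetric] using c
      by (intro arg_cong[where f=exp]) (simp add: field_simps)
    finally show ?thesis by (simp only: 1)
  qed
  ultimately show ?thesis
    using has_bochner_integral_mult_right[OF *, of z] by (simp only: )
qed

lemma gau_prod: "gau c a b x = (\<Prod>i\<in>Basis. gau c (a \<bullet> i) (b \<bullet> i) (x \<bullet> i))"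
proof -
  have 1: "(norm x)\<^sup>2 = (\<Sum>i\<in>Basis. (x \<bullet> i)\<^sup>2)"
    unfolding power2_norm_eq_inner euclidean_inner[of x x] by (simp add: power2_eq_square)
  show ?thesis
    unfolding gau_def exp_sum[OF finite_Basis, symmetric] 1
    by (simp add: euclidean_inner[of a x] euclidean_inner[of b x] sum.distrib sum_subtractf sum_distrib_left)
qed

lemma has_bochner_integral_gau:
  fixes a b :: "'a::euclidean_space"
  assumes c: "0 < c"
  shows "has_bochner_integral lborel (gau c a b) (of_real (sqrt (pi / c) ^ DIM('a)) *
    exp ((of_real ((norm a)\<^sup>2 - (norm b)\<^sup>2) + 2 * \<i> * of_real (a \<bullet> b)) / of_real (4 * c)))"
proof -
  have i: "integrable lborel (gau c (a \<bullet> i) (b \<bullet> i))"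
    and v: "integral\<^sup>L lborel (gau c (a \<bullet> i) (b \<bullet> i)) = of_real (sqrt (pi / c)) *
      exp ((of_real ((a \<bullet> i)\<^sup>2 - (b \<bullet> i)\<^sup>2) + 2 * \<i> * of_real ((a \<bullet> i) * (b \<bullet> i))) / of_real (4 * c))" for i
    using has_bochner_integral_gau_real[OF c, of "a \<bullet> i" "b \<bullet> i"] by (auto simp: has_bochner_integral_iff)
  have n: "(norm x)\<^sup>2 = (\<Sum>i\<in>Basis. (x \<bullet> i)\<^sup>2)" for x :: 'a
    unfolding power2_norm_eq_inner euclidean_inner[of x x] by (simp add: power2_eq_square)
  have g: "gau c a b = (\<lambda>x. \<Prod>i\<in>Basis. gau c (a \<bullet> i) (b \<bullet> i) (x \<bullet> i))"
    by (rule ext) (rule gau_prod)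
  have "integrable lborel (gau c a b)"
    unfolding g by (intro integrable_lborel_prod i)
  moreover have "integral\<^sup>L lborel (gau c a b) = (\<Prod>i\<in>Basis. integral\<^sup>L lborel (gau c (a \<bullet> i) (b \<bullet> i)))"
    unfolding g by (intro integral_lborel_prod i)
  moreover have "(\<Sum>i\<in>Basis. (of_real ((a \<bullet> i)\<^sup>2 - (b \<bullet> i)\<^sup>2) + 2 * \<i> * of_real ((a \<bullet> i) * (b \<bullet> i))) / of_real (4 * c))
      = (of_real ((norm a)\<^sup>2 - (norm b)\<^sup>2) + 2 * \<i> * of_real (a \<bullet> b)) / (of_real (4 * c) :: complex)"
    by (simp only: n euclidean_inner[of a b] sum_divide_distrib[symmetric] sum.distrib of_real_sum sum_subtractf[symmetric]
      sum_distrib_left)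
  ultimately show ?thesis
    by (simp only: has_bochner_integral_iff v prod.distrib exp_sum[OF finite_Basis, symmetric] prod_constant
        of_real_power simp_thms)
qed

lemma integrable_gau: "0 < c \<Longrightarrow> integrable lborel (gau c a b)"
  using has_bochner_integral_gau has_bochner_integral_iff by blast

lemma integral_gau:
  fixes a b :: "'a::euclidean_space"
  shows "0 < c \<Longrightarrow> integral\<^sup>L lborel (gau c a b) = of_real (sqrt (pi / c) ^ DIM('a)) *
    exp ((of_real ((norm a)\<^sup>2 - (norm b)\<^sup>2) + 2 * \<i> * of_real (a \<bullet> b)) / of_real (4 * c))"
  using has_bochner_integral_gau has_bochner_integral_iff by blast

lemma has_bochner_integral_gauss:
  fixes a :: "'a::euclidean_space"
  assumes "0 < c"
  shows "has_bochner_integral lborel (\<lambda>x. exp (a \<bullet> x - c * (norm x)\<^sup>2))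
    (sqrt (pi / c) ^ DIM('a) * exp ((norm a)\<^sup>2 / (4 * c)))"
proof -
  have "has_bochner_integral lborel (\<lambda>x. Re (gau c a 0 x)) (Re (of_real (sqrt (pi / c) ^ DIM('a)) *
    exp ((of_real ((norm a)\<^sup>2 - (norm (0::'a))\<^sup>2) + 2 * \<i> * of_real (a \<bullet> 0)) / of_real (4 * c))))"
    by (rule has_bochner_integral_Re[OF has_bochner_integral_gau[OF assms]])
  moreover have "Re (gau c a 0 x) = exp (a \<bullet> x - c * (norm x)\<^sup>2)" for x
    by (simp add: gau_def exp_of_real del: of_real_diff)
  moreover have "Re (of_real (sqrt (pi / c) ^ DIM('a)) * exp ((of_real ((norm a)\<^sup>2 - (norm (0::'a))\<^sup>2)
      + 2 * \<i> * of_real (a \<bullet> 0)) / of_real (4 * c))) = sqrt (pi / c) ^ DIM('a) * exp ((norm a)\<^sup>2 / (4 * c))"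
  proof -
    have "(of_real ((norm a)\<^sup>2 - (norm (0::'a))\<^sup>2) + 2 * \<i> * of_real (a \<bullet> 0)) / of_real (4 * c)
        = complex_of_real ((norm a)\<^sup>2 / (4 * c))" by simp
    then show ?thesis by (simp only: exp_of_real of_real_mult[symmetric] Re_complex_of_real)
  qed
  ultimately show ?thesis by (simp only:)
qed

lemma integrable_gauss: "0 < c \<Longrightarrow> integrable lborel (\<lambda>x. exp (a \<bullet> x - c * (norm x)\<^sup>2))"
  using has_bochner_integral_gauss has_bochner_integral_iff by blast

lemma integrable_bracket_power_gauss:
  assumes "1/2 \<le> c"
  shows "integrable lborel (\<lambda>x. bracket x ^ k * exp (a \<bullet> x - c * (norm x)\<^sup>2))"
proof -
  obtain C where C: "0 < C" "\<And>x. bracket x ^ k * exp (a \<bullet> x - c * (norm x)\<^sup>2) \<le> C * exp (- (norm x)\<^sup>2 / 4)"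
    using bracket_power_gauss_bound[of k a] assms by blast
  have "integrable lborel (\<lambda>x. C * exp (- (norm x)\<^sup>2 / 4))"
    using integrable_gauss[of "1/4" 0] by (intro integrable_mult_right) simp
  then show ?thesis
    by (rule Bochner_Integration.integrable_bound)
       (use C in \<open>auto simp: bracket_def abs_mult intro!: order_trans[OF _ abs_ge_self]\<close>)
qed

lemma integrable_inverse_1_plus_square_real: "integrable lborel (\<lambda>x::real. inverse (1 + x\<^sup>2))"
  using integrable_inverse_1_plus_square by (simp add: set_integrable_def)

text \<open>Each coordinate gets one factor
  \<open>(bracket x)\<^sup>2 \<ge> 1 + (x \<bullet> i)\<^sup>2\<close>, so a product of integrable
  functions of one variable is a majorant. This fixes the decay rate that the integrations by parts
  have to reach.\<close>

lemma integrable_inverse_bracket_power: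
  "integrable lborel (\<lambda>x::'a::euclidean_space. inverse (bracket x ^ (2 * DIM('a))))"
proof (rule Bochner_Integration.integrable_bound)
  show "integrable lborel (\<lambda>x::'a. \<Prod>i\<in>Basis. inverse (1 + (x \<bullet> i)\<^sup>2))"
    by (rule integrable_lborel_prod[OF integrable_inverse_1_plus_square_real])
  have "inverse (bracket x ^ (2 * DIM('a))) \<le> (\<Prod>i\<in>Basis. inverse (1 + (x \<bullet> i)\<^sup>2))" for x :: 'a
  proof -
    have "(\<Prod>i\<in>(Basis::'a set). inverse ((bracket x)\<^sup>2)) \<le> (\<Prod>i\<in>Basis. inverse (1 + (x \<bullet> i)\<^sup>2))"
    proof (rule prod_mono, intro conjI)
      fix i :: 'a assume "i \<in> Basis"
      then have "(x \<bullet> i)\<^sup>2 \<le> (norm x)\<^sup>2"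
        using Basis_le_norm[of i x] power_mono[of "\<bar>x \<bullet> i\<bar>" "norm x" 2] by simp
      then show "inverse ((bracket x)\<^sup>2) \<le> inverse (1 + (x \<bullet> i)\<^sup>2)"
        unfolding bracket_squared by (intro le_imp_inverse_le) (auto simp: add_pos_nonneg)
    qed simp
    then show ?thesis by (simp add: power_mult power_inverse)
  qed
  then show "AE x::'a in lborel. norm (inverse (bracket x ^ (2 * DIM('a)))) \<le> norm (\<Prod>i\<in>Basis. inverse (1 + (x \<bullet> i)\<^sup>2))"
    by (auto simp: prod_nonneg less_imp_le)
qed (auto simp: bracket_def)

subsection \<open>The inverse of the harmonic oscillator on coherent states\<close>

text \<open>Majorants in separated variables justify most of the exchanges of integrals
  below.\<close>

lemma integrable_pair_dominated:
  fixes F :: "'a::euclidean_space \<times> 'b::euclidean_space \<Rightarrow> 'c::{banach,second_countable_topology}"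
  assumes F: "F \<in> borel_measurable borel" and g: "integrable lborel g" and h: "integrable lborel h"
    and le: "\<And>x y. norm (F (x, y)) \<le> g x * h y"
  shows "integrable (lborel \<Otimes>\<^sub>M lborel) F"
proof (rule Bochner_Integration.integrable_bound)
  have [measurable]: "g \<in> borel_measurable borel" "h \<in> borel_measurable borel"
    using borel_measurable_integrable[OF g] borel_measurable_integrable[OF h] by auto
  show "integrable (lborel \<Otimes>\<^sub>M lborel) (\<lambda>z. g (fst z) * h (snd z))"
    by (rule lborel_pair.Fubini_integrable) (use g h in \<open>auto simp: abs_mult\<close>)
  show "F \<in> borel_measurable (lborel \<Otimes>\<^sub>M lborel)" using F by (simp add: lborel_prod)
  show "AE z in lborel \<Otimes>\<^sub>M lborel. norm (F z) \<le> norm (g (fst z) * h (snd z))"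
    using le by (auto intro!: always_eventually order_trans[OF _ abs_ge_self])
qed

lemma
  fixes f :: "'a::euclidean_space \<Rightarrow> 'b::{banach,second_countable_topology}"
  assumes [measurable]: "f \<in> borel_measurable borel" and c: "c \<noteq> 0"
  shows lborel_integral_affine: "(\<integral>x. f x \<partial>lborel) = \<bar>c\<bar> ^ DIM('a) *\<^sub>R (\<integral>x. f (t + c *\<^sub>R x) \<partial>lborel)"
    and lborel_integrable_affine: "integrable lborel f \<Longrightarrow> integrable lborel (\<lambda>x. f (t + c *\<^sub>R x))"
proof -
  show "(\<integral>x. f x \<partial>lborel) = \<bar>c\<bar> ^ DIM('a) *\<^sub>R (\<integral>x. f (t + c *\<^sub>R x) \<partial>lborel)"
    by (subst lborel_affine[OF c, of t]) (simp add: integral_density integral_distr)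
  assume "integrable lborel f"
  then have "integrable lborel (\<lambda>x. \<bar>c\<bar> ^ DIM('a) *\<^sub>R f (t + c *\<^sub>R x))"
    by (subst (asm) lborel_affine[OF c, of t]) (simp add: integrable_density integrable_distr_eq)
  from integrable_scaleR_right[OF this, of "inverse (\<bar>c\<bar> ^ DIM('a))"] c
  show "integrable lborel (\<lambda>x. f (t + c *\<^sub>R x))" by simp
qed

lemma gau_mult: "gau c a b x * gau c' a' b' x = gau (c + c') (a + a') (b + b') x"
  unfolding gau_def exp_add[symmetric] by (simp add: algebra_simps)

text \<open>At \<open>c = 1/2\<close> the term \<open>(norm x)\<^sup>2\<close> produced by the
  Laplacian cancels the potential. With \<open>q = a + \<i> b\<close> and \<open>n\<close> the
  dimension, the remaining factor is \<open>n + 2 q \<bullet> x - q \<bullet> q\<close>, bilinear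
  without conjugation, which is what a first order operator in \<open>q\<close> can
  reproduce.\<close>

lemma harmonic_expr_gau:
  fixes a b :: "'a::euclidean_space"
  shows "harmonic_expr (\<lambda>x. z * gau (1/2) a b x) x =
    (of_nat DIM('a) + 2 * (of_real (a \<bullet> x) + \<i> * of_real (b \<bullet> x))
      - (of_real ((norm a)\<^sup>2 - (norm b)\<^sup>2) + 2 * \<i> * of_real (a \<bullet> b))) * (z * gau (1/2) a b x)"
proof -
  let ?g = "gau (1/2) a b" let ?l = "\<lambda>i x. of_real ((a - x) \<bullet> i) + \<i> * of_real (b \<bullet> i) :: complex"
  have 1: "partial_deriv i (\<lambda>x. z * ?g x) = (\<lambda>x. ?l i x * (z * ?g x))" for i
  proof
    fix x
    have "((\<lambda>x. z * ?g x) has_derivative (\<lambda>h. z * ((of_real (a \<bullet> h - 2 * (1/2) * (x \<bullet> h)) + \<i> * of_real (b \<bullet> h)) * ?g x))) (at x)"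
      by (rule has_derivative_mult_right[OF gau_has_derivative])
    from partial_deriv_eqI[OF this]
    show "partial_deriv i (\<lambda>x. z * ?g x) x = ?l i x * (z * ?g x)"
      by (simp add: inner_diff_left)
  qed
  have 2: "partial_deriv i (partial_deriv i (\<lambda>x. z * ?g x)) x = ((?l i x)\<^sup>2 - 1) * (z * ?g x)" if i: "i \<in> Basis" for i
  proof -
    have d: "(?l i has_derivative (\<lambda>h. - of_real (h \<bullet> i))) (at x)"
      by (auto intro!: derivative_eq_intros simp: inner_diff_left)
    have e: "((\<lambda>x. z * ?g x) has_derivative (\<lambda>h. z * ((of_real (a \<bullet> h - 2 * (1/2) * (x \<bullet> h)) + \<i> * of_real (b \<bullet> h)) * ?g x))) (at x)"
      by (rule has_derivative_mult_right[OF gau_has_derivative])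
    show ?thesis
      unfolding 1 using i
      by (subst partial_deriv_eqI[OF has_derivative_mult[OF d e]])
         (simp add: inner_diff_left power2_eq_square algebra_simps)
  qed
  have "(?l i x)\<^sup>2 = of_real ((a - x) \<bullet> i * ((a - x) \<bullet> i) - b \<bullet> i * (b \<bullet> i)) + 2 * \<i> * of_real (((a - x) \<bullet> i) * (b \<bullet> i))" for i
    by (simp add: power2_eq_square algebra_simps)
  then have 3: "(\<Sum>i\<in>Basis. (?l i x)\<^sup>2) = of_real ((a - x) \<bullet> (a - x) - b \<bullet> b) + 2 * \<i> * of_real ((a - x) \<bullet> b)"
    by (simp only: euclidean_inner[of "a - x" "a - x"] euclidean_inner[of b b] euclidean_inner[of "a - x" b]
        sum.distrib sum_distrib_left of_real_sum sum_subtractf[symmetric])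
  have "(\<Sum>i\<in>Basis. partial_deriv i (partial_deriv i (\<lambda>x. z * ?g x)) x)
      = (\<Sum>i\<in>Basis. (?l i x)\<^sup>2 - 1) * (z * ?g x)"
    by (simp add: 2 sum_distrib_right)
  also have "(\<Sum>i\<in>Basis. (?l i x)\<^sup>2 - 1)
      = of_real ((a - x) \<bullet> (a - x) - b \<bullet> b) + 2 * \<i> * of_real ((a - x) \<bullet> b) - of_nat DIM('a)"
    by (simp add: sum_subtractf 3)
  finally show ?thesis
    unfolding harmonic_expr_def power2_norm_eq_inner
    by (simp add: inner_diff_left inner_diff_right inner_commute algebra_simps)
qed

text \<open>
  \<open>ladder a b r\<close> is the coherent state with complex parameter \<open>q = r (a + \<i> b)\<close>, scaled by \<open>exp (- q\<^sup>2 / 4)\<close>.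
  With this scaling the harmonic oscillator acts as \<open>n + 2 r d/dr\<close>, which is inverted by integrating along the ray.
\<close>

definition ladder :: "'a::euclidean_space \<Rightarrow> 'a \<Rightarrow> real \<Rightarrow> 'a \<Rightarrow> complex" where
  "ladder a b r x = exp (- of_real (r\<^sup>2 / 4) * (of_real ((norm a)\<^sup>2 - (norm b)\<^sup>2) + 2 * \<i> * of_real (a \<bullet> b)))
     * gau (1/2) (r *\<^sub>R a) (r *\<^sub>R b) x"

lemma schwartz_ladder: "schwartz (ladder a b r)"
  unfolding ladder_def[abs_def] by (rule schwartz_gpoly[OF _ gpoly.scale[OF gpoly.gau]]) simp

lemma harmonic_expr_ladder:
  fixes a b :: "'a::euclidean_space"
  shows "harmonic_expr (ladder a b r) x =
    (of_nat DIM('a) + of_real (2 * r) * (of_real (a \<bullet> x) + \<i> * of_real (b \<bullet> x))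
      - of_real (r\<^sup>2) * (of_real ((norm a)\<^sup>2 - (norm b)\<^sup>2) + 2 * \<i> * of_real (a \<bullet> b))) * ladder a b r x"
proof -
  have n: "(norm (r *\<^sub>R y))\<^sup>2 = r\<^sup>2 * (norm y)\<^sup>2" for y :: 'a by (simp add: power_mult_distrib)
  show ?thesis
    unfolding ladder_def[abs_def] harmonic_expr_gau n
    by (intro arg_cong2[where f="(*)"] refl) (simp add: power2_eq_square algebra_simps)
qed

text \<open>With \<open>q = a + \<i> b\<close> the product has the parameter
  \<open>r q - cnj q\<close>, whose bilinear square is
  \<open>r\<^sup>2 q\<^sup>2 - 2 r |q|\<^sup>2 + (cnj q)\<^sup>2\<close>. The scaling of
  \<open>ladder\<close> removes the first term, so \<open>r\<close> survives only in a real decaying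
  exponential. This is the reason for pairing the parameter \<open>q\<close> with
  \<open>- cnj q\<close>.\<close>

lemma integral_gau_ladder:
  fixes a b :: "'a::euclidean_space"
  shows "(\<integral>x. gau (1/2) (- a) b x * ladder a b r x \<partial>lborel) = of_real (sqrt pi ^ DIM('a)
      * exp (- r * ((norm a)\<^sup>2 + (norm b)\<^sup>2) / 2))
      * exp ((of_real ((norm a)\<^sup>2 - (norm b)\<^sup>2) - 2 * \<i> * of_real (a \<bullet> b)) / 4)"
proof -
  define Q :: complex where "Q = of_real ((norm a)\<^sup>2 - (norm b)\<^sup>2) + 2 * \<i> * of_real (a \<bullet> b)"
  have 1: "gau (1/2) (- a) b x * ladder a b r x
      = exp (- of_real (r\<^sup>2 / 4) * Q) * gau 1 ((r - 1) *\<^sub>R a) ((r + 1) *\<^sub>R b) x" for x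
  proof -
    have "gau (1/2) (- a) b x * ladder a b r x
      = exp (- of_real (r\<^sup>2 / 4) * Q) * (gau (1/2) (- a) b x * gau (1/2) (r *\<^sub>R a) (r *\<^sub>R b) x)"
      by (simp add: ladder_def Q_def)
    then show ?thesis by (simp add: gau_mult algebra_simps)
  qed
  have 2: "(norm ((r - 1) *\<^sub>R a))\<^sup>2 = (r - 1)\<^sup>2 * (norm a)\<^sup>2" "(norm ((r + 1) *\<^sub>R b))\<^sup>2 = (r + 1)\<^sup>2 * (norm b)\<^sup>2"
    by (simp_all add: power_mult_distrib)
  have "(\<integral>x. gau (1/2) (- a) b x * ladder a b r x \<partial>lborel) = of_real (sqrt pi ^ DIM('a))
      * (exp (- of_real (r\<^sup>2 / 4) * Q)
      * exp ((of_real ((r - 1)\<^sup>2 * (norm a)\<^sup>2 - (r + 1)\<^sup>2 * (norm b)\<^sup>2)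
          + 2 * \<i> * of_real ((r + 1) * ((r - 1) * (a \<bullet> b)))) / 4))"
    unfolding 1 by (simp add: integral_gau 2[simplified])
  also have "exp (- of_real (r\<^sup>2 / 4) * Q) * exp ((of_real ((r - 1)\<^sup>2 * (norm a)\<^sup>2 - (r + 1)\<^sup>2 * (norm b)\<^sup>2)
          + 2 * \<i> * of_real ((r + 1) * ((r - 1) * (a \<bullet> b)))) / 4)
      = exp (of_real (- r * ((norm a)\<^sup>2 + (norm b)\<^sup>2) / 2)
        + (of_real ((norm a)\<^sup>2 - (norm b)\<^sup>2) - 2 * \<i> * of_real (a \<bullet> b)) / 4)"
    unfolding exp_add[symmetric] Q_def
    by (intro arg_cong[where f=exp]) (simp add: power2_eq_square field_simps)
  finally show ?thesis
    by (simp only: exp_add exp_of_real of_real_mult mult.assoc)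
qed

text \<open>With \<open>n\<close> the dimension, the integrand is the derivative of
  \<open>r ^ n * ladder a b (r\<^sup>2) x\<close>. Moving along the ray as \<open>r\<^sup>2\<close>
  turns the integrating factor \<open>r powr (n / 2)\<close> into \<open>r ^ n\<close>, which avoids
  a singular weight at \<open>0\<close> when \<open>n = 1\<close> and makes \<open>r\<close> the
  variable of Mehler's symbol. The boundary term at \<open>0\<close> vanishes because
  \<open>n\<close> is positive.\<close>

lemma ladder_FTC:
  fixes a b :: "'a::euclidean_space"
  shows "(\<integral>r. indicator {0..1} r *\<^sub>R (of_real (r ^ (DIM('a) - 1)) * harmonic_expr (ladder a b (r\<^sup>2)) x) \<partial>lborel)
    = ladder a b 1 x"
proof -
  let ?F = "\<lambda>r. of_real (r ^ DIM('a)) * ladder a b (r\<^sup>2) x"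
  let ?f = "\<lambda>r. of_real (r ^ (DIM('a) - 1)) * harmonic_expr (ladder a b (r\<^sup>2)) x"
  define q :: complex where "q = of_real (a \<bullet> x) + \<i> * of_real (b \<bullet> x)"
  define Q :: complex where "Q = of_real ((norm a)\<^sup>2 - (norm b)\<^sup>2) + 2 * \<i> * of_real (a \<bullet> b)"
  have l: "ladder a b (r\<^sup>2) x = exp (of_real (r\<^sup>2) * q - of_real (r ^ 4) / 4 * Q - of_real ((norm x)\<^sup>2 / 2))" for r
    unfolding ladder_def gau_def exp_add[symmetric] q_def Q_def
    by (intro arg_cong[where f=exp]) (simp add: algebra_simps)
  have h: "?f r = of_real (r ^ (DIM('a) - 1)) * ((of_nat DIM('a) + of_real (2 * r\<^sup>2) * q - of_real (r ^ 4) * Q) *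
      exp (of_real (r\<^sup>2) * q - of_real (r ^ 4) / 4 * Q - of_real ((norm x)\<^sup>2 / 2)))" for r
    by (simp add: harmonic_expr_ladder l q_def Q_def)
  have cont: "continuous_on {0..1} ?f"
    unfolding h by (intro continuous_intros) simp
  have der: "(?F has_vector_derivative ?f r) (at r within {0..1})" for r
  proof -
    \<comment> \<open>The derivative is computed in a complex variable and then restricted to the
      real axis.\<close>
    let ?E = "\<lambda>z. z ^ DIM('a) * exp (z\<^sup>2 * q - z ^ 4 / 4 * Q - of_real ((norm x)\<^sup>2 / 2))"
    obtain m where m: "DIM('a) = Suc m" using DIM_positive[where 'a='a] by (cases "DIM('a)") auto
    have "(?E has_field_derivative z ^ m * ((of_nat (Suc m) + 2 * z\<^sup>2 * q - z ^ 4 * Q)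
        * exp (z\<^sup>2 * q - z ^ 4 / 4 * Q - of_real ((norm x)\<^sup>2 / 2)))) (at z)" for z
    proof -
      have e: "((\<lambda>z. z\<^sup>2 * q - z ^ 4 / 4 * Q - of_real ((norm x)\<^sup>2 / 2)) has_field_derivative 2 * z * q - z ^ 3 * Q) (at z)"
        by (auto intro!: derivative_eq_intros)
      have p: "((\<lambda>z. z ^ Suc m) has_field_derivative of_nat (Suc m) * z ^ m) (at z)"
        by (rule DERIV_cong[OF DERIV_power[OF DERIV_ident]]) simp
      show ?thesis
        unfolding m using DERIV_mult[OF p DERIV_chain2[OF DERIV_exp e]]
        by (rule DERIV_cong) (simp add: power2_eq_square eval_nat_numeral algebra_simps)
    qed
    from this[of "of_real r"] have "(?E has_field_derivative ?f r) (at (of_real r))"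
      unfolding h by (simp add: m)
    from has_vector_derivative_real_field[OF this, of "{0..1}"]
    show ?thesis by (simp add: l)
  qed
  have "(\<integral>r. indicator {0..1} r *\<^sub>R ?f r \<partial>lborel) = ?F 1 - ?F 0"
    by (rule integral_FTC_atLeastAtMost) (use der cont in auto)
  then show ?thesis by simp
qed

text \<open>The bound is uniform in \<open>r\<close>, as the exchange of the \<open>r\<close>- and
  \<open>x\<close>-integrals demands. The second exponential appears because
  \<open>r * (a \<bullet> x)\<close> is bounded by the larger of \<open>a \<bullet> x\<close> and
  \<open>0\<close>.\<close>

lemma norm_harmonic_expr_ladder_le:
  fixes a b :: "'a::euclidean_space"
  shows "\<exists>A\<ge>0. \<forall>r\<in>{0..1}. \<forall>x. norm (harmonic_expr (ladder a b r) x)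
    \<le> A * (bracket x * exp (a \<bullet> x - 1/2 * (norm x)\<^sup>2) + bracket x * exp (0 \<bullet> x - 1/2 * (norm x)\<^sup>2))"
proof (intro exI ballI allI conjI)
  define Q :: complex where "Q = of_real ((norm a)\<^sup>2 - (norm b)\<^sup>2) + 2 * \<i> * of_real (a \<bullet> b)"
  let ?B = "real DIM('a) + 2 * (norm a + norm b) + norm Q"
  let ?E = "exp ((norm b)\<^sup>2 / 4)"
  show "0 \<le> ?B * ?E" by simp
  fix r :: real and x :: 'a assume r: "r \<in> {0..1}"
  then have r2: "0 \<le> r\<^sup>2" "r\<^sup>2 \<le> 1" by (auto simp: power_le_one)
  have nx: "norm y * norm x \<le> norm y * bracket x" for y :: 'a
    by (intro mult_left_mono norm_le_bracket) auto
  have "norm (of_real (a \<bullet> x) + \<i> * of_real (b \<bullet> x)) \<le> \<bar>a \<bullet> x\<bar> + \<bar>b \<bullet> x\<bar>"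
    by (rule order_trans[OF norm_triangle_ineq]) (simp add: norm_mult)
  also have "\<dots> \<le> (norm a + norm b) * bracket x"
    using Cauchy_Schwarz_ineq2[of a x] Cauchy_Schwarz_ineq2[of b x] nx[of a] nx[of b] by (simp add: distrib_right)
  finally have "norm (of_real (2 * r) * (of_real (a \<bullet> x) + \<i> * of_real (b \<bullet> x))) \<le> 2 * ((norm a + norm b) * bracket x)"
    using r mult_mono[of "2 * r" 2 "norm (of_real (a \<bullet> x) + \<i> * of_real (b \<bullet> x))" "(norm a + norm b) * bracket x"]
    by (simp add: norm_mult)
  moreover have "norm (of_real (r\<^sup>2) * Q) \<le> norm Q * bracket x"
    using r2 mult_mono[of "r\<^sup>2" 1 "norm Q" "norm Q * bracket x"] mult_left_mono[OF bracket_ge_1[of x], of "norm Q"]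
    unfolding norm_mult norm_of_real by simp
  moreover have "norm (of_nat DIM('a) :: complex) \<le> real DIM('a) * bracket x"
    using mult_left_mono[OF bracket_ge_1[of x], of "real DIM('a)"] by simp
  ultimately have "norm (of_nat DIM('a) :: complex) + norm (of_real (2 * r) * (of_real (a \<bullet> x) + \<i> * of_real (b \<bullet> x)))
      + norm (of_real (r\<^sup>2) * Q) \<le> real DIM('a) * bracket x + 2 * ((norm a + norm b) * bracket x) + norm Q * bracket x"
    by (intro add_mono)
  also have "\<dots> = ?B * bracket x" by (simp only: distrib_right mult.assoc)
  finally have 1: "norm (of_nat DIM('a) + of_real (2 * r) * (of_real (a \<bullet> x) + \<i> * of_real (b \<bullet> x)) - of_real (r\<^sup>2) * Q)
      \<le> ?B * bracket x"
    by (rule order_trans[OF order_trans[OF norm_triangle_ineq4 add_right_mono[OF norm_triangle_ineq]]])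
  have "norm (exp (- of_real (r\<^sup>2 / 4) * Q)) = exp (r\<^sup>2 * ((norm b)\<^sup>2 - (norm a)\<^sup>2) / 4)"
    by (simp add: Q_def algebra_simps)
  also have "\<dots> \<le> ?E"
  proof -
    have "r\<^sup>2 * ((norm b)\<^sup>2 - (norm a)\<^sup>2) \<le> r\<^sup>2 * (norm b)\<^sup>2" using r2 by (intro mult_left_mono) auto
    also have "\<dots> \<le> 1 * (norm b)\<^sup>2" using r2 by (intro mult_right_mono) auto
    finally show ?thesis by simp
  qed
  finally have 2: "norm (exp (- of_real (r\<^sup>2 / 4) * Q)) \<le> ?E" .
  have "r * (a \<bullet> x) \<le> a \<bullet> x \<or> r * (a \<bullet> x) \<le> 0"
    using r mult_right_mono[of r 1 "a \<bullet> x"] mult_nonneg_nonpos[of r "a \<bullet> x"] by (cases "a \<bullet> x" "0::real" rule: linorder_cases) auto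
  then have "exp (r * (a \<bullet> x) - 1/2 * (norm x)\<^sup>2) \<le> exp (a \<bullet> x - 1/2 * (norm x)\<^sup>2) + exp (0 \<bullet> x - 1/2 * (norm x)\<^sup>2)"
    by (smt (verit) exp_le_cancel_iff exp_gt_zero inner_zero_left)
  then have 3: "norm (gau (1/2) (r *\<^sub>R a) (r *\<^sub>R b) x)
      \<le> exp (a \<bullet> x - 1/2 * (norm x)\<^sup>2) + exp (0 \<bullet> x - 1/2 * (norm x)\<^sup>2)"
    by (simp add: norm_gau)
  have "norm (harmonic_expr (ladder a b r) x) \<le> (?B * bracket x) * (?E * (exp (a \<bullet> x - 1/2 * (norm x)\<^sup>2) + exp (0 \<bullet> x - 1/2 * (norm x)\<^sup>2)))"
    unfolding harmonic_expr_ladder Q_def[symmetric] norm_mult ladder_def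
    by (intro mult_mono 1 2 3) (auto simp: less_imp_le)
  then show "norm (harmonic_expr (ladder a b r) x) \<le> ?B * ?E *
      (bracket x * exp (a \<bullet> x - 1/2 * (norm x)\<^sup>2) + bracket x * exp (0 \<bullet> x - 1/2 * (norm x)\<^sup>2))"
    by (simp only: algebra_simps)
qed

text \<open>A product \<open>p * q\<close> of nonnegative numbers is at most
  \<open>p\<^sup>2 + q\<^sup>2\<close>, and the square of the weight is again a Gaussian with a
  polynomial factor.\<close>

lemma square_integrable_gauss:
  assumes "square_integrable u"
  shows "integrable lborel (\<lambda>x. norm (u x) * (bracket x * exp (a \<bullet> x - 1/2 * (norm x)\<^sup>2)))"
proof (rule Bochner_Integration.integrable_bound)
  have m[measurable]: "u \<in> borel_measurable borel" and i: "integrable lborel (\<lambda>x. (norm (u x))\<^sup>2)"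
    using assms by (auto simp: square_integrable_def)
  have [measurable]: "bracket \<in> borel_measurable borel" unfolding bracket_def[abs_def] by measurable
  show "integrable lborel (\<lambda>x. (norm (u x))\<^sup>2 + bracket x ^ 2 * exp ((2 *\<^sub>R a) \<bullet> x - 1 * (norm x)\<^sup>2))"
    by (intro Bochner_Integration.integrable_add i integrable_bracket_power_gauss) auto
  show "(\<lambda>x. norm (u x) * (bracket x * exp (a \<bullet> x - 1/2 * (norm x)\<^sup>2))) \<in> borel_measurable lborel"
    by measurable
  have "norm (u x) * (bracket x * exp (a \<bullet> x - 1/2 * (norm x)\<^sup>2))
      \<le> (norm (u x))\<^sup>2 + bracket x ^ 2 * exp ((2 *\<^sub>R a) \<bullet> x - 1 * (norm x)\<^sup>2)" for x
  proof -
    let ?p = "norm (u x)" let ?q = "bracket x * exp (a \<bullet> x - 1/2 * (norm x)\<^sup>2)"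
    have "?q\<^sup>2 = bracket x ^ 2 * exp ((2 *\<^sub>R a) \<bullet> x - 1 * (norm x)\<^sup>2)"
      unfolding power_mult_distrib exp_double[symmetric] by (simp add: algebra_simps)
    moreover have "?p * ?q \<le> ?p\<^sup>2 + ?q\<^sup>2"
    proof -
      have "0 \<le> ?p * ?q" by (intro mult_nonneg_nonneg) (auto simp: less_imp_le)
      then show ?thesis using sum_squares_bound[of ?p ?q] by linarith
    qed
    ultimately show ?thesis by simp
  qed
  then show "AE x in lborel. norm (norm (u x) * (bracket x * exp (a \<bullet> x - 1/2 * (norm x)\<^sup>2)))
      \<le> norm ((norm (u x))\<^sup>2 + bracket x ^ 2 * exp ((2 *\<^sub>R a) \<bullet> x - 1 * (norm x)\<^sup>2))"
    by (auto simp: abs_mult less_imp_le intro!: always_eventually order_trans[OF _ abs_ge_self])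
qed

text \<open>By \<open>ladder_FTC\<close> the test function is a superposition of functions
  \<open>harmonic_expr (ladder a b (r\<^sup>2))\<close>. The weak equation replaces the pairing of
  \<open>u\<close> with each of them by an explicit Gaussian integral, so the value is the same for
  every square integrable solution \<open>u\<close>.\<close>

lemma harmonic_oscillator_coherent:
  fixes a b :: "'a::euclidean_space"
  assumes "(u, gau (1/2) (- a) b) \<in> harmonic_oscillator"
  shows "(\<integral>x. u x * gau (1/2) a b x \<partial>lborel)
    = of_real (sqrt pi ^ DIM('a) * exp (((norm a)\<^sup>2 - (norm b)\<^sup>2) / 2)) *
      (\<integral>r. indicator {0..1} r *\<^sub>R of_real (r ^ (DIM('a) - 1) * exp (- r\<^sup>2 * ((norm a)\<^sup>2 + (norm b)\<^sup>2) / 2)) \<partial>lborel)"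
proof -
  define q :: complex where "q = of_real ((norm a)\<^sup>2 - (norm b)\<^sup>2) + 2 * \<i> * of_real (a \<bullet> b)"
  define K where "K = (\<integral>r. indicator {0..1} r *\<^sub>R complex_of_real (r ^ (DIM('a) - 1) * exp (- r\<^sup>2 * ((norm a)\<^sup>2 + (norm b)\<^sup>2) / 2)) \<partial>lborel)"
  let ?w = "\<lambda>r. of_real (r ^ (DIM('a) - 1)) :: complex"
  let ?F = "\<lambda>(x, r). indicator {0..1} r *\<^sub>R (?w r * (u x * harmonic_expr (ladder a b (r\<^sup>2)) x))"
  have sq: "square_integrable u" and
    eq: "\<And>\<phi>. schwartz \<phi> \<Longrightarrow> (\<integral>x. u x * harmonic_expr \<phi> x \<partial>lborel) = (\<integral>x. gau (1/2) (- a) b x * \<phi> x \<partial>lborel)"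
    using assms by (auto simp: harmonic_oscillator_def)
  have [measurable]: "u \<in> borel_measurable borel" using sq by (auto simp: square_integrable_def)
  obtain A where A: "0 \<le> A" "\<And>r x. r \<in> {0..1} \<Longrightarrow> norm (harmonic_expr (ladder a b r) x)
    \<le> A * (bracket x * exp (a \<bullet> x - 1/2 * (norm x)\<^sup>2) + bracket x * exp (0 \<bullet> x - 1/2 * (norm x)\<^sup>2))"
    using norm_harmonic_expr_ladder_le[of a b] by blast
  let ?g = "\<lambda>x. A * (norm (u x) * (bracket x * exp (a \<bullet> x - 1/2 * (norm x)\<^sup>2)) + norm (u x) * (bracket x * exp (0 \<bullet> x - 1/2 * (norm x)\<^sup>2)))"
  have int: "integrable (lborel \<Otimes>\<^sub>M lborel) ?F"
  proof (rule integrable_pair_dominated[of _ ?g "indicator {0..1}"])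
    show "?F \<in> borel_measurable borel"
      unfolding harmonic_expr_ladder ladder_def gau_def borel_prod[symmetric] case_prod_beta by measurable
    show "integrable lborel ?g"
      by (intro integrable_mult_right Bochner_Integration.integrable_add square_integrable_gauss sq)
    show "integrable lborel (indicator {0..1} :: real \<Rightarrow> real)" by (simp add: integrable_indicator_iff)
    show "norm (?F (x, r)) \<le> ?g x * indicator {0..1} r" for x r
    proof (cases "r \<in> {0..1}")
      case True
      then have "norm (?w r) \<le> 1" "r\<^sup>2 \<in> {0..1}" by (auto simp: power_le_one norm_power)
      then have "norm (?w r) * (norm (u x) * norm (harmonic_expr (ladder a b (r\<^sup>2)) x))
         \<le> 1 * (norm (u x) * (A * (bracket x * exp (a \<bullet> x - 1/2 * (norm x)\<^sup>2) + bracket x * exp (0 \<bullet> x - 1/2 * (norm x)\<^sup>2))))"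
        by (intro mult_mono A(2)) auto
      with True show ?thesis by (simp add: norm_mult algebra_simps del: of_real_power)
    qed simp
  qed
  have "(\<integral>x. u x * ladder a b 1 x \<partial>lborel) = (\<integral>x. (\<integral>r. ?F (x, r) \<partial>lborel) \<partial>lborel)"
  proof (rule Bochner_Integration.integral_cong[OF refl])
    fix x
    have "(\<integral>r. ?F (x, r) \<partial>lborel)
        = (\<integral>r. u x * (indicator {0..1} r *\<^sub>R (?w r * harmonic_expr (ladder a b (r\<^sup>2)) x)) \<partial>lborel)"
      by (rule Bochner_Integration.integral_cong) auto
    then show "u x * ladder a b 1 x = (\<integral>r. ?F (x, r) \<partial>lborel)"
      by (simp only: integral_mult_right_zero ladder_FTC)
  qed
  also have "\<dots> = (\<integral>r. (\<integral>x. ?F (x, r) \<partial>lborel) \<partial>lborel)"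
    using lborel_pair.Fubini_integral[of "\<lambda>x r. ?F (x, r)"] int by simp
  also have "\<dots> = (\<integral>r. of_real (sqrt pi ^ DIM('a)) * exp ((of_real ((norm a)\<^sup>2 - (norm b)\<^sup>2) - 2 * \<i> * of_real (a \<bullet> b)) / 4) *
      (indicator {0..1} r *\<^sub>R of_real (r ^ (DIM('a) - 1) * exp (- r\<^sup>2 * ((norm a)\<^sup>2 + (norm b)\<^sup>2) / 2))) \<partial>lborel)"
  proof (rule Bochner_Integration.integral_cong[OF refl])
    fix r
    show "(\<integral>x. ?F (x, r) \<partial>lborel) = of_real (sqrt pi ^ DIM('a)) * exp ((of_real ((norm a)\<^sup>2 - (norm b)\<^sup>2) - 2 * \<i> * of_real (a \<bullet> b)) / 4) *
      (indicator {0..1} r *\<^sub>R of_real (r ^ (DIM('a) - 1) * exp (- r\<^sup>2 * ((norm a)\<^sup>2 + (norm b)\<^sup>2) / 2)))"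
    proof -
      have "(\<integral>x. ?F (x, r) \<partial>lborel) = indicator {0..1} r *\<^sub>R (?w r * (\<integral>x. u x * harmonic_expr (ladder a b (r\<^sup>2)) x \<partial>lborel))"
        by simp
      then show ?thesis
        unfolding eq[OF schwartz_ladder] integral_gau_ladder by (simp add: scaleR_conv_of_real mult_ac)
    qed
  qed
  also have "\<dots> = of_real (sqrt pi ^ DIM('a)) * exp ((of_real ((norm a)\<^sup>2 - (norm b)\<^sup>2) - 2 * \<i> * of_real (a \<bullet> b)) / 4) * K"
    by (simp only: integral_mult_right_zero K_def)
  finally have "(\<integral>x. u x * ladder a b 1 x \<partial>lborel)
      = of_real (sqrt pi ^ DIM('a)) * exp ((of_real ((norm a)\<^sup>2 - (norm b)\<^sup>2) - 2 * \<i> * of_real (a \<bullet> b)) / 4) * K" .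
  \<comment> \<open>The factor \<open>exp (q / 4)\<close> undoes the scaling of
    \<open>ladder\<close> at \<open>r = 1\<close>. The pairing contributed
    \<open>exp (cnj q / 4)\<close>, so the phases cancel.\<close>
  moreover have "u x * gau (1/2) a b x = exp (q / 4) * (u x * ladder a b 1 x)" for x
    unfolding ladder_def q_def[symmetric] by (simp add: exp_minus)
  ultimately have "(\<integral>x. u x * gau (1/2) a b x \<partial>lborel) = exp (q / 4) * (of_real (sqrt pi ^ DIM('a))
      * exp ((of_real ((norm a)\<^sup>2 - (norm b)\<^sup>2) - 2 * \<i> * of_real (a \<bullet> b)) / 4) * K)"
    by (simp only: integral_mult_right_zero)
  also have "\<dots> = of_real (sqrt pi ^ DIM('a)) * (exp (q / 4) * exp ((of_real ((norm a)\<^sup>2 - (norm b)\<^sup>2) - 2 * \<i> * of_real (a \<bullet> b)) / 4)) * K"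
    by (simp only: mult_ac)
  also have "exp (q / 4) * exp ((of_real ((norm a)\<^sup>2 - (norm b)\<^sup>2) - 2 * \<i> * of_real (a \<bullet> b)) / 4)
      = of_real (exp (((norm a)\<^sup>2 - (norm b)\<^sup>2) / 2))"
    unfolding exp_add[symmetric] exp_of_real[symmetric] q_def by (intro arg_cong[where f=exp]) (simp add: field_simps)
  finally show ?thesis by (simp only: K_def of_real_mult)
qed

subsection \<open>Fourier uniqueness and Mehler's symbol\<close>

text \<open>Integrating the vanishing transform over the frequency \<open>z\<close> against
  \<open>exp (- \<i> (y \<bullet> z))\<close> and a Gaussian gives, by Fubini, the mean of
  \<open>F\<close> around \<open>y\<close> over a Gaussian of width proportional to
  \<open>e\<close>. These means vanish and converge to a nonzero multiple of \<open>F y\<close> as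
  \<open>e\<close> tends to \<open>0\<close>, with \<open>K\<close> times a fixed Gaussian as
  majorant.\<close>

lemma fourier_uniqueness:
  fixes F :: "'a::euclidean_space \<Rightarrow> complex"
  assumes cont: "continuous_on UNIV F" and bdd: "\<And>x. norm (F x) \<le> K"
    and int: "integrable lborel F"
    and zero: "\<And>b. (\<integral>x. F x * gau 0 0 b x \<partial>lborel) = 0"
  shows "F y = 0"
proof -
  have [measurable]: "F \<in> borel_measurable borel"
    by (rule borel_measurable_continuous_onI[OF cont])
  have [measurable]: "gau c a b \<in> borel_measurable borel" for c and a b :: 'a
    by (intro borel_measurable_continuous_onI continuous_intros)
  have cont_F: "isCont F z" for z
    using cont by (simp add: continuous_on_eq_continuous_at)
  have mollified: "(\<integral>x. F (y + e *\<^sub>R x) * gau (1/4) 0 0 x \<partial>lborel) = 0" if e: "0 < e" for e :: real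
  proof -
    let ?G = "\<lambda>(x, z). F x * gau (e\<^sup>2) 0 (x - y) z"
    have split: "gau (e\<^sup>2) 0 (x - y) z = gau (e\<^sup>2) 0 (- y) z * gau 0 0 z x" for x z
      by (simp add: gau_def exp_add[symmetric] algebra_simps inner_commute)
    have G: "integrable (lborel \<Otimes>\<^sub>M lborel) ?G"
    proof (rule integrable_pair_dominated[of _ "\<lambda>x. norm (F x)" "\<lambda>z. exp (0 \<bullet> z - e\<^sup>2 * (norm z)\<^sup>2)"])
      show "?G \<in> borel_measurable borel"
        unfolding gau_def borel_prod[symmetric] case_prod_beta by measurable
      show "integrable lborel (\<lambda>z::'a. exp (0 \<bullet> z - e\<^sup>2 * (norm z)\<^sup>2))"
        using e by (intro integrable_gauss) simp
    qed (use int in \<open>auto simp: norm_mult norm_gau\<close>)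
    have "0 = (\<integral>z. gau (e\<^sup>2) 0 (- y) z * (\<integral>x. F x * gau 0 0 z x \<partial>lborel) \<partial>lborel)"
      by (simp only: zero) simp
    also have "\<dots> = (\<integral>z. (\<integral>x. ?G (x, z) \<partial>lborel) \<partial>lborel)"
      unfolding split by (simp add: integral_mult_right_zero[symmetric] mult_ac del: integral_mult_right_zero)
    also have "\<dots> = (\<integral>x. (\<integral>z. ?G (x, z) \<partial>lborel) \<partial>lborel)"
      using lborel_pair.Fubini_integral[of "\<lambda>x z. ?G (x, z)"] G by simp
    also have "\<dots> = (\<integral>x. of_real (sqrt (pi / e\<^sup>2) ^ DIM('a)) * (F x * gau (1 / (4 * e\<^sup>2)) 0 0 (x - y)) \<partial>lborel)"
    proof (rule Bochner_Integration.integral_cong[OF refl])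
      fix x
      show "(\<integral>z. ?G (x, z) \<partial>lborel) = of_real (sqrt (pi / e\<^sup>2) ^ DIM('a)) * (F x * gau (1 / (4 * e\<^sup>2)) 0 0 (x - y))"
        using e by (simp add: integral_gau) (simp add: gau_def field_simps)
    qed
    finally have "(\<integral>x. F x * gau (1 / (4 * e\<^sup>2)) 0 0 (x - y) \<partial>lborel) = 0"
      using e by simp
    then have "0 = (\<integral>x. F (y + e *\<^sub>R x) * gau (1 / (4 * e\<^sup>2)) 0 0 (y + e *\<^sub>R x - y) \<partial>lborel)"
      using e by (subst (asm) lborel_integral_affine[of _ e y]) auto
    moreover have "gau (1 / (4 * e\<^sup>2)) 0 0 (y + e *\<^sub>R x - y) = gau (1/4) 0 0 x" for x
      using e by (simp add: gau_def power_mult_distrib)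
    ultimately show ?thesis by simp
  qed
  have "(\<lambda>k. \<integral>x. F (y + (1 / real (Suc k)) *\<^sub>R x) * gau (1/4) 0 0 x \<partial>lborel)
      \<longlonglongrightarrow> (\<integral>x. F y * gau (1/4) 0 (0::'a) x \<partial>lborel)"
  proof (rule integral_dominated_convergence[where w="\<lambda>x. K * norm (gau (1/4) 0 0 x)"])
    show "integrable lborel (\<lambda>x::'a. K * norm (gau (1/4) 0 0 x))"
      by (intro integrable_mult_right integrable_norm integrable_gau) simp
    show "AE x in lborel. (\<lambda>k. F (y + (1 / real (Suc k)) *\<^sub>R x) * gau (1/4) 0 0 x) \<longlonglongrightarrow> F y * gau (1/4) 0 0 x"
    proof (intro always_eventually allI tendsto_mult tendsto_const)
      fix x
      have "(\<lambda>k. y + (1 / real (Suc k)) *\<^sub>R x) \<longlonglongrightarrow> y + 0 *\<^sub>R x"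
        by (intro tendsto_intros LIMSEQ_Suc[OF lim_1_over_n])
      then show "(\<lambda>k. F (y + (1 / real (Suc k)) *\<^sub>R x)) \<longlonglongrightarrow> F y"
        using isCont_tendsto_compose[OF cont_F] by auto
    qed
    show "AE x in lborel. norm (F (y + (1 / real (Suc k)) *\<^sub>R x) * gau (1/4) 0 0 x) \<le> K * norm (gau (1/4) 0 0 x)" for k
      by (intro always_eventually allI) (simp add: norm_mult bdd mult_right_mono)
  qed measurable
  moreover have "(\<integral>x. F (y + (1 / real (Suc k)) *\<^sub>R x) * gau (1/4) 0 0 x \<partial>lborel) = 0" for k
    by (rule mollified) simp
  ultimately have "(\<lambda>k. 0) \<longlonglongrightarrow> (\<integral>x. F y * gau (1/4) 0 (0::'a) x \<partial>lborel)"
    by (simp only:)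
  then have "(\<integral>x. F y * gau (1/4) 0 (0::'a) x \<partial>lborel) = 0"
    by (simp only: LIMSEQ_const_iff)
  then show ?thesis by (simp add: integral_gau)
qed

section \<open>Mehler's symbol and its Fourier transform\<close>

definition mehler_slope :: "real \<Rightarrow> real" where
  "mehler_slope r = (1 - r\<^sup>2) / (1 + r\<^sup>2)"

text \<open>For \<open>r = exp (- t)\<close> the slope above is \<open>tanh t\<close>, and for
  \<open>n \<ge> 1\<close> this weight is \<open>(cosh t) powr (- n)\<close> times the Jacobian
  \<open>1 / r\<close> of \<open>t = - ln r\<close>.\<close>

definition mehler_weight :: "nat \<Rightarrow> real \<Rightarrow> real" where
  "mehler_weight n r = 2 ^ n * r ^ (n - 1) / (1 + r\<^sup>2) ^ n"

lemma one_plus_square_nonzero [simp]: "1 + (r::real)\<^sup>2 \<noteq> 0"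
  by (metis add_pos_nonneg zero_le_power2 zero_less_one less_irrefl)

lemma one_plus_square_pos [simp]: "0 < 1 + (r::real)\<^sup>2"
  by (simp add: add_pos_nonneg)

lemma mehler_slope_bounds:
  assumes "r \<in> {0..1}"
  shows "1 - r \<le> mehler_slope r" "mehler_slope r \<le> 1" "0 \<le> mehler_slope r"
proof -
  \<comment> \<open>Divided by \<open>1 + r\<^sup>2\<close>, this product is
    \<open>mehler_slope r - (1 - r)\<close>. The linear lower bound for the slope is what makes the
    final integral over \<open>r\<close> elementary.\<close>
  have "0 \<le> (1 - r) * (r - r\<^sup>2)"
    using assms by (intro mult_nonneg_nonneg) (auto simp: power2_eq_square mult_left_le)
  then show "1 - r \<le> mehler_slope r"
    by (simp add: mehler_slope_def pos_le_divide_eq) (simp add: power2_eq_square algebra_simps)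
  show "mehler_slope r \<le> 1" "0 \<le> mehler_slope r"
    using assms by (auto simp: mehler_slope_def power_le_one)
qed

lemma mehler_weight_bounds:
  assumes "r \<in> {0..1}"
  shows "0 \<le> mehler_weight n r" "mehler_weight n r \<le> 2 ^ n"
proof -
  show "0 \<le> mehler_weight n r" using assms by (simp add: mehler_weight_def)
  have "r ^ (n - 1) / (1 + r\<^sup>2) ^ n \<le> 1 / 1"
    using assms by (intro frac_le) (auto simp: power_le_one)
  then have "2 ^ n * (r ^ (n - 1) / (1 + r\<^sup>2) ^ n) \<le> 2 ^ n * (1 / 1)"
    by (rule mult_left_mono) simp
  then show "mehler_weight n r \<le> 2 ^ n" by (simp add: mehler_weight_def)
qed

lemma continuous_on_mehler [continuous_intros]:
  "continuous_on S f \<Longrightarrow> continuous_on S (\<lambda>x. mehler_slope (f x))"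
  "continuous_on S f \<Longrightarrow> continuous_on S (\<lambda>x. mehler_weight n (f x))"
  unfolding mehler_slope_def mehler_weight_def by (intro continuous_intros; simp)+

lemma borel_measurable_mehler [measurable]:
  "mehler_slope \<in> borel_measurable borel" "mehler_weight n \<in> borel_measurable borel"
  by (intro borel_measurable_continuous_onI continuous_intros)+

text \<open>
  By Mehler's formula \<open>exp (- t H)\<close> has Weyl symbol \<open>(cosh t) powr (- n) * exp (- (norm X)\<^sup>2 * tanh t)\<close>;
  \<open>mehler n\<close> is its integral over \<open>t > 0\<close> in the variable \<open>r = exp (- t)\<close>.
\<close>

definition mehler :: "nat \<Rightarrow> 'a::euclidean_space \<Rightarrow> complex" where
  "mehler n X = (\<integral>r. indicator {0..1} r *\<^sub>R (of_real (mehler_weight n r) * gau (mehler_slope r) 0 0 X) \<partial>lborel)"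

text \<open>Because \<open>mehler_slope r + 1 = 2 / (1 + r\<^sup>2)\<close>, the Gaussian integral
  in \<open>2 * n\<close> variables yields \<open>(1 + r\<^sup>2) ^ n\<close>, which cancels the
  denominator of the weight. What remains is the \<open>r\<close>-integral of
  \<open>harmonic_oscillator_coherent\<close>.\<close>

lemma mehler_transform:
  fixes z :: "'a::euclidean_space"
  assumes n: "DIM('a) = 2 * n"
  shows "(\<integral>X. mehler n X * gau 1 0 (2 *\<^sub>R z) X \<partial>lborel) = of_real (pi ^ n * exp (- (norm z)\<^sup>2 / 2)) *
    (\<integral>r. indicator {0..1} r *\<^sub>R of_real (r ^ (n - 1) * exp (- r\<^sup>2 * (norm z)\<^sup>2 / 2)) \<partial>lborel)"
proof -
  let ?F = "\<lambda>(X, r). (indicator {0..1} r *\<^sub>R (of_real (mehler_weight n r) * gau (mehler_slope r) 0 0 X)) * gau 1 0 (2 *\<^sub>R z) X"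
  have F: "integrable (lborel \<Otimes>\<^sub>M lborel) ?F"
  proof (rule integrable_pair_dominated[of _ "\<lambda>X. exp (0 \<bullet> X - 1 * (norm X)\<^sup>2)" "\<lambda>r. 2 ^ n * indicator {0..1} r"])
    show "?F \<in> borel_measurable borel"
      unfolding gau_def borel_prod[symmetric] case_prod_beta by measurable
    show "integrable lborel (\<lambda>X::'a. exp (0 \<bullet> X - 1 * (norm X)\<^sup>2))"
      by (intro integrable_gauss) simp
    show "integrable lborel (\<lambda>r::real. 2 ^ n * indicator {0..1} r :: real)"
      by (intro integrable_mult_right) (simp add: integrable_indicator_iff)
    show "norm (?F (X, r)) \<le> exp (0 \<bullet> X - 1 * (norm X)\<^sup>2) * (2 ^ n * indicator {0..1} r)" for X r
    proof (cases "r \<in> {0..1}")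
      case True
      note b = mehler_slope_bounds[OF True] mehler_weight_bounds[OF True, of n]
      have "norm (of_real (mehler_weight n r) :: complex) * norm (gau (mehler_slope r) 0 0 X) \<le> 2 ^ n * 1"
        using b by (intro mult_mono) (auto simp: norm_gau)
      then have "norm (of_real (mehler_weight n r) :: complex) * norm (gau (mehler_slope r) 0 0 X) * norm (gau 1 0 (2 *\<^sub>R z) X)
          \<le> 2 ^ n * 1 * norm (gau 1 0 (2 *\<^sub>R z) X)"
        by (intro mult_right_mono) auto
      then show ?thesis using True by (simp add: norm_mult norm_gau mult_ac)
    qed simp
  qed
  have "(\<integral>X. mehler n X * gau 1 0 (2 *\<^sub>R z) X \<partial>lborel) = (\<integral>X. (\<integral>r. ?F (X, r) \<partial>lborel) \<partial>lborel)"
    by (simp add: mehler_def integral_mult_left_zero[symmetric] del: integral_mult_left_zero)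
  also have "\<dots> = (\<integral>r. (\<integral>X. ?F (X, r) \<partial>lborel) \<partial>lborel)"
    using lborel_pair.Fubini_integral[of "\<lambda>X r. ?F (X, r)"] F by simp
  also have "\<dots> = (\<integral>r. of_real (pi ^ n * exp (- (norm z)\<^sup>2 / 2)) *
      (indicator {0..1} r *\<^sub>R of_real (r ^ (n - 1) * exp (- r\<^sup>2 * (norm z)\<^sup>2 / 2))) \<partial>lborel)"
  proof (rule Bochner_Integration.integral_cong[OF refl])
    fix r
    show "(\<integral>X. ?F (X, r) \<partial>lborel) = of_real (pi ^ n * exp (- (norm z)\<^sup>2 / 2)) *
      (indicator {0..1} r *\<^sub>R of_real (r ^ (n - 1) * exp (- r\<^sup>2 * (norm z)\<^sup>2 / 2)))"
    proof (cases "r \<in> {0..1}")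
    case True
    have s: "mehler_slope r + 1 = 2 / (1 + r\<^sup>2)"
      by (simp add: mehler_slope_def field_simps)
    have "(\<integral>X. ?F (X, r) \<partial>lborel) = of_real (mehler_weight n r) * (\<integral>X. gau (mehler_slope r + 1) 0 (2 *\<^sub>R z) X \<partial>lborel)"
      using True by (simp add: mult.assoc gau_mult)
    also have "(\<integral>X. gau (mehler_slope r + 1) 0 (2 *\<^sub>R z) X \<partial>lborel)
        = of_real (sqrt (pi * (1 + r\<^sup>2) / 2) ^ (2 * n)) * of_real (exp (- (1 + r\<^sup>2) * (norm z)\<^sup>2 / 2))"
    proof -
      have "0 < 2 / (1 + r\<^sup>2)" by simp
      moreover have "(of_real ((norm (0::'a))\<^sup>2 - (norm (2 *\<^sub>R z))\<^sup>2) + 2 * \<i> * of_real (0 \<bullet> (2 *\<^sub>R z))) / of_real (4 * (2 / (1 + r\<^sup>2)))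
          = complex_of_real (- (1 + r\<^sup>2) * (norm z)\<^sup>2 / 2)"
        by (simp add: power_mult_distrib) (simp add: algebra_simps)
      moreover have "pi / (2 / (1 + r\<^sup>2)) = pi * (1 + r\<^sup>2) / 2" by simp
      ultimately show ?thesis
        unfolding s by (simp only: integral_gau n exp_of_real)
    qed
    also have "sqrt (pi * (1 + r\<^sup>2) / 2) ^ (2 * n) = (pi * (1 + r\<^sup>2) / 2) ^ n"
      by (simp add: power_mult)
    also have "exp (- (1 + r\<^sup>2) * (norm z)\<^sup>2 / 2) = exp (- (norm z)\<^sup>2 / 2) * exp (- r\<^sup>2 * (norm z)\<^sup>2 / 2)"
      unfolding exp_add[symmetric] by (simp add: algebra_simps add_divide_distrib diff_divide_distrib)
    finally have "(\<integral>X. ?F (X, r) \<partial>lborel) = of_real (mehler_weight n r * (pi * (1 + r\<^sup>2) / 2) ^ n *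
        (exp (- (norm z)\<^sup>2 / 2) * exp (- r\<^sup>2 * (norm z)\<^sup>2 / 2)))"
      by (simp only: of_real_mult mult.assoc)
    also have "mehler_weight n r * (pi * (1 + r\<^sup>2) / 2) ^ n = pi ^ n * r ^ (n - 1)"
      by (simp add: mehler_weight_def power_mult_distrib power_divide)
    finally show ?thesis using True by (simp add: mult_ac)
    qed simp
  qed
  finally show ?thesis by (simp only: integral_mult_right_zero)
qed

subsection \<open>Derivative estimates\<close>

text \<open>Cauchy's inequality on the disc of radius \<open>R = sqrt k\<close>. There
  \<open>Re (z\<^sup>2) \<ge> y\<^sup>2 / 2 - 3 * R\<^sup>2\<close>, so half of the Gaussian decay
  is kept at the price \<open>exp 3 ^ k\<close>. The choice of \<open>R\<close> gives
  \<open>fact k / R ^ k \<le> sqrt (fact k)\<close>, since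
  \<open>fact k \<le> k ^ k\<close>.\<close>

lemma gaussian_higher_deriv_bound:
  "norm ((deriv ^^ k) (\<lambda>z. exp (- z\<^sup>2)) (complex_of_real y)) \<le> exp 3 ^ k * sqrt (fact k) * exp (- y\<^sup>2 / 2)"
proof (cases "k = 0")
  case True
  have "norm (exp (- (complex_of_real y)\<^sup>2)) = exp (- y\<^sup>2)"
    by (simp flip: of_real_power)
  then show ?thesis using True by simp
next
  case False
  \<comment> \<open>The radius would degenerate for \<open>k = 0\<close>, which was therefore
    treated separately.\<close>
  define R where "R = sqrt (real k)"
  have R: "0 < R" "R\<^sup>2 = real k" using False by (auto simp: R_def)
  let ?g = "\<lambda>z::complex. exp (- z\<^sup>2)"
  have "norm ((deriv ^^ k) ?g (of_real y)) \<le> fact k * exp (3 * R\<^sup>2 - y\<^sup>2 / 2) / R ^ k"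
  proof (rule Cauchy_inequality)
    show "?g holomorphic_on ball (of_real y) R" by (intro holomorphic_intros)
    show "continuous_on (cball (of_real y) R) ?g" by (intro continuous_intros)
    show "0 < R" by (fact R)
    fix z assume z: "norm (complex_of_real y - z) = R"
    define w where "w = z - of_real y"
    have w: "norm w = R" using z by (simp add: w_def norm_minus_commute)
    have "Re (z\<^sup>2) = y\<^sup>2 + 2 * (y * Re w) + Re (w\<^sup>2)"
      by (simp add: w_def power2_eq_square algebra_simps)
    moreover have "\<bar>y * Re w\<bar> \<le> \<bar>y\<bar> * R"
      unfolding abs_mult using abs_Re_le_cmod[of w] w by (intro mult_left_mono) auto
    moreover have "\<bar>Re (w\<^sup>2)\<bar> \<le> R\<^sup>2"
      using abs_Re_le_cmod[of "w\<^sup>2"] w by (simp add: norm_power)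
    moreover have "0 \<le> (\<bar>y\<bar> - 2 * R)\<^sup>2" by simp
    then have "0 \<le> y\<^sup>2 - 4 * (\<bar>y\<bar> * R) + 4 * R\<^sup>2" by (simp add: power2_diff power_mult_distrib)
    ultimately have "- Re (z\<^sup>2) \<le> 3 * R\<^sup>2 - y\<^sup>2 / 2" by linarith
    then show "norm (exp (- z\<^sup>2)) \<le> exp (3 * R\<^sup>2 - y\<^sup>2 / 2)" by simp
  qed
  also have "\<dots> = exp 3 ^ k * exp (- y\<^sup>2 / 2) * (sqrt (fact k) * (sqrt (fact k) / R ^ k))"
  proof -
    have "exp (3 * R\<^sup>2 - y\<^sup>2 / 2) = exp 3 ^ k * exp (- y\<^sup>2 / 2)"
      by (simp add: R(2) exp_of_nat_mult[symmetric] exp_add[symmetric] mult.commute)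
    moreover have "(fact k :: real) = sqrt (fact k) * sqrt (fact k)" by simp
    ultimately show ?thesis by simp
  qed
  also have "\<dots> \<le> exp 3 ^ k * exp (- y\<^sup>2 / 2) * (sqrt (fact k) * 1)"
  proof -
    have "(fact k :: real) \<le> real k ^ k" using fact_le_power[of k, where 'a=real] by simp
    then have "sqrt (fact k) \<le> R ^ k" unfolding R_def real_sqrt_power[symmetric] by simp
    then have "sqrt (fact k) / R ^ k \<le> 1" using R by simp
    then show ?thesis by (intro mult_left_mono) auto
  qed
  finally show ?thesis by (simp add: mult_ac)
qed

text \<open>
  The \<open>k\<close>-th derivative of \<open>\<lambda>y. exp (- s * y\<^sup>2)\<close>, scaled back to \<open>s = 1\<close> to make the joint continuity in \<open>(s, y)\<close> visible.
\<close>

definition gherm :: "nat \<Rightarrow> real \<Rightarrow> real \<Rightarrow> complex" where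
  "gherm k s y = of_real (sqrt s) ^ k * (deriv ^^ k) (\<lambda>z. exp (- z\<^sup>2)) (of_real (sqrt s * y))"

lemma gherm_0: "0 \<le> s \<Longrightarrow> gherm 0 s y = gau s 0 0 y"
  by (simp add: gherm_def gau_def power_mult_distrib flip: of_real_mult of_real_power of_real_minus)

lemma gherm_has_vector_derivative:
  "((\<lambda>y. gherm k s y) has_vector_derivative gherm (Suc k) s y) (at y within S)"
proof -
  let ?g = "\<lambda>z::complex. exp (- z\<^sup>2)"
  have "(deriv ^^ k) ?g holomorphic_on UNIV"
    by (intro holomorphic_higher_deriv holomorphic_intros) auto
  then have "((deriv ^^ k) ?g has_field_derivative (deriv ^^ Suc k) ?g z) (at z)" for z
    using holomorphic_derivI[of "(deriv ^^ k) ?g" UNIV z] by simp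
  from DERIV_chain2[OF this DERIV_cmult_Id[of "of_real (sqrt s)"], of "of_real y"]
  have "((\<lambda>w. of_real (sqrt s) ^ k * (deriv ^^ k) ?g (of_real (sqrt s) * w)) has_field_derivative gherm (Suc k) s y) (at (of_real y))"
    unfolding gherm_def by (auto intro!: derivative_eq_intros)
  from has_vector_derivative_real_field[OF this] show ?thesis
    by (simp add: gherm_def)
qed

lemma continuous_on_gherm [continuous_intros]:
  assumes "continuous_on S f" "continuous_on S g"
  shows "continuous_on S (\<lambda>x. gherm k (f x) (g x))"
proof -
  have "(deriv ^^ k) (\<lambda>z::complex. exp (- z\<^sup>2)) holomorphic_on UNIV"
    by (intro holomorphic_higher_deriv holomorphic_intros) auto
  then have c: "continuous_on UNIV ((deriv ^^ k) (\<lambda>z::complex. exp (- z\<^sup>2)))"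
    by (rule holomorphic_on_imp_continuous_on)
  show ?thesis
    unfolding gherm_def by (intro continuous_intros continuous_on_compose2[OF c] assms) auto
qed

lemma norm_gherm_le:
  assumes "0 \<le> s"
  shows "norm (gherm k s y) \<le> sqrt s ^ k * (exp 3 ^ k * sqrt (fact k) * exp (- s * y\<^sup>2 / 2))"
proof -
  have "norm (gherm k s y) = sqrt s ^ k * norm ((deriv ^^ k) (\<lambda>z. exp (- z\<^sup>2)) (complex_of_real (sqrt s * y)))"
    using assms by (simp add: gherm_def norm_mult norm_power)
  also have "\<dots> \<le> sqrt s ^ k * (exp 3 ^ k * sqrt (fact k) * exp (- (sqrt s * y)\<^sup>2 / 2))"
    using assms by (intro mult_left_mono gaussian_higher_deriv_bound) auto
  finally show ?thesis using assms by (simp add: power_mult_distrib)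
qed

text \<open>The candidate obtained by differentiating under the integral sign, coordinate by
  coordinate. It uses the Henstock-Kurzweil integral, to which the Leibniz rule applies;
  \<open>mehler\<close> is a Lebesgue integral for the sake of Fubini.\<close>

definition mehler_deriv :: "nat \<Rightarrow> ('a::euclidean_space \<Rightarrow> nat) \<Rightarrow> 'a \<Rightarrow> complex" where
  "mehler_deriv n \<alpha> X = integral {0..1}
     (\<lambda>r. of_real (mehler_weight n r) * (\<Prod>i\<in>Basis. gherm (\<alpha> i) (mehler_slope r) (X \<bullet> i)))"

lemma mehler_deriv_0: "mehler_deriv n (\<lambda>_. 0) = mehler n"
proof
  fix X :: 'a
  let ?f = "\<lambda>r. of_real (mehler_weight n r) * gau (mehler_slope r) 0 0 X"
  have "(\<Prod>i\<in>Basis. gherm 0 (mehler_slope r) (X \<bullet> i)) = gau (mehler_slope r) 0 0 X" if "r \<in> {0..1}" for r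
    using mehler_slope_bounds[OF that] by (subst gau_prod) (simp add: gherm_0)
  then have "mehler_deriv n (\<lambda>_. 0) X = integral {0..1} ?f"
    unfolding mehler_deriv_def by (intro integral_cong) auto
  also have "\<dots> = set_lebesgue_integral lborel {0..1} ?f"
    by (intro set_borel_integral_eq_integral(2)[symmetric] borel_integrable_atLeastAtMost' continuous_intros)
  finally show "mehler_deriv n (\<lambda>_. 0) X = mehler n X"
    by (simp add: mehler_def set_lebesgue_integral_def)
qed

lemma mehler_deriv_has_vector_derivative:
  assumes j: "j \<in> Basis"
  shows "((\<lambda>t. mehler_deriv n \<alpha> (X + t *\<^sub>R j)) has_vector_derivative mehler_deriv n (\<alpha>(j := Suc (\<alpha> j))) X) (at 0)"
proof -
  let ?c = "\<lambda>r. of_real (mehler_weight n r) * (\<Prod>i\<in>Basis - {j}. gherm (\<alpha> i) (mehler_slope r) (X \<bullet> i))"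
  let ?f = "\<lambda>t r. gherm (\<alpha> j) (mehler_slope r) (X \<bullet> j + t) * ?c r"
  let ?f' = "\<lambda>t r. gherm (Suc (\<alpha> j)) (mehler_slope r) (X \<bullet> j + t) * ?c r"
  \<comment> \<open>Along the direction \<open>j\<close> only the factor belonging to
    \<open>j\<close> varies; \<open>?c\<close> collects the weight and the other factors.\<close>
  have split: "of_real (mehler_weight n r) * (\<Prod>i\<in>Basis. gherm (\<beta> i) (mehler_slope r) ((X + t *\<^sub>R j) \<bullet> i))
      = gherm (\<beta> j) (mehler_slope r) (X \<bullet> j + t) * ?c r" if "\<And>i. i \<noteq> j \<Longrightarrow> \<beta> i = \<alpha> i" for \<beta> t r
  proof -
    have "(\<Prod>i\<in>Basis - {j}. gherm (\<beta> i) (mehler_slope r) ((X + t *\<^sub>R j) \<bullet> i)) = (\<Prod>i\<in>Basis - {j}. gherm (\<alpha> i) (mehler_slope r) (X \<bullet> i))"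
      using that j by (intro prod.cong) (auto simp: inner_add_left inner_Basis)
    then show ?thesis
      using j by (subst prod.remove[OF _ j]) (auto simp: inner_add_left mult_ac)
  qed
  have "((\<lambda>t. integral (cbox 0 1) (?f t)) has_vector_derivative integral (cbox 0 1) (?f' 0)) (at 0 within UNIV)"
  proof (rule leibniz_rule_vector_derivative)
    fix t r :: real
    have "((\<lambda>t. gherm (\<alpha> j) (mehler_slope r) (X \<bullet> j + t)) has_vector_derivative
        1 *\<^sub>R gherm (Suc (\<alpha> j)) (mehler_slope r) (X \<bullet> j + t)) (at t within UNIV)"
      by (rule vector_diff_chain_within[of "\<lambda>t. X \<bullet> j + t" 1 t UNIV "gherm (\<alpha> j) (mehler_slope r)", unfolded o_def])
         (auto intro!: derivative_eq_intros gherm_has_vector_derivative has_vector_derivative_eq_rhs simp: has_vector_derivative_def[of "\<lambda>t. _ + t"])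
    then show "((\<lambda>t. ?f t r) has_vector_derivative ?f' t r) (at t within UNIV)"
      by (intro has_vector_derivative_mult_left) simp
  next
    fix t :: real
    show "?f t integrable_on cbox 0 1"
      by (intro integrable_continuous continuous_intros)
  next
    show "continuous_on (UNIV \<times> cbox 0 1) (\<lambda>(t, r). ?f' t r)"
      unfolding case_prod_beta by (intro continuous_intros)
  qed auto
  moreover have "mehler_deriv n (\<alpha>(j := Suc (\<alpha> j))) X = integral (cbox 0 1) (?f' 0)"
  proof -
    have "of_real (mehler_weight n r) * (\<Prod>i\<in>Basis. gherm ((\<alpha>(j := Suc (\<alpha> j))) i) (mehler_slope r) ((X + 0 *\<^sub>R j) \<bullet> i))
        = gherm ((\<alpha>(j := Suc (\<alpha> j))) j) (mehler_slope r) (X \<bullet> j + 0) * ?c r" for r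
      by (rule split) simp
    then show ?thesis
      by (simp only: mehler_deriv_def cbox_interval scaleR_zero_left add_0_right fun_upd_same)
  qed
  ultimately show ?thesis
    by (simp only: mehler_deriv_def cbox_interval split[OF refl])
qed

text \<open>The invariant \<open>P\<close> joins two facts: the function is an iterated partial
  derivative of \<open>b\<close>, hence differentiable by smoothness, and it equals
  \<open>mehler_deriv n \<beta>\<close>. Differentiability turns \<open>partial_deriv j\<close> into
  the derivative along a line in direction \<open>j\<close>, and that derivative is known for
  \<open>mehler_deriv\<close>.\<close>

lemma multi_deriv_mehler:
  fixes b :: "'a::euclidean_space \<Rightarrow> complex"
  assumes smooth: "smooth b" and b: "b = mehler n"
  shows "multi_deriv \<alpha> b = mehler_deriv n \<alpha>"
proof -
  define P where "P f \<beta> \<longleftrightarrow> (\<exists>is. set is \<subseteq> Basis \<and> f = foldr partial_deriv is b) \<and> f = mehler_deriv n \<beta>" for f \<beta>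
  have step: "P (partial_deriv j f) (\<beta>(j := Suc (\<beta> j)))" if P: "P f \<beta>" and j: "j \<in> Basis" for f \<beta> j
  proof -
    obtain "is" where "is": "set is \<subseteq> Basis" "f = foldr partial_deriv is b" and f: "f = mehler_deriv n \<beta>"
      using P by (auto simp: P_def)
    have "partial_deriv j f X = mehler_deriv n (\<beta>(j := Suc (\<beta> j))) X" for X
    proof -
      have "f differentiable (at X)" using smooth "is" by (simp add: smooth_def)
      then have "(f has_derivative frechet_derivative f (at X)) (at (X + 0 *\<^sub>R j))"
        by (simp add: frechet_derivative_works)
      moreover have "((\<lambda>t. X + t *\<^sub>R j) has_derivative (\<lambda>t. t *\<^sub>R j)) (at 0)"
        by (auto intro!: derivative_eq_intros)
      ultimately have "((\<lambda>t. f (X + t *\<^sub>R j)) has_derivative (\<lambda>t. frechet_derivative f (at X) (t *\<^sub>R j))) (at 0)"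
        by (rule has_derivative_compose[rotated])
      moreover have "linear (frechet_derivative f (at X))"
        using \<open>f differentiable (at X)\<close> by (rule linear_frechet_derivative)
      ultimately have "((\<lambda>t. f (X + t *\<^sub>R j)) has_vector_derivative partial_deriv j f X) (at 0)"
        by (simp add: has_vector_derivative_def partial_deriv_def linear_cmul)
      moreover have "((\<lambda>t. f (X + t *\<^sub>R j)) has_vector_derivative mehler_deriv n (\<beta>(j := Suc (\<beta> j))) X) (at 0)"
        unfolding f by (rule mehler_deriv_has_vector_derivative[OF j])
      ultimately show ?thesis by (rule vector_derivative_unique_at)
    qed
    moreover have "partial_deriv j f = foldr partial_deriv (j # is) b" using "is" by simp
    ultimately show ?thesis
      unfolding P_def using "is" j by (metis (no_types, lifting) ext insert_subset list.simps(15))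
  qed
  have pow: "P ((partial_deriv j ^^ k) f) (\<beta>(j := \<beta> j + k))" if "P f \<beta>" "j \<in> Basis" for f \<beta> j k
  proof (induction k)
    case 0 then show ?case using that by simp
  next
    case (Suc k)
    moreover have "\<beta>(j := \<beta> j + k, j := Suc ((\<beta>(j := \<beta> j + k)) j)) = \<beta>(j := \<beta> j + Suc k)"
      by auto
    ultimately show ?case using step[OF Suc that(2)] by (simp only: funpow.simps o_apply)
  qed
  have "P (foldr (\<lambda>i. partial_deriv i ^^ \<alpha> i) xs b) (\<lambda>i. if i \<in> set xs then \<alpha> i else 0)"
    if "set xs \<subseteq> Basis" "distinct xs" for xs
    using that
  proof (induction xs)
    case Nil
    show ?case using b by (auto simp: P_def mehler_deriv_0 intro!: exI[of _ "[]"])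
  next
    case (Cons j xs)
    then have "P (foldr (\<lambda>i. partial_deriv i ^^ \<alpha> i) xs b) (\<lambda>i. if i \<in> set xs then \<alpha> i else 0)" by simp
    from pow[OF this, of j "\<alpha> j"] Cons.prems
    have "P (foldr (\<lambda>i. partial_deriv i ^^ \<alpha> i) (j # xs) b) ((\<lambda>i. if i \<in> set xs then \<alpha> i else 0)(j := \<alpha> j))" by simp
    moreover have "(\<lambda>i. if i \<in> set xs then \<alpha> i else 0)(j := \<alpha> j) = (\<lambda>i. if i \<in> set (j # xs) then \<alpha> i else 0)"
      by auto
    ultimately show ?case by simp
  qed
  from this[of basis_list] have "multi_deriv \<alpha> b = mehler_deriv n (\<lambda>i. if i \<in> Basis then \<alpha> i else 0)"
    by (simp add: P_def multi_deriv_def basis_list)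
  \<comment> \<open>\<open>mehler_deriv\<close> reads its multi-index on \<open>Basis\<close>
    only.\<close>
  also have "\<dots> = mehler_deriv n \<alpha>" by (simp add: mehler_deriv_def fun_eq_iff cong: prod.cong)
  finally show ?thesis .
qed

text \<open>After squaring, this is \<open>z ^ k * exp (- z) \<le> fact k\<close> for
  \<open>z = y\<^sup>2 / (2 * d)\<close>. In the application \<open>d\<close> is the dimension:
  \<open>exp (- y\<^sup>2 / 4)\<close> is shared equally among the coordinates, which produces
  \<open>sqrt (\<alpha>!)\<close> directly, and not the root of the factorial of the order.\<close>

lemma power_gauss_le:
  fixes y d :: real
  assumes "0 < d"
  shows "\<bar>y\<bar> ^ k * exp (- y\<^sup>2 / (4 * d)) \<le> sqrt (2 * d) ^ k * sqrt (fact k)"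
proof (rule power2_le_imp_le)
  define z where "z = y\<^sup>2 / (2 * d)"
  have z: "0 \<le> z" using assms by (simp add: z_def)
  have "(\<Sum>n\<in>{k}. inverse (fact n) * z ^ n) \<le> (\<Sum>n. inverse (fact n) * z ^ n)"
    by (rule sum_le_suminf[OF summable_exp]) (use z in auto)
  then have "z ^ k \<le> fact k * exp z" by (simp add: exp_def inverse_eq_divide pos_divide_le_eq mult.commute)
  then have "z ^ k * exp (- z) \<le> fact k" by (simp add: exp_minus divide_inverse[symmetric] pos_divide_le_eq)
  then have "(2 * d) ^ k * (z ^ k * exp (- z)) \<le> (2 * d) ^ k * fact k"
    using assms by (intro mult_left_mono) auto
  moreover have "(2 * d) ^ k * z ^ k = (y\<^sup>2) ^ k" using assms by (subst power_mult_distrib[symmetric]) (simp add: z_def)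
  moreover have "(\<bar>y\<bar> ^ k * exp (- y\<^sup>2 / (4 * d)))\<^sup>2 = (y\<^sup>2) ^ k * exp (- z)"
    using assms by (simp add: z_def power_mult_distrib power_mult[symmetric] exp_double[symmetric] mult.commute[of k] power_even_abs)
  moreover have "(sqrt (2 * d) ^ k * sqrt (fact k))\<^sup>2 = (2 * d) ^ k * fact k"
    using assms by (simp add: power_mult_distrib power_mult[symmetric] mult.commute[of k]) (simp add: power_mult)
  ultimately show "(\<bar>y\<bar> ^ k * exp (- y\<^sup>2 / (4 * d)))\<^sup>2 \<le> (sqrt (2 * d) ^ k * sqrt (fact k))\<^sup>2"
    by (simp only: mult.assoc[symmetric])
qed (use assms in auto)

lemma multi_fact_pos: "0 < multi_fact \<alpha>"
  by (simp add: multi_fact_def prod_pos)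

lemma sqrt_multi_fact: "sqrt (real (multi_fact \<alpha>)) = (\<Prod>i\<in>Basis. sqrt (fact (\<alpha> i)))"
proof -
  have "sqrt (\<Prod>i\<in>A. f i) = (\<Prod>i\<in>A. sqrt (f i))" for A and f :: "'a \<Rightarrow> real"
    by (induction A rule: infinite_finite_induct) (auto simp: real_sqrt_mult)
  then show ?thesis by (simp add: multi_fact_def)
qed

text \<open>The left side \<open>T\<close> is at most \<open>1\<close> and at most the base
  \<open>Y\<close> on the right, hence \<open>T \<le> T powr \<sigma> \<le> Y powr \<sigma>\<close>.
  This interpolates between the cases \<open>\<sigma> = 0\<close> and \<open>\<sigma> = 1\<close> of
  the theorem.\<close>

lemma slope_power_gauss_le:
  fixes X :: "'a::euclidean_space" and \<alpha> :: "'a \<Rightarrow> nat"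
  assumes s: "0 \<le> s" "s \<le> 1" and \<sigma>: "0 \<le> \<sigma>" "\<sigma> \<le> 1"
  shows "sqrt s ^ multi_size \<alpha> * exp (- s * (norm X)\<^sup>2 / 4)
    \<le> (exp (1/4) * sqrt (2 * real DIM('a)) ^ multi_size \<alpha> * sqrt (multi_fact \<alpha>) / bracket X ^ multi_size \<alpha>) powr \<sigma>"
    (is "?T \<le> ?Y powr \<sigma>")
proof -
  let ?k = "multi_size \<alpha>" let ?d = "real DIM('a)"
  have "sqrt s ^ ?k \<le> 1" using s by (simp add: power_le_one)
  then have T1: "?T \<le> 1 * 1" using s by (intro mult_mono) auto
  define y where "y = sqrt s * bracket X"
  have y: "0 \<le> y" "y\<^sup>2 = s * (1 + (norm X)\<^sup>2)"
    using s by (auto simp: y_def power_mult_distrib bracket_squared less_imp_le)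
  have "y ^ ?k * exp (- y\<^sup>2 / 4) = (\<Prod>i\<in>(Basis::'a set). \<bar>y\<bar> ^ \<alpha> i * exp (- y\<^sup>2 / (4 * ?d)))"
    using y(1) by (simp add: prod.distrib power_sum multi_size_def exp_of_nat_mult[symmetric])
  also have "\<dots> \<le> (\<Prod>i\<in>(Basis::'a set). sqrt (2 * ?d) ^ \<alpha> i * sqrt (fact (\<alpha> i)))"
    using power_gauss_le[of ?d y] by (intro prod_mono) auto
  also have "\<dots> = sqrt (2 * ?d) ^ ?k * sqrt (multi_fact \<alpha>)"
    by (simp add: prod.distrib power_sum multi_size_def sqrt_multi_fact)
  finally have 1: "y ^ ?k * exp (- y\<^sup>2 / 4) \<le> sqrt (2 * ?d) ^ ?k * sqrt (multi_fact \<alpha>)" .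
  have "?T * bracket X ^ ?k = y ^ ?k * exp (- s * (norm X)\<^sup>2 / 4)"
    by (simp add: y_def power_mult_distrib)
  \<comment> \<open>\<open>y\<^sup>2\<close> exceeds \<open>s * (norm X)\<^sup>2\<close> by
    \<open>s \<le> 1\<close>, whence the constant \<open>exp (1/4)\<close>.\<close>
  also have "\<dots> \<le> y ^ ?k * (exp (1/4) * exp (- y\<^sup>2 / 4))"
    unfolding exp_add[symmetric] using y s by (intro mult_left_mono) (auto simp: algebra_simps add_divide_distrib diff_divide_distrib)
  also have "\<dots> \<le> exp (1/4) * (sqrt (2 * ?d) ^ ?k * sqrt (multi_fact \<alpha>))"
    using mult_left_mono[OF 1, of "exp (1/4)"] by (simp add: mult_ac)
  finally have T2: "?T \<le> ?Y" by (simp add: pos_le_divide_eq mult_ac)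
  have T0: "0 \<le> ?T" using s by simp
  show ?thesis
  proof (cases "?T = 0")
    case True
    show ?thesis unfolding True by (rule powr_ge_zero)
  next
    case False
    then have "?T = ?T powr 1" using T0 by simp
    also have "\<dots> \<le> ?T powr \<sigma>"
      using T1 T0 \<sigma> by (intro powr_mono') auto
    also have "\<dots> \<le> ?Y powr \<sigma>" using T0 T2 \<sigma> by (intro powr_mono2) auto
    finally show ?thesis .
  qed
qed

lemma integral_exp_le:
  fixes B :: real
  assumes "0 < B"
  shows "integral {0..1} (\<lambda>r. exp (- (1 - r) * B)) \<le> 1 / B"
proof -
  have "((\<lambda>r. exp (- (1 - r) * B)) has_integral exp (- (1 - 1) * B) / B - exp (- (1 - 0) * B) / B) {0..1}"
    by (rule fundamental_theorem_of_calculus[where f="\<lambda>r. exp (- (1 - r) * B) / B"])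
       (use assms in \<open>auto intro!: derivative_eq_intros simp: has_real_derivative_iff_has_vector_derivative[symmetric]\<close>)
  then have "integral {0..1} (\<lambda>r. exp (- (1 - r) * B)) = 1 / B - exp (- B) / B"
    by (simp add: integral_unique)
  then show ?thesis using assms by simp
qed

text \<open>The factor \<open>exp (- s * (norm X)\<^sup>2 / 2)\<close> left by
  \<open>norm_gherm_le\<close>, with \<open>s\<close> the slope, is split into two equal factors,
  one for \<open>slope_power_gauss_le\<close> and one for the integral over \<open>r\<close>. In the
  constant, \<open>2 ^ n\<close> bounds the weight, \<open>4\<close> comes from
  \<open>1 / B\<close>, \<open>exp (1/2)\<close> from two losses of \<open>exp (1/4)\<close>,
  \<open>exp 3\<close> from Cauchy's inequality and the square root from the interpolation.\<close>

lemma norm_mehler_deriv_le: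
  fixes \<alpha> :: "'a::euclidean_space \<Rightarrow> nat"
  assumes \<sigma>: "\<sigma> \<in> {0..1}"
  shows "norm (mehler_deriv n \<alpha> X) \<le>
    (2 ^ n * 4 * exp (1/2) * (exp 3 * sqrt (2 * real DIM('a)))) ^ (multi_size \<alpha> + 1) * real (multi_fact \<alpha>) powr ((\<sigma> + 1) / 2)
      * bracket X powr (- 2 - \<sigma> * real (multi_size \<alpha>))"
proof -
  let ?k = "multi_size \<alpha>" let ?A = "sqrt (2 * real DIM('a))" let ?E = "exp (3::real)"
  let ?m = "real (multi_fact \<alpha>)"
  let ?Y = "exp (1/4) * ?A ^ ?k * sqrt ?m / bracket X ^ ?k"
  define B where "B = (bracket X)\<^sup>2 / 4"
  have B: "0 < B" by (simp add: B_def)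
  let ?G = "2 ^ n * ?E ^ ?k * sqrt ?m * ?Y powr \<sigma> * exp (1/4)"
  have G: "0 \<le> ?G" by simp
  have m1: "1 \<le> ?m" using multi_fact_pos[of \<alpha>] by linarith
  have "1 \<le> 2 * real DIM('a)" using DIM_positive[where 'a='a] by linarith
  then have A1: "1 \<le> ?A" by simp
  have pt: "norm (of_real (mehler_weight n r) * (\<Prod>i\<in>Basis. gherm (\<alpha> i) (mehler_slope r) (X \<bullet> i)))
      \<le> ?G * exp (- (1 - r) * B)" if r: "r \<in> {0..1}" for r
  proof -
    let ?s = "mehler_slope r"
    note s = mehler_slope_bounds[OF r]
    have "norm (\<Prod>i\<in>Basis. gherm (\<alpha> i) ?s (X \<bullet> i))
        \<le> (\<Prod>i\<in>Basis. sqrt ?s ^ \<alpha> i * (?E ^ \<alpha> i * sqrt (fact (\<alpha> i)) * exp (- ?s * (X \<bullet> i)\<^sup>2 / 2)))"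
      unfolding prod_norm[symmetric] using s by (intro prod_mono conjI norm_gherm_le) auto
    also have "\<dots> = sqrt ?s ^ ?k * (?E ^ ?k * sqrt ?m * exp (- ?s * (norm X)\<^sup>2 / 2))"
    proof -
      have "(norm X)\<^sup>2 = (\<Sum>i\<in>Basis. (X \<bullet> i)\<^sup>2)"
        unfolding power2_norm_eq_inner euclidean_inner[of X X] by (simp add: power2_eq_square)
      then have "exp (- ?s * (norm X)\<^sup>2 / 2) = (\<Prod>i\<in>Basis. exp (- ?s * (X \<bullet> i)\<^sup>2 / 2))"
        by (simp add: exp_sum[symmetric] sum_distrib_left sum_divide_distrib sum_negf)
      then show ?thesis by (simp add: prod.distrib power_sum multi_size_def sqrt_multi_fact)
    qed
    also have "\<dots> = ?E ^ ?k * sqrt ?m * ((sqrt ?s ^ ?k * exp (- ?s * (norm X)\<^sup>2 / 4)) * exp (- ?s * (norm X)\<^sup>2 / 4))"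
      by (simp add: exp_add[symmetric])
    also have "\<dots> \<le> ?E ^ ?k * sqrt ?m * (?Y powr \<sigma> * (exp (1/4) * exp (- (1 - r) * B)))"
    proof (intro mult_left_mono mult_mono)
      show "sqrt ?s ^ ?k * exp (- ?s * (norm X)\<^sup>2 / 4) \<le> ?Y powr \<sigma>"
        using s \<sigma> by (intro slope_power_gauss_le) auto
      have "(1 - r) * B \<le> ?s * B" using s B by (intro mult_right_mono) auto
      moreover have "?s * B \<le> 1 / 4 + ?s * (norm X)\<^sup>2 / 4" using s by (simp add: B_def bracket_squared algebra_simps)
      ultimately show "exp (- ?s * (norm X)\<^sup>2 / 4) \<le> exp (1/4) * exp (- (1 - r) * B)"
        unfolding exp_add[symmetric] by (simp add: algebra_simps)
    qed auto
    finally have "norm (\<Prod>i\<in>Basis. gherm (\<alpha> i) ?s (X \<bullet> i))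
        \<le> ?E ^ ?k * sqrt ?m * (?Y powr \<sigma> * (exp (1/4) * exp (- (1 - r) * B)))" .
    then have "norm (of_real (mehler_weight n r) :: complex) * norm (\<Prod>i\<in>Basis. gherm (\<alpha> i) ?s (X \<bullet> i))
        \<le> 2 ^ n * (?E ^ ?k * sqrt ?m * (?Y powr \<sigma> * (exp (1/4) * exp (- (1 - r) * B))))"
      using mehler_weight_bounds[OF r, of n] by (intro mult_mono) auto
    then show ?thesis by (simp only: norm_mult mult.assoc)
  qed
  have "norm (mehler_deriv n \<alpha> X) \<le> integral {0..1} (\<lambda>r. ?G * exp (- (1 - r) * B))"
    unfolding mehler_deriv_def
    by (intro integral_norm_bound_integral pt integrable_continuous_interval continuous_intros)
  also have "\<dots> \<le> ?G * (1 / B)"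
    using mult_left_mono[OF integral_exp_le[OF B] G] by simp
  also have "\<dots> = (2 ^ n * 4 * exp (1/4)) * ?E ^ ?k * (sqrt ?m * ?Y powr \<sigma>) * bracket X powr (- 2)"
  proof -
    have "1 / B = 4 * bracket X powr (- 2)"
      by (simp add: B_def powr_minus powr_numeral field_simps)
    then show ?thesis by (simp only: mult_ac)
  qed
  also have "?Y powr \<sigma> = (exp (1/4) * ?A ^ ?k) powr \<sigma> * (?m powr (\<sigma> / 2) * bracket X powr (- \<sigma> * ?k))"
  proof -
    have "sqrt ?m powr \<sigma> = ?m powr (\<sigma> / 2)" using m1 by (simp add: powr_half_sqrt[symmetric] powr_powr)
    moreover have "(bracket X ^ ?k) powr \<sigma> = bracket X powr (\<sigma> * ?k)"
      by (simp add: powr_realpow[symmetric] powr_powr mult.commute)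
    ultimately show ?thesis using m1 A1 by (simp add: powr_mult powr_divide powr_minus_divide)
  qed
  \<comment> \<open>Here the \<open>1/2\<close> of Cauchy's inequality and the
    \<open>\<sigma> / 2\<close> of the interpolation add up to the exponent of the
    factorial.\<close>
  also have "sqrt ?m * ((exp (1/4) * ?A ^ ?k) powr \<sigma> * (?m powr (\<sigma> / 2) * bracket X powr (- \<sigma> * ?k)))
      = (exp (1/4) * ?A ^ ?k) powr \<sigma> * (?m powr ((\<sigma> + 1) / 2) * bracket X powr (- \<sigma> * ?k))"
    using m1 by (simp add: powr_half_sqrt[symmetric] powr_add add_divide_distrib)
  also have "(2 ^ n * 4 * exp (1/4)) * ?E ^ ?k * ((exp (1/4) * ?A ^ ?k) powr \<sigma> * (?m powr ((\<sigma> + 1) / 2) * bracket X powr (- \<sigma> * ?k))) * bracket X powr (- 2)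
      = ((2 ^ n * 4 * exp (1/4)) * ?E ^ ?k * (exp (1/4) * ?A ^ ?k) powr \<sigma>) * ?m powr ((\<sigma> + 1) / 2) * bracket X powr (- 2 - \<sigma> * ?k)"
    by (simp add: powr_add[symmetric] mult_ac)
  also have "\<dots> \<le> (2 ^ n * 4 * exp (1/2) * (?E * ?A)) ^ (?k + 1) * ?m powr ((\<sigma> + 1) / 2) * bracket X powr (- 2 - \<sigma> * ?k)"
  proof (intro mult_right_mono)
    let ?K = "2 ^ n * 4 * exp (1/2) :: real"
    \<comment> \<open>A base that is at least \<open>1\<close> allows the exponent
      \<open>\<sigma>\<close> to be raised to \<open>1\<close>, which frees the constant from
      \<open>\<sigma>\<close>.\<close>
    have "1 * 1 \<le> exp (1/4) * ?A ^ ?k" using A1 by (intro mult_mono) (auto simp: one_le_power)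
    then have "(exp (1/4) * ?A ^ ?k) powr \<sigma> \<le> (exp (1/4) * ?A ^ ?k) powr 1"
      using \<sigma> by (intro powr_mono) auto
    also have "\<dots> = exp (1/4) * ?A ^ ?k" using A1 by (simp add: powr_one)
    finally have "(2 ^ n * 4 * exp (1/4)) * ?E ^ ?k * (exp (1/4) * ?A ^ ?k) powr \<sigma>
        \<le> (2 ^ n * 4 * exp (1/4)) * ?E ^ ?k * (exp (1/4) * ?A ^ ?k)" by (intro mult_left_mono) auto
    also have "\<dots> = 2 ^ n * 4 * (exp (1/4) * exp (1/4)) * (?E * ?A) ^ ?k"
      by (simp only: power_mult_distrib mult_ac)
    also have "exp (1/4) * exp (1/4) = exp (1/2 :: real)" by (simp add: exp_add[symmetric])
    also have "?K * (?E * ?A) ^ ?k \<le> (?K * (?E * ?A)) ^ (?k + 1)"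
    proof -
      have "1 * 1 \<le> (2::real) ^ n * 4" by (intro mult_mono) auto
      then have "1 * 1 \<le> ?K" by (intro mult_mono) auto
      then have K: "1 \<le> ?K" by simp
      have "1 * 1 \<le> ?E * ?A" using A1 by (intro mult_mono) auto
      then have L: "1 \<le> ?E * ?A" by simp
      have "?K ^ 1 * (?E * ?A) ^ ?k \<le> ?K ^ (?k + 1) * (?E * ?A) ^ (?k + 1)"
        using K L by (intro mult_mono power_increasing) auto
      then show ?thesis by (simp only: power_mult_distrib power_one_right)
    qed
    finally show "(2 ^ n * 4 * exp (1/4)) * ?E ^ ?k * (exp (1/4) * ?A ^ ?k) powr \<sigma> \<le> (?K * (?E * ?A)) ^ (?k + 1)" .
  qed auto
  finally show ?thesis .
qed

subsection \<open>Integration by parts in the Weyl quantization\<close>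

text \<open>Integration by parts on the whole space without boundary terms:
  \<open>F (y + j) - F y\<close> is the integral of \<open>F'\<close> over the segment from
  \<open>y\<close> to \<open>y + j\<close>. Integrated over \<open>y\<close>, by translation
  invariance, the difference gives \<open>0\<close> and every point of the segment contributes the
  integral of \<open>F'\<close>.\<close>

lemma integral_directional_derivative_eq_0:
  fixes F F' :: "'a::euclidean_space \<Rightarrow> complex"
  assumes der: "\<And>y. ((\<lambda>t. F (y + t *\<^sub>R j)) has_vector_derivative F' y) (at 0)"
    and F: "integrable lborel F" and F': "integrable lborel F'" and cont: "continuous_on UNIV F'"
  shows "(\<integral>y. F' y \<partial>lborel) = 0"
proof -
  let ?G = "\<lambda>(t, y). indicator {0..1} t *\<^sub>R F' (y + t *\<^sub>R j)"
  have [measurable]: "F' \<in> borel_measurable borel" "F \<in> borel_measurable borel"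
    using F F' by (auto dest: borel_measurable_integrable)
  have shift_int: "integrable lborel (\<lambda>y. H (y + v))" if "integrable lborel H" for H :: "'a \<Rightarrow> 'c::{banach,second_countable_topology}" and v
    using lborel_integrable_affine[of H 1 v] that borel_measurable_integrable[OF that] by (simp add: add.commute)
  have shift: "(\<integral>y. H (y + v) \<partial>lborel) = (\<integral>y. H y \<partial>lborel)" if "integrable lborel H" for H :: "'a \<Rightarrow> 'c::{banach,second_countable_topology}" and v
    using lborel_integral_affine[of H 1 v] borel_measurable_integrable[OF that] by (simp add: add.commute)
  have FTC: "(\<integral>t. indicator {0..1} t *\<^sub>R F' (y + t *\<^sub>R j) \<partial>lborel) = F (y + j) - F y" for y
  proof -
    have "((\<lambda>t. F (y + t *\<^sub>R j)) has_vector_derivative F' (y + t *\<^sub>R j)) (at t within {0..1})" for t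
    proof -
      have "((\<lambda>s. F (y + t *\<^sub>R j + s *\<^sub>R j)) has_vector_derivative F' (y + t *\<^sub>R j)) (at (t - t))"
        using der[of "y + t *\<^sub>R j"] by simp
      moreover have "((\<lambda>s. s - t) has_vector_derivative 1) (at t)"
        by (auto intro!: derivative_eq_intros simp: has_real_derivative_iff_has_vector_derivative[symmetric])
      ultimately have "((\<lambda>s. F (y + t *\<^sub>R j + s *\<^sub>R j)) \<circ> (\<lambda>s. s - t) has_vector_derivative 1 *\<^sub>R F' (y + t *\<^sub>R j)) (at t)"
        by (intro vector_diff_chain_at)
      then have "((\<lambda>s. F (y + s *\<^sub>R j)) has_vector_derivative F' (y + t *\<^sub>R j)) (at t)"
        by (simp add: o_def scaleR_left_diff_distrib)
      then show ?thesis by (rule has_vector_derivative_at_within)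
    qed
    moreover have "continuous_on {0..1} (\<lambda>t. F' (y + t *\<^sub>R j))"
      by (intro continuous_on_compose2[OF cont] continuous_intros) auto
    ultimately show ?thesis
      using integral_FTC_atLeastAtMost[of 0 1 "\<lambda>t. F (y + t *\<^sub>R j)" "\<lambda>t. F' (y + t *\<^sub>R j)"] by simp
  qed
  have G: "integrable (lborel \<Otimes>\<^sub>M lborel) ?G"
  proof (rule lborel_pair.Fubini_integrable)
    show "?G \<in> borel_measurable (lborel \<Otimes>\<^sub>M lborel)" by measurable
    have "(\<integral>y. norm (?G (t, y)) \<partial>lborel) = indicator {0..1} t * (\<integral>y. norm (F' y) \<partial>lborel)" for t
      using shift[OF integrable_norm[OF F'], of "t *\<^sub>R j"] by simp
    then show "integrable lborel (\<lambda>t. \<integral>y. norm (?G (t, y)) \<partial>lborel)"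
      by (simp only:) (intro integrable_mult_left, simp add: integrable_indicator_iff)
    show "AE t in lborel. integrable lborel (\<lambda>y. ?G (t, y))"
      using shift_int[OF F'] by auto
  qed
  have "0 = (\<integral>y. F (y + j) - F y \<partial>lborel)"
    using shift[OF F, of j] shift_int[OF F, of j] F by simp
  also have "\<dots> = (\<integral>y. (\<integral>t. ?G (t, y) \<partial>lborel) \<partial>lborel)"
    by (simp add: FTC)
  also have "\<dots> = (\<integral>t. (\<integral>y. ?G (t, y) \<partial>lborel) \<partial>lborel)"
    using lborel_pair.Fubini_integral[of "\<lambda>t y. ?G (t, y)"] G by simp
  also have "\<dots> = (\<integral>t. indicator {0..1::real} t *\<^sub>R (\<integral>y. F' y \<partial>lborel) \<partial>lborel)"
  proof (rule Bochner_Integration.integral_cong[OF refl])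
    fix t
    show "(\<integral>y. ?G (t, y) \<partial>lborel) = indicator {0..1} t *\<^sub>R (\<integral>y. F' y \<partial>lborel)"
      using shift[OF F', of "t *\<^sub>R j"] by (cases "t \<in> {0..1}") simp_all
  qed
  also have "\<dots> = (\<integral>y. F' y \<partial>lborel)"
  proof -
    have "(\<integral>t. indicator {0..1::real} t *\<^sub>R c \<partial>lborel) = (\<integral>t. indicator {0..1::real} t \<partial>lborel) *\<^sub>R c" for c :: complex
      by (rule integral_scaleR_left) (simp add: integrable_indicator_iff)
    then show ?thesis by simp
  qed
  finally show ?thesis by simp
qed

lemma differentiable_partial_deriv_funpow:
  assumes "smooth b" "j \<in> Basis"
  shows "(partial_deriv j ^^ l) b differentiable (at X)"
proof -
  have "(partial_deriv j ^^ l) b = foldr partial_deriv (replicate l j) b"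
    by (induction l) auto
  moreover have "set (replicate l j) \<subseteq> Basis" using assms(2) by auto
  ultimately show ?thesis using assms(1) unfolding smooth_def by metis
qed

lemma multi_deriv_single:
  fixes b :: "'a::euclidean_space \<Rightarrow> complex"
  assumes "j \<in> Basis"
  shows "multi_deriv (\<lambda>i. if i = j then l else 0) b = (partial_deriv j ^^ l) b"
proof -
  have "foldr (\<lambda>i. partial_deriv i ^^ (if i = j then l else 0)) xs b = (if j \<in> set xs then (partial_deriv j ^^ l) b else b)"
    if "distinct xs" for xs
    using that by (induction xs) auto
  then show ?thesis using assms by (simp add: multi_deriv_def basis_list)
qed

text \<open>The order is rounded up to a natural number that is still common to all derivatives. As
  differentiation does not raise the growth, finitely many integrations by parts can outweigh
  it.\<close>

lemma amplitude_bound: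
  assumes "amplitude b"
  shows "\<exists>M. \<forall>\<alpha>. \<exists>C\<ge>0. \<forall>X. norm (multi_deriv \<alpha> b X) \<le> C * bracket X ^ M"
proof -
  obtain m where m: "\<And>\<alpha>. \<exists>C. \<forall>X. norm (multi_deriv \<alpha> b X) \<le> C * bracket X powr m"
    using assms by (auto simp: amplitude_def)
  have "\<exists>C\<ge>0. \<forall>X. norm (multi_deriv \<alpha> b X) \<le> C * bracket X ^ nat \<lceil>m\<rceil>" for \<alpha>
  proof -
    obtain C where C: "\<And>X. norm (multi_deriv \<alpha> b X) \<le> C * bracket X powr m" using m by blast
    have "norm (multi_deriv \<alpha> b X) \<le> max C 0 * bracket X ^ nat \<lceil>m\<rceil>" for X
    proof -
      have "bracket X powr m \<le> bracket X powr real (nat \<lceil>m\<rceil>)"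
        by (intro powr_mono real_nat_ceiling_ge bracket_ge_1)
      then have le: "bracket X powr m \<le> bracket X ^ nat \<lceil>m\<rceil>" by (simp add: powr_realpow)
      have "norm (multi_deriv \<alpha> b X) \<le> max C 0 * bracket X powr m"
        by (rule order_trans[OF C]) (intro mult_right_mono, auto)
      also have "\<dots> \<le> max C 0 * bracket X ^ nat \<lceil>m\<rceil>" using le by (intro mult_left_mono) auto
      finally show ?thesis .
    qed
    then show ?thesis by (intro exI[of _ "max C 0"]) auto
  qed
  then show ?thesis by blast
qed

text \<open>Separates the variables, so that the growth in \<open>x\<close> and \<open>w\<close>
  leaves the \<open>y\<close>-integral. The squared inequality follows by expanding
  \<open>(1 + p) * (1 + q) * (1 + r)\<close>.\<close>

lemma bracket_midpoint_le:
  "bracket ((1/2) *\<^sub>R (x + y), w) \<le> bracket x * bracket y * bracket w"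
proof -
  have "(norm ((1/2) *\<^sub>R (x + y)))\<^sup>2 \<le> (norm x)\<^sup>2 + (norm y)\<^sup>2"
  proof -
    have "(norm (x + y))\<^sup>2 \<le> (norm x + norm y)\<^sup>2" by (intro power_mono norm_triangle_ineq) auto
    also have "\<dots> \<le> 4 * ((norm x)\<^sup>2 + (norm y)\<^sup>2)"
    proof -
      have "0 \<le> (norm x - norm y)\<^sup>2 + 2 * ((norm x)\<^sup>2 + (norm y)\<^sup>2)" by simp
      then show ?thesis by (simp add: power2_eq_square algebra_simps)
    qed
    finally show ?thesis by (simp add: power_divide)
  qed
  moreover have "1 + p + q + r \<le> (1 + p) * (1 + q) * (1 + r)" if "0 \<le> p" "0 \<le> q" "0 \<le> r" for p q r :: real
  proof -
    have "(1 + p) * (1 + q) * (1 + r) = 1 + p + q + r + (p * q + p * r + q * r + p * q * r)"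
      by (simp add: algebra_simps)
    moreover have "0 \<le> p * q + p * r + q * r + p * q * r" using that by simp
    ultimately show ?thesis by linarith
  qed
  from this[of "(norm x)\<^sup>2" "(norm y)\<^sup>2" "(norm w)\<^sup>2"]
  have "1 + (norm x)\<^sup>2 + (norm y)\<^sup>2 + (norm w)\<^sup>2 \<le> (bracket x * bracket y * bracket w)\<^sup>2"
    unfolding power_mult_distrib bracket_squared by simp
  moreover have "(bracket ((1/2) *\<^sub>R (x + y), w))\<^sup>2 = 1 + (norm ((1/2) *\<^sub>R (x + y)))\<^sup>2 + (norm w)\<^sup>2"
    unfolding bracket_squared norm_Pair by (simp del: norm_scaleR)
  ultimately have "(bracket ((1/2) *\<^sub>R (x + y), w))\<^sup>2 \<le> (bracket x * bracket y * bracket w)\<^sup>2"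
    by linarith
  then show ?thesis by (rule power2_le_imp_le) simp
qed

lemma bracket_Pair_le: "bracket (x, w) \<le> bracket x * bracket w"
proof -
  have "(bracket (x, w))\<^sup>2 \<le> (bracket x * bracket w)\<^sup>2"
    unfolding power_mult_distrib bracket_squared norm_Pair by (simp add: algebra_simps)
  then show ?thesis by (rule power2_le_imp_le) simp
qed

lemma borel_measurable_bracket [measurable]: "bracket \<in> borel_measurable borel"
  unfolding bracket_def[abs_def] by measurable

text \<open>
  The terms produced by integrating by parts in the direction \<open>j\<close> in the \<open>y\<close>-integral of the Weyl
  quantization of a Gaussian; the factor \<open>exp (- \<i> (y \<bullet> w))\<close> is absorbed in the Gaussian.
\<close>

definition weyl_term :: "('a::euclidean_space \<times> 'a \<Rightarrow> complex) \<Rightarrow> 'a \<Rightarrow> 'a \<Rightarrow> 'a \<Rightarrow> nat \<Rightarrow> nat \<Rightarrow> real \<Rightarrow> 'a \<Rightarrow> 'a \<Rightarrow> 'a \<Rightarrow> complex" where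
  "weyl_term b a v j l k c x w y =
     (partial_deriv (j, 0) ^^ l) b ((1/2) *\<^sub>R (x + y), w) * (of_real (y \<bullet> j) ^ k * gau c a (v - w) y)"

text \<open>The \<open>y\<close>-integral of the Weyl quantization applied to a coherent state,
  stripped of \<open>exp (\<i> (x \<bullet> w))\<close>. The parameter \<open>c\<close> stays free
  because a Gaussian cut-off in \<open>y\<close> merely moves it from \<open>1/2\<close> to
  \<open>(1 + \<epsilon>\<^sup>2) / 2\<close>.\<close>

definition weyl_inner :: "('a::euclidean_space \<times> 'a \<Rightarrow> complex) \<Rightarrow> 'a \<Rightarrow> 'a \<Rightarrow> real \<Rightarrow> 'a \<Rightarrow> 'a \<Rightarrow> complex" where
  "weyl_inner b a v c x w = (\<integral>y. b ((1/2) *\<^sub>R (x + y), w) * gau c a (v - w) y \<partial>lborel)"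

lemma weyl_term_bound:
  assumes D: "\<And>X. norm ((partial_deriv (j, 0) ^^ l) b X) \<le> C * bracket X ^ M" and C: "0 \<le> C"
    and j: "j \<in> Basis" and c: "1/2 \<le> c"
  shows "norm (weyl_term b a v j l k c x w y)
    \<le> C * bracket x ^ M * bracket w ^ M * (bracket y ^ (M + k) * exp (a \<bullet> y - 1/2 * (norm y)\<^sup>2))"
proof -
  have "norm ((partial_deriv (j, 0) ^^ l) b ((1/2) *\<^sub>R (x + y), w)) \<le> C * bracket ((1/2) *\<^sub>R (x + y), w) ^ M"
    by (rule D)
  also have "\<dots> \<le> C * (bracket x * bracket y * bracket w) ^ M"
    by (intro mult_left_mono power_mono bracket_midpoint_le C) auto
  finally have 1: "norm ((partial_deriv (j, 0) ^^ l) b ((1/2) *\<^sub>R (x + y), w)) \<le> C * (bracket x * bracket y * bracket w) ^ M" .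
  have "\<bar>y \<bullet> j\<bar> \<le> bracket y" using Basis_le_norm[OF j, of y] norm_le_bracket[of y] by linarith
  then have 2: "norm (of_real (y \<bullet> j) ^ k :: complex) \<le> bracket y ^ k"
    by (simp add: norm_power power_mono)
  have "1/2 * (norm y)\<^sup>2 \<le> c * (norm y)\<^sup>2" using c by (intro mult_right_mono) auto
  then have 3: "norm (gau c a (v - w) y) \<le> exp (a \<bullet> y - 1/2 * (norm y)\<^sup>2)"
    by (simp add: norm_gau)
  have "norm (weyl_term b a v j l k c x w y)
      \<le> (C * (bracket x * bracket y * bracket w) ^ M) * (bracket y ^ k * exp (a \<bullet> y - 1/2 * (norm y)\<^sup>2))"
    unfolding weyl_term_def norm_mult by (intro mult_mono 1 2 3) (auto simp: C)
  then show ?thesis by (simp add: power_mult_distrib power_add mult_ac)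
qed

lemma continuous_on_partial_deriv_funpow:
  fixes b :: "'a::euclidean_space \<Rightarrow> complex"
  assumes "smooth b" "j \<in> Basis"
  shows "continuous_on UNIV ((partial_deriv j ^^ l) b)"
  using differentiable_partial_deriv_funpow[OF assms]
  by (simp add: continuous_at_imp_continuous_on differentiable_imp_continuous_within)

lemma continuous_on_weyl_term:
  fixes b :: "'a::euclidean_space \<times> 'a \<Rightarrow> complex"
  assumes "smooth b" "j \<in> Basis"
  shows "continuous_on UNIV (weyl_term b a v j l k c x w)"
proof -
  have "(j, 0 :: 'a) \<in> Basis" using assms(2) by (simp add: Basis_prod_def)
  note c = continuous_on_partial_deriv_funpow[OF assms(1) this, of l]
  show ?thesis
    unfolding weyl_term_def[abs_def] by (intro continuous_intros continuous_on_compose2[OF c]) auto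
qed

text \<open>The summand with \<open>(v - w) \<bullet> j\<close> is the point: since the whole
  derivative integrates to \<open>0\<close>, solving for it trades a factor
  \<open>w \<bullet> j\<close> for terms of the same kind. The factor \<open>1/2\<close> is the
  chain rule at the midpoint.\<close>

lemma weyl_term_has_vector_derivative:
  fixes b :: "'a::euclidean_space \<times> 'a \<Rightarrow> complex"
  assumes b: "smooth b" and j: "j \<in> Basis"
  shows "((\<lambda>t. weyl_term b a v j l k c x w (y + t *\<^sub>R j)) has_vector_derivative
    (1/2) * weyl_term b a v j (Suc l) k c x w y + of_nat k * weyl_term b a v j l (k - 1) c x w y
     + (of_real (a \<bullet> j) + \<i> * of_real ((v - w) \<bullet> j)) * weyl_term b a v j l k c x w y
     - of_real (2 * c) * weyl_term b a v j l (Suc k) c x w y) (at 0)"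
proof -
  let ?D = "(partial_deriv (j, 0) ^^ l) b" let ?z = "((1/2) *\<^sub>R (x + y), w)"
  have "(j, 0 :: 'a) \<in> Basis" using j by (simp add: Basis_prod_def)
  then have "?D differentiable (at ?z)" by (rule differentiable_partial_deriv_funpow[OF b])
  then have D: "(?D has_derivative frechet_derivative ?D (at ?z)) (at ?z)" and lin: "linear (frechet_derivative ?D (at ?z))"
    by (auto simp: frechet_derivative_works linear_frechet_derivative)
  have "((\<lambda>t. ((1/2) *\<^sub>R (x + (y + t *\<^sub>R j)), w)) has_derivative (\<lambda>t. ((1/2) *\<^sub>R (t *\<^sub>R j), 0))) (at 0)"
    by (auto intro!: derivative_eq_intros)
  from has_derivative_compose[OF this] D
  have "((\<lambda>t. ?D ((1/2) *\<^sub>R (x + (y + t *\<^sub>R j)), w)) has_derivative (\<lambda>t. frechet_derivative ?D (at ?z) ((1/2) *\<^sub>R (t *\<^sub>R j), 0))) (at 0)"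
    by simp
  moreover have "frechet_derivative ?D (at ?z) ((1/2) *\<^sub>R (t *\<^sub>R j), 0) = t *\<^sub>R ((1/2) * partial_deriv (j, 0) ?D ?z)" for t
  proof -
    have "((1/2) *\<^sub>R (t *\<^sub>R j), 0 :: 'a) = (t / 2) *\<^sub>R (j, 0)" by simp
    then have "frechet_derivative ?D (at ?z) ((1/2) *\<^sub>R (t *\<^sub>R j), 0) = (t / 2) *\<^sub>R frechet_derivative ?D (at ?z) (j, 0)"
      using linear_cmul[OF lin] by metis
    then show ?thesis by (simp add: partial_deriv_def scaleR_conv_of_real)
  qed
  ultimately have 1: "((\<lambda>t. ?D ((1/2) *\<^sub>R (x + (y + t *\<^sub>R j)), w)) has_vector_derivative (1/2) * partial_deriv (j, 0) ?D ?z) (at 0)"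
    by (simp add: has_vector_derivative_def)
  have jj: "j \<bullet> j = 1" using j by simp
  have 2: "((\<lambda>t. complex_of_real ((y + t *\<^sub>R j) \<bullet> j) ^ k) has_vector_derivative of_nat k * of_real (y \<bullet> j) ^ (k - 1)) (at 0)"
  proof -
    have "((\<lambda>z. (of_real (y \<bullet> j) + z) ^ k) has_field_derivative of_nat k * of_real (y \<bullet> j) ^ (k - 1)) (at (complex_of_real 0))"
      by (auto intro!: derivative_eq_intros)
    from has_vector_derivative_real_field[OF this] show ?thesis by (simp add: inner_add_left jj)
  qed
  have 3: "((\<lambda>t. gau c a (v - w) (y + t *\<^sub>R j)) has_vector_derivative
      (of_real (a \<bullet> j - 2 * c * (y \<bullet> j)) + \<i> * of_real ((v - w) \<bullet> j)) * gau c a (v - w) y) (at 0)"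
  proof -
    have "((\<lambda>t. y + t *\<^sub>R j) has_derivative (\<lambda>t. t *\<^sub>R j)) (at 0)"
      by (auto intro!: derivative_eq_intros)
    from has_derivative_compose[OF this gau_has_derivative[of c a "v - w"]]
    show ?thesis
      by (simp add: has_vector_derivative_def scaleR_conv_of_real algebra_simps)
  qed
  have "((\<lambda>t. weyl_term b a v j l k c x w (y + t *\<^sub>R j)) has_vector_derivative
     ?D ?z * (of_real (y \<bullet> j) ^ k * ((of_real (a \<bullet> j - 2 * c * (y \<bullet> j)) + \<i> * of_real ((v - w) \<bullet> j)) * gau c a (v - w) y)
        + of_nat k * of_real (y \<bullet> j) ^ (k - 1) * gau c a (v - w) y)
     + (1/2) * partial_deriv (j, 0) ?D ?z * (of_real (y \<bullet> j) ^ k * gau c a (v - w) y)) (at 0)"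
    unfolding weyl_term_def using has_vector_derivative_mult[OF 1 has_vector_derivative_mult[OF 2 3]] by simp
  then show ?thesis
    by (rule has_vector_derivative_eq_rhs) (simp add: weyl_term_def algebra_simps)
qed

lemma integrable_weyl_term:
  fixes b :: "'a::euclidean_space \<times> 'a \<Rightarrow> complex"
  assumes b: "smooth b" and j: "j \<in> Basis" and c: "1/2 \<le> c"
    and D: "\<And>X. norm ((partial_deriv (j, 0) ^^ l) b X) \<le> C * bracket X ^ M" and C: "0 \<le> C"
  shows "integrable lborel (weyl_term b a v j l k c x w)"
proof (rule Bochner_Integration.integrable_bound)
  show "integrable lborel (\<lambda>y. C * bracket x ^ M * bracket w ^ M * (bracket y ^ (M + k) * exp (a \<bullet> y - 1/2 * (norm y)\<^sup>2)))"
    by (intro integrable_mult_right integrable_bracket_power_gauss) simp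
  show "weyl_term b a v j l k c x w \<in> borel_measurable lborel"
    using borel_measurable_continuous_onI[OF continuous_on_weyl_term[OF b j]] by simp
  show "AE y in lborel. norm (weyl_term b a v j l k c x w y)
      \<le> norm (C * bracket x ^ M * bracket w ^ M * (bracket y ^ (M + k) * exp (a \<bullet> y - 1/2 * (norm y)\<^sup>2)))"
    using weyl_term_bound[OF D C j c] by (auto intro!: always_eventually order_trans[OF _ abs_ge_self])
qed

text \<open>Induction on the number \<open>N\<close> of integrations by parts, for all
  \<open>l\<close> and \<open>k\<close> simultaneously because each step shifts them. The exponent
  \<open>M\<close> serves every \<open>l\<close>, so the right side keeps its growth while powers of
  \<open>w \<bullet> j\<close> are gained.\<close>

lemma weyl_term_integral_bound:
  fixes b :: "'a::euclidean_space \<times> 'a \<Rightarrow> complex"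
  assumes b: "smooth b" and j: "j \<in> Basis"
    and D: "\<And>l. \<exists>C\<ge>0. \<forall>X. norm ((partial_deriv (j, 0) ^^ l) b X) \<le> C * bracket X ^ M"
  shows "\<exists>C\<ge>0. \<forall>c\<in>{1/2..1}. \<forall>x w. \<bar>w \<bullet> j\<bar> ^ N * norm (\<integral>y. weyl_term b a v j l k c x w y \<partial>lborel)
    \<le> C * (bracket x ^ M * bracket w ^ M)"
proof (induction N arbitrary: l k)
  case 0
  obtain C where C: "0 \<le> C" "\<And>X. norm ((partial_deriv (j, 0) ^^ l) b X) \<le> C * bracket X ^ M" using D by blast
  let ?E = "\<lambda>y. bracket y ^ (M + k) * exp (a \<bullet> y - 1/2 * (norm y)\<^sup>2)"
  have "norm (\<integral>y. weyl_term b a v j l k c x w y \<partial>lborel) \<le> (C * integral\<^sup>L lborel ?E) * (bracket x ^ M * bracket w ^ M)"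
    if c: "c \<in> {1/2..1}" for c x w
  proof -
    have "norm (\<integral>y. weyl_term b a v j l k c x w y \<partial>lborel) \<le> (\<integral>y. norm (weyl_term b a v j l k c x w y) \<partial>lborel)"
      by (rule integral_norm_bound)
    also have "\<dots> \<le> (\<integral>y. C * bracket x ^ M * bracket w ^ M * ?E y \<partial>lborel)"
      using c by (intro integral_mono integrable_norm integrable_weyl_term[OF b j _ C(2) C(1)] integrable_mult_right
          integrable_bracket_power_gauss weyl_term_bound[OF C(2) C(1) j]) auto
    finally show ?thesis by (simp add: mult_ac)
  qed
  moreover have "0 \<le> C * integral\<^sup>L lborel ?E" using C(1) by (intro mult_nonneg_nonneg integral_nonneg) auto
  ultimately show ?case by auto
next
  case (Suc N)
  obtain C1 where C1: "0 \<le> C1" "\<And>c x w. c \<in> {1/2..1} \<Longrightarrow>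
      \<bar>w \<bullet> j\<bar> ^ N * norm (\<integral>y. weyl_term b a v j (Suc l) k c x w y \<partial>lborel) \<le> C1 * (bracket x ^ M * bracket w ^ M)"
    using Suc.IH[of "Suc l" k] by blast
  \<comment> \<open>For \<open>k = 0\<close> the truncated \<open>k - 1\<close> does no harm, as
    this term enters with the factor \<open>k\<close>.\<close>
  obtain C2 where C2: "0 \<le> C2" "\<And>c x w. c \<in> {1/2..1} \<Longrightarrow>
      \<bar>w \<bullet> j\<bar> ^ N * norm (\<integral>y. weyl_term b a v j l (k - 1) c x w y \<partial>lborel) \<le> C2 * (bracket x ^ M * bracket w ^ M)"
    using Suc.IH[of l "k - 1"] by blast
  obtain C3 where C3: "0 \<le> C3" "\<And>c x w. c \<in> {1/2..1} \<Longrightarrow>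
      \<bar>w \<bullet> j\<bar> ^ N * norm (\<integral>y. weyl_term b a v j l k c x w y \<partial>lborel) \<le> C3 * (bracket x ^ M * bracket w ^ M)"
    using Suc.IH[of l k] by blast
  obtain C4 where C4: "0 \<le> C4" "\<And>c x w. c \<in> {1/2..1} \<Longrightarrow>
      \<bar>w \<bullet> j\<bar> ^ N * norm (\<integral>y. weyl_term b a v j l (Suc k) c x w y \<partial>lborel) \<le> C4 * (bracket x ^ M * bracket w ^ M)"
    using Suc.IH[of l "Suc k"] by blast
  let ?C = "C1 + k * C2 + (\<bar>a \<bullet> j\<bar> + \<bar>v \<bullet> j\<bar>) * C3 + 2 * C4"
  have "\<bar>w \<bullet> j\<bar> ^ Suc N * norm (\<integral>y. weyl_term b a v j l k c x w y \<partial>lborel) \<le> ?C * (bracket x ^ M * bracket w ^ M)"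
    if c: "c \<in> {1/2..1}" for c x w
  proof -
    define I where "I l k = (\<integral>y. weyl_term b a v j l k c x w y \<partial>lborel)" for l k
    define B where "B = bracket x ^ M * bracket w ^ M"
    have int: "integrable lborel (weyl_term b a v j l k c x w)" for l k
      using D[of l] c integrable_weyl_term[OF b j] by (metis atLeastAtMost_iff)
    have cont: "continuous_on UNIV (weyl_term b a v j l k c x w)" for l k
      by (rule continuous_on_weyl_term[OF b j])
    let ?q = "of_real (a \<bullet> j) + \<i> * of_real ((v - w) \<bullet> j) :: complex"
    have "(\<integral>y. (1/2) * weyl_term b a v j (Suc l) k c x w y + of_nat k * weyl_term b a v j l (k - 1) c x w y
       + ?q * weyl_term b a v j l k c x w y - of_real (2 * c) * weyl_term b a v j l (Suc k) c x w y \<partial>lborel) = 0"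
      by (rule integral_directional_derivative_eq_0[OF weyl_term_has_vector_derivative[OF b j] int])
         (intro Bochner_Integration.integrable_add Bochner_Integration.integrable_diff integrable_mult_right int
           continuous_on_add continuous_on_diff continuous_on_mult continuous_on_const cont)+
    then have "(1/2) * I (Suc l) k + of_nat k * I l (k - 1) + ?q * I l k - of_real (2 * c) * I l (Suc k) = 0"
      by (simp add: I_def int Bochner_Integration.integral_add Bochner_Integration.integral_diff)
    then have "\<i> * of_real (w \<bullet> j) * I l k = (1/2) * I (Suc l) k + of_nat k * I l (k - 1)
        + (of_real (a \<bullet> j) + \<i> * of_real (v \<bullet> j)) * I l k - of_real (2 * c) * I l (Suc k)"
      by (simp add: inner_diff_left algebra_simps)
    then have "\<bar>w \<bullet> j\<bar> * norm (I l k) = norm ((1/2) * I (Suc l) k + of_nat k * I l (k - 1)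
        + (of_real (a \<bullet> j) + \<i> * of_real (v \<bullet> j)) * I l k - of_real (2 * c) * I l (Suc k))"
      by (metis norm_mult norm_ii mult_1 norm_of_real)
    also have "\<dots> \<le> norm ((1/2) * I (Suc l) k) + norm (of_nat k * I l (k - 1))
        + norm ((of_real (a \<bullet> j) + \<i> * of_real (v \<bullet> j)) * I l k) + norm (of_real (2 * c) * I l (Suc k))"
      by (intro order_trans[OF norm_triangle_ineq4] order_trans[OF norm_triangle_ineq] add_mono order_refl)
    also have "\<dots> \<le> norm (I (Suc l) k) + k * norm (I l (k - 1)) + (\<bar>a \<bullet> j\<bar> + \<bar>v \<bullet> j\<bar>) * norm (I l k) + 2 * norm (I l (Suc k))"
    proof (intro add_mono)
      have "norm (of_real (a \<bullet> j) + \<i> * of_real (v \<bullet> j)) \<le> \<bar>a \<bullet> j\<bar> + \<bar>v \<bullet> j\<bar>"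
        by (rule order_trans[OF norm_triangle_ineq]) (simp add: norm_mult)
      then show "norm ((of_real (a \<bullet> j) + \<i> * of_real (v \<bullet> j)) * I l k) \<le> (\<bar>a \<bullet> j\<bar> + \<bar>v \<bullet> j\<bar>) * norm (I l k)"
        unfolding norm_mult by (rule mult_right_mono) simp
      show "norm (of_real (2 * c) * I l (Suc k)) \<le> 2 * norm (I l (Suc k))"
        unfolding norm_mult norm_of_real using c by (intro mult_right_mono) auto
    qed (simp_all add: norm_mult)
    finally have "\<bar>w \<bullet> j\<bar> ^ N * (\<bar>w \<bullet> j\<bar> * norm (I l k)) \<le> \<bar>w \<bullet> j\<bar> ^ N * (norm (I (Suc l) k) + k * norm (I l (k - 1))
        + (\<bar>a \<bullet> j\<bar> + \<bar>v \<bullet> j\<bar>) * norm (I l k) + 2 * norm (I l (Suc k)))"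
      by (rule mult_left_mono) simp
    also have "\<dots> = \<bar>w \<bullet> j\<bar> ^ N * norm (I (Suc l) k) + k * (\<bar>w \<bullet> j\<bar> ^ N * norm (I l (k - 1)))
        + (\<bar>a \<bullet> j\<bar> + \<bar>v \<bullet> j\<bar>) * (\<bar>w \<bullet> j\<bar> ^ N * norm (I l k)) + 2 * (\<bar>w \<bullet> j\<bar> ^ N * norm (I l (Suc k)))"
      by (simp only: distrib_left distrib_right mult_ac)
    also have "\<dots> \<le> C1 * B + k * (C2 * B) + (\<bar>a \<bullet> j\<bar> + \<bar>v \<bullet> j\<bar>) * (C3 * B) + 2 * (C4 * B)"
      unfolding I_def B_def by (intro add_mono mult_left_mono C1 C2 C3 C4 c) auto
    finally show ?thesis by (simp add: I_def B_def algebra_simps)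
  qed
  moreover have "0 \<le> ?C" using C1(1) C2(1) C3(1) C4(1) by simp
  ultimately show ?case by blast
qed

text \<open>Integration by parts controls the powers of one coordinate of \<open>w\<close> at a
  time; this recombines them. With \<open>m\<close> the largest of \<open>1\<close> and the absolute
  coordinates, \<open>bracket w\<close> is at most \<open>DIM('a) + 1\<close> times
  \<open>m\<close>.\<close>

lemma bracket_power_le_sum:
  fixes w :: "'a::euclidean_space"
  shows "bracket w ^ N \<le> real (DIM('a) + 1) ^ N * (1 + (\<Sum>j\<in>Basis. \<bar>w \<bullet> j\<bar> ^ N))"
proof -
  define m where "m = Max (insert 1 ((\<lambda>j. \<bar>w \<bullet> j\<bar>) ` Basis))"
  have m1: "1 \<le> m" unfolding m_def by (rule Max_ge) auto
  have mj: "\<bar>w \<bullet> j\<bar> \<le> m" if "j \<in> Basis" for j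
    unfolding m_def by (rule Max_ge) (use that in auto)
  have "bracket w \<le> 1 + (\<Sum>j\<in>Basis. \<bar>w \<bullet> j\<bar>)"
    using bracket_le_norm[of w] norm_le_l1[of w] by linarith
  also have "\<dots> \<le> m + (\<Sum>j\<in>(Basis::'a set). m)" by (intro add_mono m1 sum_mono mj)
  also have "\<dots> = real (DIM('a) + 1) * m" by (simp add: algebra_simps)
  finally have "bracket w ^ N \<le> (real (DIM('a) + 1) * m) ^ N" by (intro power_mono) auto
  moreover have "m ^ N \<le> 1 + (\<Sum>j\<in>Basis. \<bar>w \<bullet> j\<bar> ^ N)"
  proof -
    have "m \<in> insert 1 ((\<lambda>j. \<bar>w \<bullet> j\<bar>) ` Basis)" unfolding m_def by (rule Max_in) auto
    then consider "m = 1" | j where "j \<in> Basis" "m = \<bar>w \<bullet> j\<bar>" by auto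
    then show ?thesis
    proof cases
      case 1 then show ?thesis by (simp add: sum_nonneg)
    next
      case 2
      then have "m ^ N \<le> (\<Sum>j\<in>Basis. \<bar>w \<bullet> j\<bar> ^ N)"
        using member_le_sum[of j Basis "\<lambda>j. \<bar>w \<bullet> j\<bar> ^ N"] by simp
      then show ?thesis by simp
    qed
  qed
  ultimately show ?thesis
    by (simp only: power_mult_distrib) (meson mult_left_mono of_nat_0_le_iff order_trans zero_le_power)
qed

text \<open>For \<open>l = k = 0\<close> the function \<open>weyl_term\<close> is the integrand of
  \<open>weyl_inner\<close>, whatever the direction \<open>j\<close>. Of the \<open>N\<close> powers
  gained, \<open>M\<close> compensate the growth of the symbol in \<open>w\<close> and the other
  \<open>2 * DIM('a)\<close> give integrability.\<close>

lemma weyl_inner_decay: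
  fixes b :: "'a::euclidean_space \<times> 'a \<Rightarrow> complex"
  assumes "amplitude b"
  shows "\<exists>K M. \<forall>c\<in>{1/2..1}. \<forall>x w. norm (weyl_inner b a v c x w) \<le> K * bracket x ^ M * inverse (bracket w ^ (2 * DIM('a)))"
proof -
  have b: "smooth b" using assms by (simp add: amplitude_def)
  obtain M where M: "\<And>\<alpha>. \<exists>C\<ge>0. \<forall>X. norm (multi_deriv \<alpha> b X) \<le> C * bracket X ^ M"
    using amplitude_bound[OF assms] by blast
  have D: "\<exists>C\<ge>0. \<forall>X. norm ((partial_deriv (j, 0) ^^ l) b X) \<le> C * bracket X ^ M" if "j \<in> Basis" for j :: 'a and l
  proof -
    have "(j, 0 :: 'a) \<in> Basis" using that by (simp add: Basis_prod_def)
    from multi_deriv_single[OF this, of l b] M[of "\<lambda>i. if i = (j, 0) then l else 0"] show ?thesis by simp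
  qed
  define N where "N = M + 2 * DIM('a)"
  have inner: "weyl_inner b a v c x w = (\<integral>y. weyl_term b a v j 0 0 c x w y \<partial>lborel)" for j c x w
    by (simp add: weyl_inner_def weyl_term_def)
  have bd: "\<exists>C\<ge>0. \<forall>c\<in>{1/2..1}. \<forall>x w. \<bar>w \<bullet> j\<bar> ^ n * norm (weyl_inner b a v c x w) \<le> C * (bracket x ^ M * bracket w ^ M)"
    if "j \<in> Basis" for j :: 'a and n
    unfolding inner[of _ _ _ j] by (rule weyl_term_integral_bound[OF b that D[OF that]])
  obtain C0 where C0: "0 \<le> C0" "\<And>c x w. c \<in> {1/2..1} \<Longrightarrow> norm (weyl_inner b a v c x w) \<le> C0 * (bracket x ^ M * bracket w ^ M)"
    using bd[OF SOME_Basis, of 0] by auto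
  have "\<exists>C. \<forall>j\<in>Basis. 0 \<le> C j \<and> (\<forall>c\<in>{1/2..1}. \<forall>x w. \<bar>w \<bullet> j\<bar> ^ N * norm (weyl_inner b a v c x w) \<le> C j * (bracket x ^ M * bracket w ^ M))"
    by (intro bchoice ballI) (use bd in blast)
  then obtain C where C: "\<And>j c x w. j \<in> Basis \<Longrightarrow> c \<in> {1/2..1} \<Longrightarrow>
      \<bar>w \<bullet> j\<bar> ^ N * norm (weyl_inner b a v c x w) \<le> C j * (bracket x ^ M * bracket w ^ M)" by blast
  define K where "K = real (DIM('a) + 1) ^ N * (C0 + (\<Sum>j\<in>Basis. C j))"
  have "norm (weyl_inner b a v c x w) \<le> K * bracket x ^ M * inverse (bracket w ^ (2 * DIM('a)))"
    if c: "c \<in> {1/2..1}" for c x w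
  proof -
    let ?J = "norm (weyl_inner b a v c x w)" let ?B = "bracket x ^ M * bracket w ^ M"
    have "bracket w ^ N * ?J \<le> real (DIM('a) + 1) ^ N * (1 + (\<Sum>j\<in>Basis. \<bar>w \<bullet> j\<bar> ^ N)) * ?J"
      by (intro mult_right_mono bracket_power_le_sum) auto
    also have "\<dots> = real (DIM('a) + 1) ^ N * (?J + (\<Sum>j\<in>Basis. \<bar>w \<bullet> j\<bar> ^ N * ?J))"
      by (simp only: mult.assoc distrib_right sum_distrib_right mult_1)
    also have "\<dots> \<le> real (DIM('a) + 1) ^ N * (C0 * ?B + (\<Sum>j\<in>Basis. C j * ?B))"
      by (intro mult_left_mono add_mono sum_mono C0 C c) auto
    also have "\<dots> = K * ?B"
      by (simp only: K_def mult.assoc distrib_right sum_distrib_right)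
    finally have "bracket w ^ M * (bracket w ^ (2 * DIM('a)) * ?J) \<le> bracket w ^ M * (K * bracket x ^ M)"
      by (simp add: N_def power_add mult_ac)
    then have "bracket w ^ (2 * DIM('a)) * ?J \<le> K * bracket x ^ M"
      by (rule mult_left_le_imp_le) simp
    then show ?thesis by (simp add: divide_inverse[symmetric] pos_le_divide_eq mult.commute)
  qed
  then show ?thesis by blast
qed

subsection \<open>Identification of the symbol\<close>

lemma borel_measurable_weyl_inner:
  fixes b :: "'a::euclidean_space \<times> 'a \<Rightarrow> complex"
  assumes "continuous_on UNIV b"
  shows "(\<lambda>z. weyl_inner b a v c (fst z) (snd z)) \<in> borel_measurable borel"
proof -
  have [measurable]: "b \<in> borel_measurable borel"
    using assms by (rule borel_measurable_continuous_onI)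
  have "(\<lambda>(z, y). b ((1/2) *\<^sub>R (fst z + y), snd z) * gau c a (v - snd z) y) \<in> borel_measurable (borel \<Otimes>\<^sub>M lborel)"
    unfolding gau_def borel_prod[symmetric] by measurable
  then have "(\<lambda>z. \<integral>y. b ((1/2) *\<^sub>R (fst z + y), snd z) * gau c a (v - snd z) y \<partial>lborel) \<in> borel_measurable borel"
    by (rule lborel.borel_measurable_lebesgue_integral)
  then show ?thesis by (simp add: weyl_inner_def)
qed

lemma borel_measurable_weyl_inner':
  fixes b :: "'a::euclidean_space \<times> 'a \<Rightarrow> complex"
  assumes "continuous_on UNIV b"
  shows "weyl_inner b a v c x \<in> borel_measurable borel"
proof -
  have "(\<lambda>w. (x, w)) \<in> borel \<rightarrow>\<^sub>M borel" by (intro borel_measurable_continuous_onI continuous_intros)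
  from measurable_compose[OF this borel_measurable_weyl_inner[OF assms]] show ?thesis by simp
qed

lemma amplitude_continuous: "amplitude b \<Longrightarrow> continuous_on UNIV b"
proof -
  assume "amplitude b"
  then have "foldr partial_deriv [] b differentiable (at x)" for x
    unfolding amplitude_def smooth_def by (metis empty_set empty_subsetI)
  then show ?thesis by (simp add: continuous_at_imp_continuous_on differentiable_imp_continuous_within)
qed

lemma amplitude_bound_0:
  assumes "amplitude b"
  shows "\<exists>C\<ge>0. \<exists>M. \<forall>X. norm (b X) \<le> C * bracket X ^ M"
proof -
  obtain M where "\<And>\<alpha>. \<exists>C\<ge>0. \<forall>X. norm (multi_deriv \<alpha> b X) \<le> C * bracket X ^ M"
    using amplitude_bound[OF assms] by blast
  from this[of "\<lambda>_. 0"] obtain C where C: "0 \<le> C" "\<And>X. norm (multi_deriv (\<lambda>_. 0) b X) \<le> C * bracket X ^ M" by blast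
  have "foldr (\<lambda>i. partial_deriv i ^^ 0) xs b = b" for xs by (induction xs) auto
  then have "multi_deriv (\<lambda>_. 0) b = b" by (simp add: multi_deriv_def)
  then show ?thesis using C by auto
qed

lemma weyl_inner_tendsto:
  fixes b :: "'a::euclidean_space \<times> 'a \<Rightarrow> complex"
  assumes amp: "amplitude b" and c: "\<And>k. 1/2 \<le> c k" "c \<longlonglongrightarrow> c'"
  shows "(\<lambda>k. weyl_inner b a v (c k) x w) \<longlonglongrightarrow> weyl_inner b a v c' x w"
proof -
  obtain C M where C: "0 \<le> C" "\<And>X. norm (b X) \<le> C * bracket X ^ M"
    using amplitude_bound_0[OF amp] by blast
  have [measurable]: "b \<in> borel_measurable borel"
    using amplitude_continuous[OF amp] by (rule borel_measurable_continuous_onI)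
  have [measurable]: "gau c a u \<in> borel_measurable borel" for c and a u :: 'a
    by (intro borel_measurable_continuous_onI continuous_intros)
  \<comment> \<open>Any direction will do: \<open>weyl_term_bound\<close> is applied with
    \<open>l = k = 0\<close>, where \<open>j\<close> drops out.\<close>
  obtain j :: 'a where j: "j \<in> Basis" using nonempty_Basis by blast
  let ?w = "\<lambda>y. C * bracket x ^ M * bracket w ^ M * (bracket y ^ (M + 0) * exp (a \<bullet> y - 1/2 * (norm y)\<^sup>2))"
  show ?thesis
    unfolding weyl_inner_def
  proof (rule integral_dominated_convergence[where w="?w"])
    show "integrable lborel ?w"
      by (intro integrable_mult_right integrable_bracket_power_gauss) simp
    show "AE y in lborel. norm (b ((1/2) *\<^sub>R (x + y), w) * gau (c k) a (v - w) y) \<le> ?w y" for k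
    proof (intro always_eventually allI)
      fix y
      have "norm (weyl_term b a v j 0 0 (c k) x w y) \<le> ?w y"
        by (rule weyl_term_bound[OF _ C(1) j c(1)]) (simp add: C(2))
      then show "norm (b ((1/2) *\<^sub>R (x + y), w) * gau (c k) a (v - w) y) \<le> ?w y"
        by (simp add: weyl_term_def)
    qed
    show "AE y in lborel. (\<lambda>k. b ((1/2) *\<^sub>R (x + y), w) * gau (c k) a (v - w) y) \<longlonglongrightarrow> b ((1/2) *\<^sub>R (x + y), w) * gau c' a (v - w) y"
      unfolding gau_def by (intro always_eventually allI tendsto_intros c(2))
  qed measurable
qed

text \<open>The regularization is evaluated with a Gaussian cut-off. Its \<open>y\<close>-part
  changes the parameter of the coherent state to \<open>c e\<close>, its \<open>w\<close>-part tends
  to \<open>1\<close>, and the decay of \<open>weyl_inner\<close>, uniform in the parameter,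
  dominates the \<open>w\<close>-integral in the limit.\<close>

lemma oscillatory_integral_weyl:
  fixes b :: "'a::euclidean_space \<times> 'a \<Rightarrow> complex"
  assumes amp: "amplitude b"
    and osc: "has_oscillatory_integral (\<lambda>(y, w). cis ((x - y) \<bullet> w) * b ((1/2) *\<^sub>R (x + y), w) * gau (1/2) a v y / of_real L) I"
  shows "I = (\<integral>w. cis (x \<bullet> w) * weyl_inner b a v (1/2) x w \<partial>lborel) / of_real L"
proof -
  let ?k = "gau (1/2) 0 0 :: 'a \<times> 'a \<Rightarrow> complex"
  let ?F = "\<lambda>(y, w). cis ((x - y) \<bullet> w) * b ((1/2) *\<^sub>R (x + y), w) * gau (1/2) a v y / of_real L"
  define c where "c e = (1 + e\<^sup>2) / 2" for e :: real
  let ?g = "\<lambda>e w. gau (e\<^sup>2 / 2) 0 0 w * cis (x \<bullet> w) / of_real L * weyl_inner b a v (c e) x w"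
  have int: "\<And>e. 0 < e \<Longrightarrow> integrable lborel (\<lambda>z. ?k (e *\<^sub>R z) * ?F z)"
    and lim: "((\<lambda>e. \<integral>z. ?k (e *\<^sub>R z) * ?F z \<partial>lborel) \<longlongrightarrow> I) (at_right 0)"
    using osc schwartz_gau[of "1/2" 0 0] unfolding has_oscillatory_integral_def by force+
  have pt: "?k (e *\<^sub>R (y, w)) * ?F (y, w) = gau (e\<^sup>2 / 2) 0 0 w * cis (x \<bullet> w) / of_real L *
      (b ((1/2) *\<^sub>R (x + y), w) * gau (c e) a (v - w) y)" for e y w
  proof -
    have "?k (e *\<^sub>R (y, w)) * cis ((x - y) \<bullet> w) * gau (1/2) a v y = gau (e\<^sup>2 / 2) 0 0 w * cis (x \<bullet> w) * gau (c e) a (v - w) y"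
      unfolding gau_def cis_conv_exp exp_add[symmetric]
      by (intro arg_cong[where f=exp])
         (simp add: c_def norm_Pair power_mult_distrib inner_commute algebra_simps add_divide_distrib)
    then show ?thesis by (simp add: mult_ac)
  qed
  have eq: "(\<integral>z. ?k (e *\<^sub>R z) * ?F z \<partial>lborel) = (\<integral>w. ?g e w \<partial>lborel)" if "0 < e" for e
  proof -
    define G where "G z = ?k (e *\<^sub>R z) * ?F z" for z
    have G: "G (y, w) = gau (e\<^sup>2 / 2) 0 0 w * cis (x \<bullet> w) / of_real L * (b ((1/2) *\<^sub>R (x + y), w) * gau (c e) a (v - w) y)" for y w
      unfolding G_def by (rule pt)
    have "integrable (lborel \<Otimes>\<^sub>M lborel) (\<lambda>(y, w). G (y, w))"
      using int[OF that] unfolding G_def[symmetric] by (simp add: lborel_prod)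
    from lborel_pair.integral_snd[OF this]
    have "(\<integral>z. G z \<partial>lborel) = (\<integral>w. (\<integral>y. G (y, w) \<partial>lborel) \<partial>lborel)"
      by (simp add: lborel_prod)
    then show ?thesis unfolding G_def[symmetric] by (simp only: G integral_mult_right_zero weyl_inner_def)
  qed
  \<comment> \<open>Dominated convergence is applied along a sequence; it identifies the limit,
    whose existence is part of the hypothesis.\<close>
  define e where "e k = 1 / real (Suc k)" for k
  have e: "0 < e k" "e k \<le> 1" for k by (auto simp: e_def)
  have e0: "e \<longlonglongrightarrow> 0" unfolding e_def[abs_def] by (intro LIMSEQ_Suc[OF lim_1_over_n])
  have "filterlim e (at_right 0) sequentially"
    using e0 e by (intro tendsto_imp_filterlim_at_right) auto
  from filterlim_compose[OF lim this]
  have 1: "(\<lambda>k. \<integral>w. ?g (e k) w \<partial>lborel) \<longlonglongrightarrow> I"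
    by (simp only: eq[OF e(1)])
  obtain K M where K: "\<And>c x w. c \<in> {1/2..1} \<Longrightarrow> norm (weyl_inner b a v c x w) \<le> K * bracket x ^ M * inverse (bracket w ^ (2 * DIM('a)))"
    using weyl_inner_decay[OF amp, of a v] by blast
  have [measurable]: "weyl_inner b a v c x \<in> borel_measurable borel" for c
    by (rule borel_measurable_weyl_inner'[OF amplitude_continuous[OF amp]])
  have [measurable]: "gau c a u \<in> borel_measurable borel" for c and a u :: 'a
    by (intro borel_measurable_continuous_onI continuous_intros)
  have [measurable]: "(\<lambda>w. cis (x \<bullet> w)) \<in> borel_measurable borel"
    unfolding cis_conv_exp by measurable
  have ce: "c (e k) \<in> {1/2..1}" for k
    using e[of k] by (auto simp: c_def power_le_one)
  let ?w = "\<lambda>w::'a. K * bracket x ^ M / \<bar>L\<bar> * inverse (bracket w ^ (2 * DIM('a)))"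
  have 2: "(\<lambda>k. \<integral>w. ?g (e k) w \<partial>lborel) \<longlonglongrightarrow> (\<integral>w. cis (x \<bullet> w) / of_real L * weyl_inner b a v (1/2) x w \<partial>lborel)"
  proof (rule integral_dominated_convergence[where w="?w"])
    show "integrable lborel ?w" by (intro integrable_mult_right integrable_inverse_bracket_power)
    show "AE w in lborel. norm (?g (e k) w) \<le> ?w w" for k
    proof (intro always_eventually allI)
      fix w :: 'a
      have "norm (gau ((e k)\<^sup>2 / 2) 0 0 w) \<le> 1" by (simp add: norm_gau)
      then have "norm (?g (e k) w) \<le> 1 * 1 / \<bar>L\<bar> * (K * bracket x ^ M * inverse (bracket w ^ (2 * DIM('a))))"
        unfolding norm_mult norm_divide norm_of_real by (intro mult_mono divide_right_mono K ce) auto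
      then show "norm (?g (e k) w) \<le> ?w w" by simp
    qed
    show "AE w in lborel. (\<lambda>k. ?g (e k) w) \<longlonglongrightarrow> cis (x \<bullet> w) / of_real L * weyl_inner b a v (1/2) x w"
    proof (intro always_eventually allI)
      fix w :: 'a
      have "(\<lambda>k. c (e k)) \<longlonglongrightarrow> (1 + 0\<^sup>2) / 2" unfolding c_def by (intro tendsto_intros e0) simp
      then have "(\<lambda>k. weyl_inner b a v (c (e k)) x w) \<longlonglongrightarrow> weyl_inner b a v (1/2) x w"
        using ce by (intro weyl_inner_tendsto[OF amp]) auto
      moreover have "(\<lambda>k. gau ((e k)\<^sup>2 / 2) 0 0 w) \<longlonglongrightarrow> gau (0\<^sup>2 / 2) 0 0 w"
        unfolding gau_def by (intro tendsto_intros e0) simp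
      then have "(\<lambda>k. gau ((e k)\<^sup>2 / 2) 0 0 w * cis (x \<bullet> w) / of_real L) \<longlonglongrightarrow> 1 * cis (x \<bullet> w) / of_real L"
        unfolding divide_inverse by (intro tendsto_mult tendsto_const) (simp add: gau_def)
      ultimately show "(\<lambda>k. ?g (e k) w) \<longlonglongrightarrow> cis (x \<bullet> w) / of_real L * weyl_inner b a v (1/2) x w"
        by (simp only: mult_1) (rule tendsto_mult)
    qed
  qed measurable
  have "I = (\<integral>w. cis (x \<bullet> w) / of_real L * weyl_inner b a v (1/2) x w \<partial>lborel)"
    by (rule LIMSEQ_unique[OF 1 2])
  then show ?thesis by simp
qed

lemma integrable_amplitude_gau:
  fixes b :: "'a::euclidean_space \<Rightarrow> complex"
  assumes "amplitude b"
  shows "integrable lborel (\<lambda>X. b X * gau 1 0 v X)"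
proof -
  obtain C M where C: "0 \<le> C" "\<And>X. norm (b X) \<le> C * bracket X ^ M"
    using amplitude_bound_0[OF assms] by blast
  have [measurable]: "b \<in> borel_measurable borel"
    using amplitude_continuous[OF assms] by (rule borel_measurable_continuous_onI)
  have [measurable]: "gau 1 0 v \<in> borel_measurable borel"
    by (intro borel_measurable_continuous_onI continuous_intros)
  show ?thesis
  proof (rule Bochner_Integration.integrable_bound)
    show "integrable lborel (\<lambda>X::'a. C * (bracket X ^ M * exp (0 \<bullet> X - 1 * (norm X)\<^sup>2)))"
      by (intro integrable_mult_right integrable_bracket_power_gauss) simp
    show "AE X in lborel. norm (b X * gau 1 0 v X) \<le> norm (C * (bracket X ^ M * exp (0 \<bullet> X - 1 * (norm X)\<^sup>2)))"
      using C by (auto simp: norm_mult norm_gau intro!: always_eventually mult_right_mono simp flip: mult.assoc)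
  qed measurable
qed

text \<open>Before the \<open>y\<close>-integration the Gaussians give no decay in \<open>w\<close>,
  so Fubini is used in two stages: \<open>x\<close> and \<open>w\<close> are exchanged thanks to the
  decay of \<open>weyl_inner\<close>, then the remaining double integral is computed for fixed
  \<open>w\<close>.\<close>

lemma weyl_pairing:
  fixes b :: "'a::euclidean_space \<times> 'a \<Rightarrow> complex"
  assumes amp: "amplitude b"
  shows "(\<integral>x. (\<integral>w. cis (x \<bullet> w) * weyl_inner b (- a) v (1/2) x w \<partial>lborel) * gau (1/2) a v x \<partial>lborel)
    = of_real ((2 * sqrt pi) ^ DIM('a) * exp ((norm a)\<^sup>2)) * (\<integral>X. b X * gau 1 0 (2 *\<^sub>R (v, a)) X \<partial>lborel)"
proof -
  let ?n = "DIM('a)"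
  have cont: "continuous_on UNIV b" by (rule amplitude_continuous[OF amp])
  have b[measurable]: "b \<in> borel_measurable borel"
    using cont by (rule borel_measurable_continuous_onI)
  have g[measurable]: "gau c a u \<in> borel_measurable borel" for c and a u :: 'a
    by (intro borel_measurable_continuous_onI continuous_intros)
  obtain C M where C: "0 \<le> C" "\<And>X. norm (b X) \<le> C * bracket X ^ M"
    using amplitude_bound_0[OF amp] by blast
  obtain K N where K: "\<And>c x w. c \<in> {1/2..1} \<Longrightarrow> norm (weyl_inner b (- a) v c x w) \<le> K * bracket x ^ N * inverse (bracket w ^ (2 * ?n))"
    using weyl_inner_decay[OF amp, of "- a" v] by blast
  let ?F = "\<lambda>(x, w). cis (x \<bullet> w) * weyl_inner b (- a) v (1/2) x w * gau (1/2) a v x"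
  have F: "integrable (lborel \<Otimes>\<^sub>M lborel) ?F"
  proof (rule integrable_pair_dominated[of _ "\<lambda>x. K * (bracket x ^ N * exp (a \<bullet> x - 1/2 * (norm x)\<^sup>2))" "\<lambda>w. inverse (bracket w ^ (2 * ?n))"])
    have [measurable]: "(\<lambda>z. weyl_inner b (- a) v (1/2) (fst z) (snd z)) \<in> borel_measurable (borel \<Otimes>\<^sub>M borel)"
      using borel_measurable_weyl_inner[OF cont, of "- a" v "1/2"] by (simp add: borel_prod)
    show "?F \<in> borel_measurable borel"
      unfolding borel_prod[symmetric] case_prod_beta cis_conv_exp by measurable
    show "integrable lborel (\<lambda>x. K * (bracket x ^ N * exp (a \<bullet> x - 1/2 * (norm x)\<^sup>2)))"
      by (intro integrable_mult_right integrable_bracket_power_gauss) simp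
    show "integrable lborel (\<lambda>w::'a. inverse (bracket w ^ (2 * ?n)))"
      by (rule integrable_inverse_bracket_power)
    show "norm (?F (x, w)) \<le> K * (bracket x ^ N * exp (a \<bullet> x - 1/2 * (norm x)\<^sup>2)) * inverse (bracket w ^ (2 * ?n))" for x w
      using mult_right_mono[OF K[of "1/2" x w], of "exp (a \<bullet> x - 1/2 * (norm x)\<^sup>2)"]
      by (simp add: norm_mult norm_gau mult_ac)
  qed
  have slice: "(\<integral>x. ?F (x, w) \<partial>lborel) = of_real ((2 * sqrt pi) ^ ?n * exp ((norm a)\<^sup>2)) *
      (\<integral>p. b (p, w) * gau 1 0 (2 *\<^sub>R (v, a)) (p, w) \<partial>lborel)" for w
  proof -
    let ?H = "\<lambda>(p, x). b (p, w) * (gau 2 (- 2 *\<^sub>R a) (2 *\<^sub>R (v - w)) p * gau 1 (2 *\<^sub>R (p + a)) (2 *\<^sub>R w) x)"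
    \<comment> \<open>The substitution \<open>y = - x + 2 p\<close> makes \<open>p\<close> the
      midpoint; its Jacobian is \<open>2 ^ ?n\<close>.\<close>
    have inner: "weyl_inner b (- a) v (1/2) x w = of_real (2 ^ ?n) * (\<integral>p. b (p, w) * gau (1/2) (- a) (v - w) (- x + 2 *\<^sub>R p) \<partial>lborel)" for x
    proof -
      have "(\<lambda>y. b ((1/2) *\<^sub>R (x + y), w) * gau (1/2) (- a) (v - w) y) \<in> borel_measurable borel" by measurable
      from lborel_integral_affine[OF this, of 2 "- x"] show ?thesis
        by (simp add: weyl_inner_def scaleR_conv_of_real)
    qed
    \<comment> \<open>From the coefficient of \<open>x\<close> the frequency \<open>v\<close>
      cancels, while \<open>a\<close> and \<open>w\<close> are doubled there; this is the effect of
      choosing the parameters \<open>- a\<close> and \<open>a\<close>.\<close>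
    have square: "cis (x \<bullet> w) * gau (1/2) (- a) (v - w) (- x + 2 *\<^sub>R p) * gau (1/2) a v x
        = gau 2 (- 2 *\<^sub>R a) (2 *\<^sub>R (v - w)) p * gau 1 (2 *\<^sub>R (p + a)) (2 *\<^sub>R w) x" for x p
      unfolding gau_def cis_conv_exp exp_add[symmetric] power2_norm_eq_inner
      by (intro arg_cong[where f=exp])
         (simp add: inner_add_left inner_add_right inner_diff_left inner_diff_right inner_commute algebra_simps)
    have H: "integrable (lborel \<Otimes>\<^sub>M lborel) ?H"
    proof (rule lborel_pair.Fubini_integrable)
      show "?H \<in> borel_measurable (lborel \<Otimes>\<^sub>M lborel)"
        unfolding gau_def case_prod_beta by measurable
      have Hn: "(\<integral>x. norm (?H (p, x)) \<partial>lborel) = sqrt pi ^ ?n * exp ((norm a)\<^sup>2) * (norm (b (p, w)) * exp (0 \<bullet> p - 1 * (norm p)\<^sup>2))" for p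
      proof -
        have "(\<integral>x. norm (?H (p, x)) \<partial>lborel) = norm (b (p, w)) * (exp (- 2 * (a \<bullet> p) - 2 * (norm p)\<^sup>2) *
            (\<integral>x. exp (2 *\<^sub>R (p + a) \<bullet> x - 1 * (norm x)\<^sup>2) \<partial>lborel))"
          by (simp add: norm_mult norm_gau)
        also have "(\<integral>x. exp (2 *\<^sub>R (p + a) \<bullet> x - 1 * (norm x)\<^sup>2) \<partial>lborel) = sqrt pi ^ ?n * exp ((norm (p + a))\<^sup>2)"
          using has_bochner_integral_gauss[of 1 "2 *\<^sub>R (p + a)"] by (simp add: has_bochner_integral_iff power_mult_distrib del: scaleR_add_right)
        also have "exp (- 2 * (a \<bullet> p) - 2 * (norm p)\<^sup>2) * (sqrt pi ^ ?n * exp ((norm (p + a))\<^sup>2))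
            = sqrt pi ^ ?n * (exp (- 2 * (a \<bullet> p) - 2 * (norm p)\<^sup>2) * exp ((norm (p + a))\<^sup>2))" by simp
        \<comment> \<open>Expanding \<open>(norm (p + a))\<^sup>2\<close> cancels the linear term
          and halves the quadratic one, so the sign of \<open>a\<close> no longer matters for
          convergence in \<open>p\<close>.\<close>
        also have "exp (- 2 * (a \<bullet> p) - 2 * (norm p)\<^sup>2) * exp ((norm (p + a))\<^sup>2) = exp ((norm a)\<^sup>2) * exp (0 \<bullet> p - 1 * (norm p)\<^sup>2)"
          unfolding exp_add[symmetric] power2_norm_eq_inner
          by (intro arg_cong[where f=exp]) (simp add: inner_add_left inner_add_right inner_commute)
        finally show ?thesis by (simp only: mult_ac)
      qed
      show "integrable lborel (\<lambda>p. \<integral>x. norm (?H (p, x)) \<partial>lborel)"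
        unfolding Hn
      proof (intro integrable_mult_right, rule Bochner_Integration.integrable_bound)
        show "integrable lborel (\<lambda>p. C * bracket w ^ M * (bracket p ^ M * exp (0 \<bullet> p - 1 * (norm p)\<^sup>2)))"
          by (intro integrable_mult_right integrable_bracket_power_gauss) simp
        show "(\<lambda>p. norm (b (p, w)) * exp (0 \<bullet> p - 1 * (norm p)\<^sup>2)) \<in> borel_measurable lborel" by measurable
        have "norm (b (p, w)) \<le> C * (bracket p * bracket w) ^ M" for p
          by (rule order_trans[OF C(2)]) (intro mult_left_mono power_mono bracket_Pair_le C(1), auto)
        then have "norm (b (p, w)) * exp (0 \<bullet> p - 1 * (norm p)\<^sup>2) \<le> C * (bracket p * bracket w) ^ M * exp (0 \<bullet> p - 1 * (norm p)\<^sup>2)" for p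
          by (intro mult_right_mono) auto
        then show "AE p in lborel. norm (norm (b (p, w)) * exp (0 \<bullet> p - 1 * (norm p)\<^sup>2))
            \<le> norm (C * bracket w ^ M * (bracket p ^ M * exp (0 \<bullet> p - 1 * (norm p)\<^sup>2)))"
          using C(1) by (intro always_eventually allI) (simp add: abs_mult power_mult_distrib mult_ac)
      qed
      show "AE p in lborel. integrable lborel (\<lambda>x. ?H (p, x))"
        by (intro always_eventually allI) (simp, intro impI integrable_mult_right integrable_gau, simp)
    qed
    have "(\<integral>x. ?F (x, w) \<partial>lborel) = (\<integral>x. of_real (2 ^ ?n) * (\<integral>p. ?H (p, x) \<partial>lborel) \<partial>lborel)"
    proof (rule Bochner_Integration.integral_cong[OF refl])
      fix x
      have "?F (x, w) = of_real (2 ^ ?n) * ((\<integral>p. b (p, w) * gau (1/2) (- a) (v - w) (- x + 2 *\<^sub>R p) \<partial>lborel) * (cis (x \<bullet> w) * gau (1/2) a v x))"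
        by (simp add: inner mult_ac)
      also have "\<dots> = of_real (2 ^ ?n) * (\<integral>p. b (p, w) * gau (1/2) (- a) (v - w) (- x + 2 *\<^sub>R p) * (cis (x \<bullet> w) * gau (1/2) a v x) \<partial>lborel)"
        by (simp only: integral_mult_left_zero)
      also have "(\<lambda>p. b (p, w) * gau (1/2) (- a) (v - w) (- x + 2 *\<^sub>R p) * (cis (x \<bullet> w) * gau (1/2) a v x)) = (\<lambda>p. ?H (p, x))"
      proof
        fix p
        have "b (p, w) * gau (1/2) (- a) (v - w) (- x + 2 *\<^sub>R p) * (cis (x \<bullet> w) * gau (1/2) a v x)
            = b (p, w) * (cis (x \<bullet> w) * gau (1/2) (- a) (v - w) (- x + 2 *\<^sub>R p) * gau (1/2) a v x)" by (simp only: mult_ac)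
        then show "b (p, w) * gau (1/2) (- a) (v - w) (- x + 2 *\<^sub>R p) * (cis (x \<bullet> w) * gau (1/2) a v x) = ?H (p, x)"
          by (simp only: square case_prod_conv)
      qed
      finally show "?F (x, w) = of_real (2 ^ ?n) * (\<integral>p. ?H (p, x) \<partial>lborel)" .
    qed
    also have "\<dots> = of_real (2 ^ ?n) * (\<integral>x. (\<integral>p. ?H (p, x) \<partial>lborel) \<partial>lborel)"
      by (rule integral_mult_right_zero)
    also have "(\<integral>x. (\<integral>p. ?H (p, x) \<partial>lborel) \<partial>lborel) = (\<integral>p. (\<integral>x. ?H (p, x) \<partial>lborel) \<partial>lborel)"
      using lborel_pair.Fubini_integral[of "\<lambda>p x. ?H (p, x)"] H by simp
    also have "\<dots> = (\<integral>p. of_real (sqrt pi ^ ?n * exp ((norm a)\<^sup>2)) * (b (p, w) * gau 1 0 (2 *\<^sub>R (v, a)) (p, w)) \<partial>lborel)"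
    proof (rule Bochner_Integration.integral_cong[OF refl])
      fix p
      have "(\<integral>x. ?H (p, x) \<partial>lborel) = b (p, w) * (gau 2 (- 2 *\<^sub>R a) (2 *\<^sub>R (v - w)) p * (\<integral>x. gau 1 (2 *\<^sub>R (p + a)) (2 *\<^sub>R w) x \<partial>lborel))"
        by (simp only: case_prod_conv integral_mult_right_zero)
      also have "(\<integral>x. gau 1 (2 *\<^sub>R (p + a)) (2 *\<^sub>R w) x \<partial>lborel)
          = of_real (sqrt pi ^ ?n) * exp (of_real ((norm (p + a))\<^sup>2 - (norm w)\<^sup>2) + 2 * \<i> * of_real ((p + a) \<bullet> w))"
        by (simp add: integral_gau power_mult_distrib del: scaleR_add_right) (simp add: diff_divide_distrib add_divide_distrib mult.assoc)
      also have "gau 2 (- 2 *\<^sub>R a) (2 *\<^sub>R (v - w)) p * (of_real (sqrt pi ^ ?n) * exp (of_real ((norm (p + a))\<^sup>2 - (norm w)\<^sup>2) + 2 * \<i> * of_real ((p + a) \<bullet> w)))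
          = of_real (sqrt pi ^ ?n) * (gau 2 (- 2 *\<^sub>R a) (2 *\<^sub>R (v - w)) p * exp (of_real ((norm (p + a))\<^sup>2 - (norm w)\<^sup>2) + 2 * \<i> * of_real ((p + a) \<bullet> w)))"
        by (simp only: mult_ac)
      also have "gau 2 (- 2 *\<^sub>R a) (2 *\<^sub>R (v - w)) p * exp (of_real ((norm (p + a))\<^sup>2 - (norm w)\<^sup>2) + 2 * \<i> * of_real ((p + a) \<bullet> w))
          = exp (of_real ((norm a)\<^sup>2)) * gau 1 0 (2 *\<^sub>R (v, a)) (p, w)"
        unfolding gau_def exp_add[symmetric] power2_norm_eq_inner
        by (intro arg_cong[where f=exp])
           (simp add: inner_add_left inner_add_right inner_diff_left inner_diff_right inner_commute algebra_simps)
      finally show "(\<integral>x. ?H (p, x) \<partial>lborel) = of_real (sqrt pi ^ ?n * exp ((norm a)\<^sup>2)) * (b (p, w) * gau 1 0 (2 *\<^sub>R (v, a)) (p, w))"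
        by (simp only: of_real_mult exp_of_real mult_ac)
    qed
    finally show ?thesis
      by (simp only: integral_mult_right_zero power_mult_distrib of_real_mult mult.assoc)
  qed
  have "(\<integral>x. (\<integral>w. cis (x \<bullet> w) * weyl_inner b (- a) v (1/2) x w \<partial>lborel) * gau (1/2) a v x \<partial>lborel)
      = (\<integral>x. (\<integral>w. ?F (x, w) \<partial>lborel) \<partial>lborel)" by simp
  also have "\<dots> = (\<integral>w. (\<integral>x. ?F (x, w) \<partial>lborel) \<partial>lborel)"
    using lborel_pair.Fubini_integral[of "\<lambda>x w. ?F (x, w)"] F by simp
  also have "\<dots> = of_real ((2 * sqrt pi) ^ ?n * exp ((norm a)\<^sup>2)) * (\<integral>w. (\<integral>p. b (p, w) * gau 1 0 (2 *\<^sub>R (v, a)) (p, w) \<partial>lborel) \<partial>lborel)"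
    by (simp only: slice integral_mult_right_zero)
  also have "(\<integral>w. (\<integral>p. b (p, w) * gau 1 0 (2 *\<^sub>R (v, a)) (p, w) \<partial>lborel) \<partial>lborel) = (\<integral>X. b X * gau 1 0 (2 *\<^sub>R (v, a)) X \<partial>lborel)"
  proof -
    have "integrable (lborel \<Otimes>\<^sub>M lborel) (\<lambda>(p, w). b (p, w) * gau 1 0 (2 *\<^sub>R (v, a)) (p, w))"
      using integrable_amplitude_gau[OF amp, of "2 *\<^sub>R (v, a)"] by (simp add: lborel_prod case_prod_beta')
    from lborel_pair.integral_snd[OF this] show ?thesis by (simp add: lborel_prod case_prod_beta')
  qed
  finally show ?thesis .
qed

section \<open>Equality of the Weyl symbol and Mehler's symbol\<close>

lemma continuous_on_mehler_symbol: "continuous_on UNIV (mehler n :: 'a::euclidean_space \<Rightarrow> complex)"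
proof -
  have "continuous_on (UNIV \<times> cbox 0 1) (\<lambda>(X::'a, r). of_real (mehler_weight n r) * (\<Prod>i\<in>Basis. gherm 0 (mehler_slope r) (X \<bullet> i)))"
    unfolding case_prod_beta by (intro continuous_intros)
  from integral_continuous_on_param[OF this] show ?thesis
    unfolding mehler_deriv_0[symmetric] by (simp add: mehler_deriv_def[abs_def])
qed

lemma norm_mehler_le: "\<exists>K. \<forall>X::'a::euclidean_space. norm (mehler n X) \<le> K"
proof -
  let ?K = "2 ^ n * 4 * exp (1/2) * (exp 3 * sqrt (2 * real DIM('a)))"
  have "norm (mehler n X) \<le> ?K" for X :: 'a
  proof -
    have "norm (mehler n X) \<le> ?K * bracket X powr - 2"
      using norm_mehler_deriv_le[of 0 n "\<lambda>_. 0" X] by (simp add: mehler_deriv_0 multi_size_def multi_fact_def)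
    also have "\<dots> \<le> ?K * bracket X powr 0"
      using bracket_ge_1[of X] by (intro mult_left_mono powr_mono) auto
    finally show ?thesis by simp
  qed
  then show ?thesis by blast
qed

text \<open>The difference of the two symbols times \<open>gau 1 0 0\<close> is continuous, bounded
  and integrable, and its Fourier transform vanishes because both sides reduce to the same
  \<open>r\<close>-integral. Fourier uniqueness applies, and the Gaussian has no zeros.\<close>

lemma weyl_symbol_eq_mehler:
  fixes b :: "(real^'n) \<times> (real^'n) \<Rightarrow> complex"
  assumes "weyl_symbol (converse harmonic_oscillator) b"
  shows "b = mehler CARD('n)"
proof -
  let ?n = "CARD('n)"
  have amp: "amplitude b" using assms by (simp add: weyl_symbol_def)
  have cont: "continuous_on UNIV b" by (rule amplitude_continuous[OF amp])
  have transform: "(\<integral>X. b X * gau 1 0 (2 *\<^sub>R (v, a)) X \<partial>lborel) = (\<integral>X. mehler ?n X * gau 1 0 (2 *\<^sub>R (v, a)) X \<partial>lborel)"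
    for a v :: "real^'n"
  proof -
    let ?f = "gau (1/2) (- a) v" let ?L = "(2 * pi) ^ ?n"
    let ?J = "\<lambda>x. \<integral>w. cis (x \<bullet> w) * weyl_inner b (- a) v (1/2) x w \<partial>lborel"
    let ?T = "\<integral>r. indicator {0..1} r *\<^sub>R complex_of_real (r ^ (?n - 1) * exp (- r\<^sup>2 * ((norm a)\<^sup>2 + (norm v)\<^sup>2) / 2)) \<partial>lborel"
    let ?B = "\<integral>X. b X * gau 1 0 (2 *\<^sub>R (v, a)) X \<partial>lborel"
    obtain u where u: "(u, ?f) \<in> harmonic_oscillator" and
      osc: "AE x in lborel. has_oscillatory_integral
         (\<lambda>(y, w). cis ((x - y) \<bullet> w) * b ((1/2) *\<^sub>R (x + y), w) * ?f y / of_real ?L) (u x)"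
      using assms schwartz_gau[of "1/2" "- a" v] unfolding weyl_symbol_def by auto
    \<comment> \<open>The oscillatory integral represents \<open>u\<close> only almost everywhere,
      which is enough for the pairing.\<close>
    have "AE x in lborel. u x * gau (1/2) a v x = ?J x / of_real ?L * gau (1/2) a v x"
      using osc by eventually_elim (drule oscillatory_integral_weyl[OF amp], simp only:)
    then have "(\<integral>x. u x * gau (1/2) a v x \<partial>lborel) = (\<integral>x. ?J x / of_real ?L * gau (1/2) a v x \<partial>lborel)"
    proof (rule integral_cong_AE[rotated 2])
      have [measurable]: "gau (1/2) a v \<in> borel_measurable borel"
        by (intro borel_measurable_continuous_onI continuous_intros)
      have [measurable]: "u \<in> borel_measurable borel"
        using u by (auto simp: harmonic_oscillator_def square_integrable_def)
      have [measurable]: "(\<lambda>z. weyl_inner b (- a) v (1/2) (fst z) (snd z)) \<in> borel_measurable (borel \<Otimes>\<^sub>M borel)"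
        using borel_measurable_weyl_inner[OF cont, of "- a" v "1/2"] by (simp add: borel_prod)
      have "(\<lambda>(x, w). cis (x \<bullet> w) * weyl_inner b (- a) v (1/2) x w) \<in> borel_measurable (borel \<Otimes>\<^sub>M lborel)"
        unfolding case_prod_beta cis_conv_exp by measurable
      then have [measurable]: "?J \<in> borel_measurable borel"
        by (rule lborel.borel_measurable_lebesgue_integral)
      show "(\<lambda>x. u x * gau (1/2) a v x) \<in> borel_measurable lborel"
        "(\<lambda>x. ?J x / of_real ?L * gau (1/2) a v x) \<in> borel_measurable lborel" by measurable
    qed
    also have "\<dots> = (\<integral>x. ?J x * gau (1/2) a v x / of_real ?L \<partial>lborel)"
      by (simp only: times_divide_eq_left)
    also have "\<dots> = (\<integral>x. ?J x * gau (1/2) a v x \<partial>lborel) / of_real ?L"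
      by (rule integral_divide_zero)
    also have "\<dots> = of_real ((2 * sqrt pi) ^ ?n * exp ((norm a)\<^sup>2) / ?L) * ?B"
      unfolding weyl_pairing[OF amp] by simp
    finally have "of_real ((2 * sqrt pi) ^ ?n * exp ((norm a)\<^sup>2) / ?L) * ?B
        = of_real (sqrt pi ^ ?n * exp (((norm a)\<^sup>2 - (norm v)\<^sup>2) / 2)) * ?T"
      using harmonic_oscillator_coherent[OF u] by simp
    moreover have "(2 * sqrt pi) ^ ?n / ?L = 1 / sqrt pi ^ ?n"
    proof -
      have "?L = (2 * sqrt pi) ^ ?n * sqrt pi ^ ?n"
        by (subst power_mult_distrib[symmetric]) (simp add: mult.assoc)
      then show ?thesis by simp
    qed
    from arg_cong[OF this, of "\<lambda>t. t * exp ((norm a)\<^sup>2)"]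
    have "(2 * sqrt pi) ^ ?n * exp ((norm a)\<^sup>2) / ?L = exp ((norm a)\<^sup>2) / sqrt pi ^ ?n"
      by (simp only: times_divide_eq_left mult_1)
    ultimately have eq: "of_real (exp ((norm a)\<^sup>2) / sqrt pi ^ ?n) * ?B
        = of_real (sqrt pi ^ ?n * exp (((norm a)\<^sup>2 - (norm v)\<^sup>2) / 2)) * ?T" by (simp only:)
    have "?B = of_real (sqrt pi ^ ?n / exp ((norm a)\<^sup>2)) * (of_real (exp ((norm a)\<^sup>2) / sqrt pi ^ ?n) * ?B)"
      by simp
    also have "\<dots> = of_real ((sqrt pi ^ ?n * sqrt pi ^ ?n) * (exp (((norm a)\<^sup>2 - (norm v)\<^sup>2) / 2) / exp ((norm a)\<^sup>2))) * ?T"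
      unfolding eq by simp
    also have "sqrt pi ^ ?n * sqrt pi ^ ?n = pi ^ ?n" by (subst power_mult_distrib[symmetric]) simp
    \<comment> \<open>Dividing by \<open>exp ((norm a)\<^sup>2)\<close> from
      \<open>weyl_pairing\<close> makes the exponent symmetric in \<open>a\<close> and
      \<open>v\<close>, hence a function of the phase space norm as in
      \<open>mehler_transform\<close>.\<close>
    also have "exp (((norm a)\<^sup>2 - (norm v)\<^sup>2) / 2) / exp ((norm a)\<^sup>2) = exp (- (norm (v, a))\<^sup>2 / 2)"
      unfolding exp_diff[symmetric] by (simp add: norm_Pair field_simps)
    also have "of_real (pi ^ ?n * exp (- (norm (v, a))\<^sup>2 / 2)) * ?T = (\<integral>X. mehler ?n X * gau 1 0 (2 *\<^sub>R (v, a)) X \<partial>lborel)"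
      by (subst mehler_transform) (simp_all add: norm_Pair add.commute)
    finally show ?thesis .
  qed
  obtain K where K: "\<And>X::(real^'n) \<times> (real^'n). norm (mehler ?n X) \<le> K" using norm_mehler_le by blast
  obtain C M where C: "0 \<le> C" "\<And>X. norm (b X) \<le> C * bracket X ^ M"
    using amplitude_bound_0[OF amp] by blast
  obtain C' where C': "\<And>X::(real^'n) \<times> (real^'n). bracket X ^ M * norm (gau 1 0 0 X) \<le> C'"
    using gpoly_decay[OF _ gpoly.gau, of 1 M 0 0] by auto
  define F where "F X = (b X - mehler ?n X) * gau 1 0 0 X" for X
  have ib: "integrable lborel (\<lambda>X. b X * gau 1 0 z X)" for z by (rule integrable_amplitude_gau[OF amp])
  have im: "integrable lborel (\<lambda>X. mehler ?n X * gau 1 0 z X)" for z :: "(real^'n) \<times> (real^'n)"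
  proof (rule Bochner_Integration.integrable_bound)
    show "integrable lborel (\<lambda>X. K * norm (gau 1 0 z X))"
      by (intro integrable_mult_right integrable_norm integrable_gau) simp
    show "(\<lambda>X. mehler ?n X * gau 1 0 z X) \<in> borel_measurable lborel"
      by (simp, intro borel_measurable_continuous_onI continuous_intros continuous_on_mehler_symbol)
    have "0 \<le> K" using K norm_ge_zero order_trans by blast
    then show "AE X in lborel. norm (mehler ?n X * gau 1 0 z X) \<le> norm (K * norm (gau 1 0 z X))"
      using K by (auto simp: norm_mult intro!: always_eventually mult_right_mono)
  qed
  have "F X = 0" for X
  proof (rule fourier_uniqueness[of F "C * C' + K"])
    show "continuous_on UNIV F"
      unfolding F_def[abs_def] by (intro continuous_intros cont continuous_on_mehler_symbol)
    show "norm (F X) \<le> C * C' + K" for X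
    proof -
      have "norm (F X) \<le> norm (b X) * norm (gau 1 0 0 X) + norm (mehler ?n X) * norm (gau 1 0 0 X)"
        unfolding F_def norm_mult distrib_right[symmetric] by (intro mult_right_mono norm_triangle_ineq4) auto
      also have "\<dots> \<le> C * bracket X ^ M * norm (gau 1 0 0 X) + K * 1"
        using C(1) K[of X] order_trans[OF norm_ge_zero K]
        by (intro add_mono mult_right_mono mult_mono C(2)) (auto simp: norm_gau)
      also have "\<dots> \<le> C * C' + K"
        using mult_left_mono[OF C'[of X] C(1)] by (simp add: mult.assoc)
      finally show ?thesis .
    qed
    show "integrable lborel F"
      unfolding F_def[abs_def] left_diff_distrib using ib im by (intro Bochner_Integration.integrable_diff)
    fix z :: "(real^'n) \<times> (real^'n)"
    have z: "z = 2 *\<^sub>R ((1/2) *\<^sub>R fst z, (1/2) *\<^sub>R snd z)" by (simp add: prod_eq_iff)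
    have "(\<integral>X. F X * gau 0 0 z X \<partial>lborel) = (\<integral>X. b X * gau 1 0 z X - mehler ?n X * gau 1 0 z X \<partial>lborel)"
      by (simp add: F_def mult.assoc gau_mult left_diff_distrib)
    also have "\<dots> = (\<integral>X. b X * gau 1 0 z X \<partial>lborel) - (\<integral>X. mehler ?n X * gau 1 0 z X \<partial>lborel)"
      by (rule Bochner_Integration.integral_diff[OF ib im])
    also have "\<dots> = 0" by (subst (1 2) z) (simp only: transform diff_self)
    finally show "(\<integral>X. F X * gau 0 0 z X \<partial>lborel) = 0" .
  qed
  then show ?thesis by (simp add: F_def fun_eq_iff gau_def)
qed

theorem theorem3p1:
  fixes b :: "(real^'n) \<times> (real^'n) \<Rightarrow> complex"
  assumes "weyl_symbol (converse harmonic_oscillator) b"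
  shows "\<exists>C>0. \<forall>X. \<forall>\<alpha> :: (real^'n) \<times> (real^'n) \<Rightarrow> nat. \<forall>s\<in>{0..1}.
    norm (multi_deriv \<alpha> b X) \<le>
      C ^ (multi_size \<alpha> + 1) * real (multi_fact \<alpha>) powr ((s + 1) / 2)
        * bracket X powr (- 2 - s * real (multi_size \<alpha>))"
proof (intro exI conjI allI ballI)
  let ?C = "2 ^ CARD('n) * 4 * exp (1/2) * (exp 3 * sqrt (2 * real DIM((real^'n) \<times> (real^'n))))"
  show "0 < ?C" by simp
  have "smooth b" using assms by (simp add: weyl_symbol_def amplitude_def)
  from multi_deriv_mehler[OF this weyl_symbol_eq_mehler[OF assms]]
  show "norm (multi_deriv \<alpha> b X) \<le>
      ?C ^ (multi_size \<alpha> + 1) * real (multi_fact \<alpha>) powr ((s + 1) / 2)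
        * bracket X powr (- 2 - s * real (multi_size \<alpha>))"
    if "s \<in> {0..1}" for X and \<alpha> :: "(real^'n) \<times> (real^'n) \<Rightarrow> nat" and s :: real
    using norm_mehler_deriv_le[OF that, of "CARD('n)" \<alpha> X] by (simp only:)
qed

end
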